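(* Let $T_1,T_2$ be commuting contractions on a finite-dimensional Hilbert space $\mathcal H$ with $T_1$ completely non-unitary, and let $d_1=\dim(I-T_1T_1^* )^{1/2}\mathcal H$. For every unitary $U\in\mathcal U_{(T_1,T_2)}$, $\varphi_{U^*}(S)$ is an isometric analytic Toeplitz operator on $H^2(\mathbb D)\otimes\mathbb C^{d_1}$, and for every $k\in\mathbb N$ and $[p_{rs}]_k\in M_k(\mathbb C[z,w])$, $$\|[p_{rs}(T_1,T_2)]_k\|\le\|[p_{rs}(B_1\otimes I_{\mathbb C^{d_1}},\varphi_{U^*}(B_1))]_k\|,$$ where $B_1=P_{\mathcal N_{T_1}}S|_{\mathcal N_{T_1}}$ is the universal model of $T_1$.
   Context: $S$ is the unilateral shift on $H^2=H^2(\mathbb D)$. For a completely non-unitary contraction $T$ on a finite-dimensional space (equivalently, no eigenvalues of modulus 1), with minimal polynomial $m_T(z)=\prod_{i=1}^k(z-\lambda_i)^{n_i}$ ($|\lambda_i|<1$), let $b_T(z)=\prod_i\big(\frac{z-\lambda_i}{1-\bar\lambda_iz}\big)^{n_i}$, $\mathcal N_T=H^2\ominus b_TH^2$, and $B_T=P_{\mathcal N_T}S|_{\mathcal N_T}$ (the universal model of $T$). For a contraction $T$, $\Delta_T=(I-TT^* )^{1/2}$, $\mathcal D_T=\overline{\Delta_T\mathcal H}$. For commuting contractions $T,T'$, $\mathcal U_{(T,T')}$ is the set of unitaries $U:\mathcal D_T\oplus\mathcal D_{T'}\to\mathcal D_T\oplus\mathcal D_{T'}$ extending $(\Delta_Th,\Delta_{T'}T^*h)\mapsto(\Delta_TT'^*h,\Delta_{T'}h)$.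 For $U=\begin{bmatrix}A&B\\C&D\end{bmatrix}$ ($A\in B(\mathcal D_T)$, $B:\mathcal D_{T'}\to\mathcal D_T$, $C:\mathcal D_T\to\mathcal D_{T'}$, $D\in B(\mathcal D_{T'})$), $\varphi_{U^*}(z)=A^*+zC^*(I-zD^* )^{-1}B^*$, $\varphi_{U^*}(S)$ is the corresponding multiplication operator on $H^2\otimes\mathcal D_T$, and $\varphi_{U^*}(B_T)=P_{\mathcal N_T\otimes\mathcal D_T}\varphi_{U^*}(S)|_{\mathcal N_T\otimes\mathcal D_T}$. An analytic Toeplitz operator is one commuting with $S\otimes I$. *)

theory Defs
  imports "HOL-Analysis.Analysis" "HOL-Computational_Algebra.Computational_Algebra" "HOL-Library.Function_Algebras"
begin

definition l2 :: "('a \<Rightarrow> complex) \<Rightarrow> bool" where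
  "l2 x \<longleftrightarrow> (\<lambda>i. (cmod (x i))^2) summable_on UNIV"

definition l2_inner :: "('a \<Rightarrow> complex) \<Rightarrow> ('a \<Rightarrow> complex) \<Rightarrow> complex" where
  "l2_inner x y = (\<Sum>\<^sub>\<infinity>i. x i * cnj (y i))"

definition l2_norm :: "('a \<Rightarrow> complex) \<Rightarrow> real" where
  "l2_norm x = sqrt (\<Sum>\<^sub>\<infinity>i. (cmod (x i))^2)"

definition scl :: "complex \<Rightarrow> ('a \<Rightarrow> complex) \<Rightarrow> ('a \<Rightarrow> complex)" where
  "scl c x = (\<lambda>i. c * x i)"

definition csubspace :: "('a \<Rightarrow> complex) set \<Rightarrow> bool" where
  "csubspace M \<longleftrightarrow> 0 \<in> M \<and> (\<forall>x\<in>M. \<forall>y\<in>M. x + y \<in> M) \<and> (\<forall>c. \<forall>x\<in>M. scl c x \<in> M)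
     \<and> M \<subseteq> Collect l2"

definition l2_closure :: "('a \<Rightarrow> complex) set \<Rightarrow> ('a \<Rightarrow> complex) set" where
  "l2_closure S = {x. l2 x \<and> (\<forall>e>0. \<exists>y\<in>S. l2_norm (x - y) < e)}"

definition cspan :: "('a \<Rightarrow> complex) set \<Rightarrow> ('a \<Rightarrow> complex) set" where
  "cspan S = \<Inter>{M. csubspace M \<and> S \<subseteq> M}"

definition op_linear :: "('a \<Rightarrow> complex) set \<Rightarrow> (('a \<Rightarrow> complex) \<Rightarrow> ('b \<Rightarrow> complex)) \<Rightarrow> bool" where
  "op_linear M F \<longleftrightarrow> (\<forall>x\<in>M. \<forall>y\<in>M. F (x + y) = F x + F y) \<and> (\<forall>c. \<forall>x\<in>M. F (scl c x) = scl c (F x))"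

definition adj_on :: "('a \<Rightarrow> complex) set \<Rightarrow> (('a \<Rightarrow> complex) \<Rightarrow> ('b \<Rightarrow> complex))
    \<Rightarrow> ('b \<Rightarrow> complex) \<Rightarrow> ('a \<Rightarrow> complex)" where
  "adj_on M F y = (THE z. z \<in> M \<and> (\<forall>x\<in>M. l2_inner (F x) y = l2_inner x z))"

definition proj :: "('a \<Rightarrow> complex) set \<Rightarrow> ('a \<Rightarrow> complex) \<Rightarrow> ('a \<Rightarrow> complex)" where
  "proj M x = (THE y. y \<in> M \<and> (\<forall>z\<in>M. l2_inner (x - y) z = 0))"

definition hadj :: "(('i::finite \<Rightarrow> complex) \<Rightarrow> ('i \<Rightarrow> complex)) \<Rightarrow> ('i \<Rightarrow> complex) \<Rightarrow> ('i \<Rightarrow> complex)" where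
  "hadj T = adj_on UNIV T"

definition contraction :: "(('i::finite \<Rightarrow> complex) \<Rightarrow> ('i \<Rightarrow> complex)) \<Rightarrow> bool" where
  "contraction T \<longleftrightarrow> op_linear UNIV T \<and> (\<forall>x. l2_norm (T x) \<le> l2_norm x)"

definition positive_op :: "(('i::finite \<Rightarrow> complex) \<Rightarrow> ('i \<Rightarrow> complex)) \<Rightarrow> bool" where
  "positive_op G \<longleftrightarrow> op_linear UNIV G \<and> (\<forall>x y. l2_inner (G x) y = l2_inner x (G y))
     \<and> (\<forall>x. 0 \<le> Re (l2_inner (G x) x))"

definition op_sqrt :: "(('i::finite \<Rightarrow> complex) \<Rightarrow> ('i \<Rightarrow> complex)) \<Rightarrow> ('i \<Rightarrow> complex) \<Rightarrow> ('i \<Rightarrow> complex)" where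
  "op_sqrt F = (THE G. positive_op G \<and> (\<forall>x. G (G x) = F x))"

definition defect :: "(('i::finite \<Rightarrow> complex) \<Rightarrow> ('i \<Rightarrow> complex)) \<Rightarrow> ('i \<Rightarrow> complex) \<Rightarrow> ('i \<Rightarrow> complex)" where
  "defect T = op_sqrt (\<lambda>x. x - T (hadj T x))"

definition defect_space :: "(('i::finite \<Rightarrow> complex) \<Rightarrow> ('i \<Rightarrow> complex)) \<Rightarrow> ('i \<Rightarrow> complex) set" where
  "defect_space T = l2_closure (range (defect T))"

definition cnu :: "(('i::finite \<Rightarrow> complex) \<Rightarrow> ('i \<Rightarrow> complex)) \<Rightarrow> bool" where
  "cnu T \<longleftrightarrow> (\<forall>M. csubspace M \<and> l2_closure M \<subseteq> M \<and> (\<forall>x\<in>M. T x \<in> M \<and> hadj T x \<in> M)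
      \<and> (\<forall>x\<in>M. hadj T (T x) = x \<and> T (hadj T x) = x) \<longrightarrow> M \<subseteq> {0})"

definition op_poly :: "complex poly \<Rightarrow> (('a \<Rightarrow> complex) \<Rightarrow> ('a \<Rightarrow> complex)) \<Rightarrow> ('a \<Rightarrow> complex) \<Rightarrow> ('a \<Rightarrow> complex)" where
  "op_poly p T x = (\<Sum>i\<le>degree p. scl (coeff p i) ((T ^^ i) x))"

definition min_poly :: "(('i::finite \<Rightarrow> complex) \<Rightarrow> ('i \<Rightarrow> complex)) \<Rightarrow> complex poly" where
  "min_poly T = (THE p. lead_coeff p = 1 \<and> (\<forall>x. op_poly p T x = 0)
     \<and> (\<forall>q. q \<noteq> 0 \<and> (\<forall>x. op_poly q T x = 0) \<longrightarrow> degree p \<le> degree q))"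

definition blaschke_fps :: "(('i::finite \<Rightarrow> complex) \<Rightarrow> ('i \<Rightarrow> complex)) \<Rightarrow> complex fps" where
  "blaschke_fps T = (let m = min_poly T in
     (\<Prod>a\<in>{a. poly m a = 0}.
        ((fps_X - fps_const a) * inverse (1 - fps_const (cnj a) * fps_X)) ^ order a m))"

section \<open>Hardy space H^2 (as Taylor coefficient sequences), model space, shift\<close>

definition H2 :: "(nat \<Rightarrow> complex) set" where
  "H2 = Collect l2"

definition mult_fps :: "complex fps \<Rightarrow> (nat \<Rightarrow> complex) \<Rightarrow> (nat \<Rightarrow> complex)" where
  "mult_fps b f = (\<lambda>n. (b * Abs_fps f) $ n)"

definition model_space :: "(('i::finite \<Rightarrow> complex) \<Rightarrow> ('i \<Rightarrow> complex)) \<Rightarrow> (nat \<Rightarrow> complex) set" where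
  "model_space T = {x \<in> H2. \<forall>f\<in>H2. l2_inner x (mult_fps (blaschke_fps T) f) = 0}"

definition shift :: "(nat \<Rightarrow> complex) \<Rightarrow> (nat \<Rightarrow> complex)" where
  "shift x = (\<lambda>n. if n = 0 then 0 else x (n - 1))"

definition univ_model :: "(('i::finite \<Rightarrow> complex) \<Rightarrow> ('i \<Rightarrow> complex)) \<Rightarrow> (nat \<Rightarrow> complex) \<Rightarrow> (nat \<Rightarrow> complex)" where
  "univ_model T = (\<lambda>x. proj (model_space T) (shift x))"

definition tensor_sub :: "(nat \<Rightarrow> complex) set \<Rightarrow> ('i \<Rightarrow> complex) set \<Rightarrow> (nat \<times> 'i \<Rightarrow> complex) set" where
  "tensor_sub M K = l2_closure (cspan {(\<lambda>(n, i). f n * v i) | f v. f \<in> M \<and> v \<in> K})"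

definition ampl :: "((nat \<Rightarrow> complex) \<Rightarrow> (nat \<Rightarrow> complex)) \<Rightarrow> (nat \<times> 'i \<Rightarrow> complex) \<Rightarrow> (nat \<times> 'i \<Rightarrow> complex)" where
  "ampl A x = (\<lambda>(n, i). A (\<lambda>m. x (m, i)) n)"

definition dsum :: "('i \<Rightarrow> complex) \<Rightarrow> ('i \<Rightarrow> complex) \<Rightarrow> ('i + 'i \<Rightarrow> complex)" where
  "dsum x y = case_sum x y"

definition dspace :: "(('i::finite \<Rightarrow> complex) \<Rightarrow> ('i \<Rightarrow> complex)) \<Rightarrow> (('i \<Rightarrow> complex) \<Rightarrow> ('i \<Rightarrow> complex))
    \<Rightarrow> ('i + 'i \<Rightarrow> complex) set" where
  "dspace T T' = {z. z \<circ> Inl \<in> defect_space T \<and> z \<circ> Inr \<in> defect_space T'}"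

definition unitary_on :: "('a \<Rightarrow> complex) set \<Rightarrow> (('a \<Rightarrow> complex) \<Rightarrow> ('a \<Rightarrow> complex)) \<Rightarrow> bool" where
  "unitary_on M U \<longleftrightarrow> op_linear M U \<and> U ` M = M \<and> (\<forall>x\<in>M. l2_norm (U x) = l2_norm x)"

definition U_set :: "(('i::finite \<Rightarrow> complex) \<Rightarrow> ('i \<Rightarrow> complex)) \<Rightarrow> (('i \<Rightarrow> complex) \<Rightarrow> ('i \<Rightarrow> complex))
    \<Rightarrow> (('i + 'i \<Rightarrow> complex) \<Rightarrow> ('i + 'i \<Rightarrow> complex)) set" where
  "U_set T T' = {U. unitary_on (dspace T T') U \<and>
     (\<forall>h. U (dsum (defect T h) (defect T' (hadj T h))) = dsum (defect T (hadj T' h)) (defect T' h))}"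

definition blkA :: "(('i + 'i \<Rightarrow> complex) \<Rightarrow> ('i + 'i \<Rightarrow> complex)) \<Rightarrow> ('i \<Rightarrow> complex) \<Rightarrow> ('i \<Rightarrow> complex)" where
  "blkA U x = U (dsum x 0) \<circ> Inl"
definition blkB :: "(('i + 'i \<Rightarrow> complex) \<Rightarrow> ('i + 'i \<Rightarrow> complex)) \<Rightarrow> ('i \<Rightarrow> complex) \<Rightarrow> ('i \<Rightarrow> complex)" where
  "blkB U y = U (dsum 0 y) \<circ> Inl"
definition blkC :: "(('i + 'i \<Rightarrow> complex) \<Rightarrow> ('i + 'i \<Rightarrow> complex)) \<Rightarrow> ('i \<Rightarrow> complex) \<Rightarrow> ('i \<Rightarrow> complex)" where
  "blkC U x = U (dsum x 0) \<circ> Inr"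
definition blkD :: "(('i + 'i \<Rightarrow> complex) \<Rightarrow> ('i + 'i \<Rightarrow> complex)) \<Rightarrow> ('i \<Rightarrow> complex) \<Rightarrow> ('i \<Rightarrow> complex)" where
  "blkD U y = U (dsum 0 y) \<circ> Inr"

text \<open>Taylor coefficients of phi_{U^*}(z) = A^* + z C^* (I - z D^*)^{-1} B^*:
  Phi_0 = A^*, Phi_(k+1) = C^* (D^*)^k B^*  (operators on D_T).\<close>
definition transfer_coeff :: "(('i::finite \<Rightarrow> complex) \<Rightarrow> ('i \<Rightarrow> complex)) \<Rightarrow> (('i \<Rightarrow> complex) \<Rightarrow> ('i \<Rightarrow> complex))
    \<Rightarrow> (('i + 'i \<Rightarrow> complex) \<Rightarrow> ('i + 'i \<Rightarrow> complex)) \<Rightarrow> nat \<Rightarrow> ('i \<Rightarrow> complex) \<Rightarrow> ('i \<Rightarrow> complex)" where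
  "transfer_coeff T T' U k =
     (if k = 0 then adj_on (defect_space T) (blkA U)
      else adj_on (defect_space T) (blkC U) \<circ> (adj_on (defect_space T') (blkD U) ^^ (k - 1))
             \<circ> adj_on (defect_space T') (blkB U))"

definition transfer_mult :: "(('i::finite \<Rightarrow> complex) \<Rightarrow> ('i \<Rightarrow> complex)) \<Rightarrow> (('i \<Rightarrow> complex) \<Rightarrow> ('i \<Rightarrow> complex))
    \<Rightarrow> (('i + 'i \<Rightarrow> complex) \<Rightarrow> ('i + 'i \<Rightarrow> complex)) \<Rightarrow> (nat \<times> 'i \<Rightarrow> complex) \<Rightarrow> (nat \<times> 'i \<Rightarrow> complex)" where
  "transfer_mult T T' U x = (\<lambda>(n, i). (\<Sum>k\<le>n. transfer_coeff T T' U k (\<lambda>j. x (n - k, j))) i)"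

definition H2D :: "(('i::finite \<Rightarrow> complex) \<Rightarrow> ('i \<Rightarrow> complex)) \<Rightarrow> (nat \<times> 'i \<Rightarrow> complex) set" where
  "H2D T = tensor_sub H2 (defect_space T)"

definition NTD :: "(('i::finite \<Rightarrow> complex) \<Rightarrow> ('i \<Rightarrow> complex)) \<Rightarrow> (nat \<times> 'i \<Rightarrow> complex) set" where
  "NTD T = tensor_sub (model_space T) (defect_space T)"

definition transfer_model :: "(('i::finite \<Rightarrow> complex) \<Rightarrow> ('i \<Rightarrow> complex)) \<Rightarrow> (('i \<Rightarrow> complex) \<Rightarrow> ('i \<Rightarrow> complex))
    \<Rightarrow> (('i + 'i \<Rightarrow> complex) \<Rightarrow> ('i + 'i \<Rightarrow> complex)) \<Rightarrow> (nat \<times> 'i \<Rightarrow> complex) \<Rightarrow> (nat \<times> 'i \<Rightarrow> complex)" where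
  "transfer_model T T' U x = proj (NTD T) (transfer_mult T T' U x)"

definition isometric_analytic_toeplitz :: "(nat \<times> 'i \<Rightarrow> complex) set
    \<Rightarrow> ((nat \<times> 'i \<Rightarrow> complex) \<Rightarrow> (nat \<times> 'i \<Rightarrow> complex)) \<Rightarrow> bool" where
  "isometric_analytic_toeplitz M F \<longleftrightarrow> op_linear M F \<and>
     (\<forall>x\<in>M. F x \<in> M \<and> l2_norm (F x) = l2_norm x \<and> F (ampl shift x) = ampl shift (F x))"

text \<open>p(X,Y) = sum_{i,j} c_{ij} X^i Y^j, where z is the inner and w the outer variable.\<close>
definition eval2 :: "complex poly poly \<Rightarrow> (('a \<Rightarrow> complex) \<Rightarrow> ('a \<Rightarrow> complex))
    \<Rightarrow> (('a \<Rightarrow> complex) \<Rightarrow> ('a \<Rightarrow> complex)) \<Rightarrow> ('a \<Rightarrow> complex) \<Rightarrow> ('a \<Rightarrow> complex)" where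
  "eval2 p X Y x = (\<Sum>j\<le>degree p. \<Sum>i\<le>degree (coeff p j). scl (coeff (coeff p j) i) ((X ^^ i) ((Y ^^ j) x)))"

definition block_norm :: "nat \<Rightarrow> ('a \<Rightarrow> complex) set \<Rightarrow> (nat \<Rightarrow> nat \<Rightarrow> ('a \<Rightarrow> complex) \<Rightarrow> ('a \<Rightarrow> complex)) \<Rightarrow> real" where
  "block_norm k M P = Sup {sqrt (\<Sum>r<k. (l2_norm (\<Sum>s<k. P r s (x s)))^2) | x.
      (\<forall>s<k. x s \<in> M) \<and> (\<Sum>s<k. (l2_norm (x s))^2) \<le> 1}"

end

theory Submission
  imports Defs
begin

text \<open>
  Write \<open>\<Delta> = (I - T\<^sub>1T\<^sub>1\<^sup>*)\<^sup>1\<^sup>/\<^sup>2\<close>. Since \<open>T\<^sub>1\<close> is completely non-unitary and acts on a finite-dimensional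
  space, \<open>T\<^sub>1\<^sup>*\<^sup>n h \<rightarrow> 0\<close>, so \<open>\<Pi> h = (\<Delta> T\<^sub>1\<^sup>*\<^sup>n h)\<^sub>n\<close> is an isometry into the Hardy space
  with values in the range of \<open>\<Delta>\<close>. Its range lies in the model space because the latter is the
  kernel of \<open>m(S)\<^sup>*\<close>, where \<open>m\<close> is the minimal polynomial of \<open>T\<^sub>1\<close> (the Blaschke denominators
  are invertible multipliers). The transfer function is the input-output map of the linear system
  with the unitary colligation \<open>U\<^sup>*\<close>. Conservation of energy makes it contractive; it is isometric
  because the states tend to \<open>0\<close>, as \<open>\<Sum> \<parallel>B D\<^sup>n v\<parallel>\<^sup>2 \<le> \<parallel>v\<parallel>\<^sup>2\<close>. Moreover \<open>\<Pi>\<^sup>*\<close> intertwines the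
  compressed shift with \<open>T\<^sub>1\<close> and the compressed transfer operator with \<open>T\<^sub>2\<close>, whence
  \<open>p(T\<^sub>1, T\<^sub>2) = \<Pi>\<^sup>* p(B\<^sub>1 \<otimes> I, \<phi>(B\<^sub>1)) \<Pi>\<close>, also for matrices of polynomials.
\<close>

section \<open>Square-summable families and projections\<close>

text \<open>Working with \<open>\<Pi>^*\<close> instead of \<open>\<Pi>\<close> shapes the last
  part. A relation such as \<open>\<Pi>^* B = T \<Pi>^*\<close> is tested by pairing with vectors
  \<open>\<Pi> h\<close>, and compression to the model space is invisible in such pairings because
  they lie in that space. So the adjoint of the transfer operator on the infinite-dimensional space
  is never formed. Projections, adjoints, square roots and minimal polynomials are all definite
  descriptions, hence each needs existence and uniqueness first. Every projection involved goes onto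
  a finite-dimensional space: the model space is the solution space of a linear recurrence of order
  \<open>degree (min_poly T1)\<close>. Diagonalisation is replaced by the squarefreeness of the
  minimal polynomial of a positive operator, and the Jordan form by removing one root at a time.
  Complete non-unitarity is used through one fact, that the roots of the minimal polynomial lie in
  the open disc. This yields both the decay of the powers and the boundedness of the inverse
  Blaschke denominators.\<close>

lemma sum_fun_apply: "(sum f A) i = (\<Sum>k\<in>A. f k i)"
  by (induction A rule: infinite_finite_induct) auto

lemma scl_apply [simp]: "scl c x i = c * x i"
  by (simp add: scl_def)

lemma scl_add: "scl c (x + y) = scl c x + scl c y"
  by (auto simp: algebra_simps)

lemma scl_add_left: "scl (c + d) x = scl c x + scl d x"
  by (auto simp: algebra_simps)

lemma scl_scl [simp]: "scl c (scl d x) = scl (c * d) x"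
  by (auto simp: algebra_simps)

lemma scl_one [simp]: "scl 1 x = x"
  by auto

lemma scl_zero_left [simp]: "scl 0 x = 0"
  by auto

lemma scl_zero_right [simp]: "scl c 0 = 0"
  by auto

lemma diff_eq_scl: "x - y = x + scl (-1) y"
  by auto

lemma scl_sum: "scl c (sum f A) = (\<Sum>k\<in>A. scl c (f k))"
  by (auto simp: sum_fun_apply sum_distrib_left)

lemma l2_finite [simp]: "l2 (x :: 'i::finite \<Rightarrow> complex)"
  by (simp add: l2_def)

lemma l2_zero [simp]: "l2 0"
  by (simp add: l2_def zero_fun_def)

lemma l2_scl [simp]: "l2 x \<Longrightarrow> l2 (scl c x)"
  by (simp add: l2_def norm_mult power_mult_distrib summable_on_cmult_right)

lemma l2_add [simp]:
  assumes "l2 x" "l2 y"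
  shows "l2 (x + y)"
proof -
  have b: "(cmod (x i + y i))\<^sup>2 \<le> 2 * (cmod (x i))\<^sup>2 + 2 * (cmod (y i))\<^sup>2" for i
  proof -
    have "(cmod (x i + y i))\<^sup>2 \<le> (cmod (x i) + cmod (y i))\<^sup>2"
      by (intro power_mono norm_triangle_ineq) auto
    also have "\<dots> \<le> 2 * (cmod (x i))\<^sup>2 + 2 * (cmod (y i))\<^sup>2"
      using sum_squares_bound[of "cmod (x i)" "cmod (y i)"] by (simp add: power2_sum)
    finally show ?thesis .
  qed
  have s: "(\<lambda>i. 2 * (cmod (x i))\<^sup>2 + 2 * (cmod (y i))\<^sup>2) summable_on UNIV"
    using assms unfolding l2_def by (intro summable_on_add summable_on_cmult_right)
  show ?thesis
    unfolding l2_def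
    by (rule summable_on_comparison_test[OF s]) (use b in auto)
qed

lemma l2_diff [simp]: "l2 x \<Longrightarrow> l2 y \<Longrightarrow> l2 (x - y)"
  by (simp add: diff_eq_scl)

lemma l2_sum: "(\<And>k. k \<in> A \<Longrightarrow> l2 (f k)) \<Longrightarrow> l2 (sum f A)"
  by (induction A rule: infinite_finite_induct) auto

lemma l2_inner_summable [simp]:
  assumes "l2 x" "l2 y"
  shows "(\<lambda>i. x i * cnj (y i)) summable_on UNIV"
proof (rule abs_summable_summable)
  have s: "(\<lambda>i. (cmod (x i))\<^sup>2 + (cmod (y i))\<^sup>2) summable_on UNIV"
    using assms unfolding l2_def by (intro summable_on_add)
  show "(\<lambda>i. norm (x i * cnj (y i))) summable_on UNIV"
  proof (rule summable_on_comparison_test[OF s])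
    fix i
    have "2 * (cmod (x i) * cmod (y i)) \<le> (cmod (x i))\<^sup>2 + (cmod (y i))\<^sup>2"
      using sum_squares_bound[of "cmod (x i)" "cmod (y i)"] by simp
    moreover have "0 \<le> cmod (x i) * cmod (y i)"
      by simp
    ultimately show "norm (x i * cnj (y i)) \<le> (cmod (x i))\<^sup>2 + (cmod (y i))\<^sup>2"
      unfolding norm_mult complex_mod_cnj by linarith
  qed auto
qed

lemma l2_inner_add_left:
  "l2 x \<Longrightarrow> l2 y \<Longrightarrow> l2 z \<Longrightarrow> l2_inner (x + y) z = l2_inner x z + l2_inner y z"
  unfolding l2_inner_def by (simp add: algebra_simps flip: infsum_add)

lemma l2_inner_scl_left: "l2_inner (scl c x) y = c * l2_inner x y"
  unfolding l2_inner_def by (simp add: mult.assoc infsum_cmult_right')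

lemma l2_inner_commute: "l2_inner y x = cnj (l2_inner x y)"
  unfolding l2_inner_def by (simp add: mult.commute flip: infsum_cnj)

lemma l2_inner_scl_right: "l2_inner x (scl c y) = cnj c * l2_inner x y"
  by (subst (1 2) l2_inner_commute) (simp add: l2_inner_scl_left)

lemma l2_inner_add_right:
  "l2 x \<Longrightarrow> l2 y \<Longrightarrow> l2 z \<Longrightarrow> l2_inner x (y + z) = l2_inner x y + l2_inner x z"
  by (subst (1 2 3) l2_inner_commute) (simp add: l2_inner_add_left)

lemma l2_inner_diff_left:
  "l2 x \<Longrightarrow> l2 y \<Longrightarrow> l2 z \<Longrightarrow> l2_inner (x - y) z = l2_inner x z - l2_inner y z"
  by (simp add: diff_eq_scl l2_inner_add_left l2_inner_scl_left)

lemma l2_inner_diff_right: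
  "l2 x \<Longrightarrow> l2 y \<Longrightarrow> l2 z \<Longrightarrow> l2_inner x (y - z) = l2_inner x y - l2_inner x z"
  by (simp add: diff_eq_scl l2_inner_add_right l2_inner_scl_right)

lemma l2_inner_zero_left [simp]: "l2_inner 0 y = 0"
  by (simp add: l2_inner_def)

lemma l2_inner_zero_right [simp]: "l2_inner y 0 = 0"
  by (simp add: l2_inner_def)

lemmas l2_inner_lin = l2_inner_add_left l2_inner_add_right l2_inner_diff_left l2_inner_diff_right
  l2_inner_scl_left l2_inner_scl_right

lemma l2_inner_sum_left:
  "(\<And>k. k \<in> A \<Longrightarrow> l2 (f k)) \<Longrightarrow> l2 y \<Longrightarrow> l2_inner (sum f A) y = (\<Sum>k\<in>A. l2_inner (f k) y)"
  by (induction A rule: infinite_finite_induct) (auto simp: l2_inner_lin l2_sum)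

lemma l2_inner_sum_right:
  "(\<And>k. k \<in> A \<Longrightarrow> l2 (f k)) \<Longrightarrow> l2 y \<Longrightarrow> l2_inner y (sum f A) = (\<Sum>k\<in>A. l2_inner y (f k))"
  by (induction A rule: infinite_finite_induct) (auto simp: l2_inner_lin l2_sum)

lemma l2_norm_nonneg [simp]: "0 \<le> l2_norm x"
  unfolding l2_norm_def by (simp add: infsum_nonneg)

lemma l2_norm_sq: "(l2_norm x)\<^sup>2 = (\<Sum>\<^sub>\<infinity>i. (cmod (x i))\<^sup>2)"
  unfolding l2_norm_def by (simp add: infsum_nonneg)

lemma l2_inner_self:
  assumes "l2 x"
  shows "l2_inner x x = of_real ((l2_norm x)\<^sup>2)"
proof -
  have "l2_inner x x = (\<Sum>\<^sub>\<infinity>i. complex_of_real ((cmod (x i))\<^sup>2))"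
    unfolding l2_inner_def by (intro infsum_cong) (simp add: complex_norm_square del: of_real_power)
  also have "\<dots> = of_real (\<Sum>\<^sub>\<infinity>i. (cmod (x i))\<^sup>2)"
    using assms unfolding l2_def by (intro infsumI has_sum_of_real) simp
  finally show ?thesis
    by (simp add: l2_norm_sq)
qed

lemma l2_norm_sq_eq_Re: "l2 x \<Longrightarrow> (l2_norm x)\<^sup>2 = Re (l2_inner x x)"
  by (simp add: l2_inner_self)

lemma l2_norm_zero [simp]: "l2_norm 0 = 0"
  by (simp add: l2_norm_def)

lemma l2_norm_eq_0:
  assumes "l2 x" "l2_norm x = 0"
  shows "x = 0"
proof
  fix i
  have "(cmod (x i))\<^sup>2 = 0"
  proof (rule nonneg_infsum_le_0D[where A = UNIV and f = "\<lambda>i. (cmod (x i))\<^sup>2"])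
    show "(\<Sum>\<^sub>\<infinity>i. (cmod (x i))\<^sup>2) \<le> 0"
      using assms(2) by (simp flip: l2_norm_sq)
    show "(\<lambda>i. (cmod (x i))\<^sup>2) summable_on UNIV"
      using assms(1) by (simp add: l2_def)
  qed auto
  then show "x i = 0 i"
    by simp
qed

lemma l2_inner_self_eq_0: "l2 x \<Longrightarrow> l2_inner x x = 0 \<Longrightarrow> x = 0"
  by (auto simp: l2_inner_self intro: l2_norm_eq_0)

lemma l2_norm_scl: "l2_norm (scl c x) = cmod c * l2_norm x"
proof -
  have "(l2_norm (scl c x))\<^sup>2 = (cmod c * l2_norm x)\<^sup>2"
    by (simp add: l2_norm_sq norm_mult power_mult_distrib infsum_cmult_right')
  then show ?thesis
    by (simp add: power2_eq_iff_nonneg)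
qed

lemma l2_norm_sq_diff:
  assumes "l2 x" "l2 y"
  shows "(l2_norm (x - y))\<^sup>2 = (l2_norm x)\<^sup>2 - 2 * Re (l2_inner x y) + (l2_norm y)\<^sup>2"
  using assms l2_inner_commute[of x y] by (simp add: l2_norm_sq_eq_Re l2_inner_lin)

lemma l2_norm_sq_add:
  assumes "l2 x" "l2 y"
  shows "(l2_norm (x + y))\<^sup>2 = (l2_norm x)\<^sup>2 + 2 * Re (l2_inner x y) + (l2_norm y)\<^sup>2"
  using assms l2_inner_commute[of x y] by (simp add: l2_norm_sq_eq_Re l2_inner_lin)

lemma l2_cauchy_schwarz:
  assumes "l2 x" "l2 y"
  shows "cmod (l2_inner x y) \<le> l2_norm x * l2_norm y"
proof (cases "l2_norm y = 0")
  case True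
  then show ?thesis
    using l2_norm_eq_0[OF assms(2)] by simp
next
  case False
  define N where "N = (l2_norm y)\<^sup>2"
  define c where "c = l2_inner x y"
  have N: "N > 0"
    using False by (simp add: N_def)
  \<comment> \<open>The vector is \<open>N\<close> times the residual of \<open>x\<close> after
    projection onto \<open>y\<close>, which avoids dividing by \<open>N\<close>.\<close>
  have "0 \<le> (l2_norm (scl (of_real N) x - scl c y))\<^sup>2"
    by simp
  also have "\<dots> = N\<^sup>2 * (l2_norm x)\<^sup>2 - 2 * (N * (cmod c)\<^sup>2) + (cmod c)\<^sup>2 * N"
    using assms N
    by (subst l2_norm_sq_diff)
       (auto simp: l2_norm_scl power_mult_distrib l2_inner_lin N_def[symmetric] c_def[symmetric]
          mult.assoc mult.commute[of "cnj c"] simp flip: complex_norm_square)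
  also have "\<dots> = N * (N * (l2_norm x)\<^sup>2 - (cmod c)\<^sup>2)"
    by (simp add: algebra_simps power2_eq_square)
  finally have "(cmod c)\<^sup>2 \<le> (l2_norm x * l2_norm y)\<^sup>2"
    using N by (simp add: zero_le_mult_iff N_def power_mult_distrib mult.commute)
  then show ?thesis
    unfolding c_def by (rule power2_le_imp_le) simp
qed

lemma l2_norm_triangle:
  assumes "l2 x" "l2 y"
  shows "l2_norm (x + y) \<le> l2_norm x + l2_norm y"
proof -
  have "Re (l2_inner x y) \<le> l2_norm x * l2_norm y"
    using l2_cauchy_schwarz[OF assms] complex_Re_le_cmod[of "l2_inner x y"] by linarith
  then have "(l2_norm (x + y))\<^sup>2 \<le> (l2_norm x + l2_norm y)\<^sup>2"
    using assms by (simp add: l2_norm_sq_add power2_sum)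
  then show ?thesis
    by (rule power2_le_imp_le) simp
qed

lemma l2_norm_sum:
  "(\<And>k. k \<in> A \<Longrightarrow> l2 (f k)) \<Longrightarrow> l2_norm (sum f A) \<le> (\<Sum>k\<in>A. l2_norm (f k))"
proof (induction A rule: infinite_finite_induct)
  case (insert a A)
  then have "l2_norm (f a + sum f A) \<le> l2_norm (f a) + l2_norm (sum f A)"
    by (intro l2_norm_triangle) (auto intro: l2_sum)
  moreover have "l2_norm (sum f A) \<le> (\<Sum>k\<in>A. l2_norm (f k))"
    using insert.IH insert.prems by blast
  ultimately have "l2_norm (sum f (insert a A)) \<le> (\<Sum>k\<in>insert a A. l2_norm (f k))"
    using insert.hyps by simp
  then show ?case .
qed auto

lemma cmod_le_l2_norm:
  assumes "l2 x"
  shows "cmod (x i) \<le> l2_norm x"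
proof -
  have "(\<Sum>j\<in>{i}. (cmod (x j))\<^sup>2) \<le> (l2_norm x)\<^sup>2"
    unfolding l2_norm_sq using assms by (intro finite_sum_le_infsum) (auto simp: l2_def)
  then have "(cmod (x i))\<^sup>2 \<le> (l2_norm x)\<^sup>2"
    by simp
  then show ?thesis
    by (rule power2_le_imp_le) simp
qed

lemma l2_inner_finite: "l2_inner x y = (\<Sum>i\<in>UNIV. x i * cnj (y (i :: 'i :: finite)))"
  by (simp add: l2_inner_def)

lemma l2_norm_sq_finite: "(l2_norm x)\<^sup>2 = (\<Sum>i\<in>UNIV. (cmod (x (i :: 'i :: finite)))\<^sup>2)"
  by (simp add: l2_norm_sq)

lemma l2_inner_ext:
  assumes "\<And>z. l2_inner x z = l2_inner y z"
  shows "x = (y :: 'i::finite \<Rightarrow> complex)"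
proof -
  have "l2_inner (x - y) (x - y) = 0"
    by (subst l2_inner_diff_left) (simp_all add: assms)
  then show ?thesis
    using l2_inner_self_eq_0[of "x - y"] by simp
qed

text \<open>A subspace all of whose members are determined by finitely many coordinates is
  finite-dimensional; projections onto it are built one coordinate at a time.\<close>

definition determined_by :: "'a set \<Rightarrow> ('a \<Rightarrow> complex) set \<Rightarrow> bool" where
  "determined_by J M \<longleftrightarrow> finite J \<and> csubspace M \<and> (\<forall>x\<in>M. (\<forall>j\<in>J. x j = 0) \<longrightarrow> x = 0)"

lemma csubspaceD:
  assumes "csubspace M"
  shows "0 \<in> M" "\<And>x y. x \<in> M \<Longrightarrow> y \<in> M \<Longrightarrow> x + y \<in> M" "\<And>c x. x \<in> M \<Longrightarrow> scl c x \<in> M"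
    "\<And>x. x \<in> M \<Longrightarrow> l2 x" "\<And>x y. x \<in> M \<Longrightarrow> y \<in> M \<Longrightarrow> x - y \<in> M"
  using assms unfolding csubspace_def diff_eq_scl by auto

lemma csubspace_sum:
  "csubspace M \<Longrightarrow> (\<And>k. k \<in> A \<Longrightarrow> f k \<in> M) \<Longrightarrow> sum f A \<in> M"
  by (induction A rule: infinite_finite_induct) (simp_all add: csubspaceD(1,2))

text \<open>Gram-Schmidt: vanishing at \<open>j\<close> cuts out a subspace \<open>M'\<close> of
  codimension at most one, to which the induction hypothesis applies. If \<open>M'\<close> is
  proper, the residual \<open>v\<close> of a vector outside it spans the orthogonal complement of
  \<open>M'\<close> in \<open>M\<close>, and the projection onto \<open>M\<close> adds the component
  of \<open>x\<close> along \<open>v\<close>.\<close>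

lemma determined_by_proj_exists:
  assumes "determined_by J M" "l2 x"
  shows "\<exists>y\<in>M. \<forall>z\<in>M. l2_inner (x - y) z = 0"
proof -
  have "finite J"
    using assms by (simp add: determined_by_def)
  then show ?thesis
    using assms
  proof (induction J arbitrary: M x rule: finite_induct)
    case empty
    then have "M \<subseteq> {0}" "0 \<in> M"
      by (auto simp: determined_by_def csubspace_def)
    then have "M = {0}"
      by blast
    then have "\<exists>y\<in>M. \<forall>z\<in>M. l2_inner (x - y) z = 0"
      by simp
    then show ?case .
  next
    case (insert j J M x)
    define M' where "M' = {x\<in>M. x j = 0}"
    have M: "csubspace M"
      using insert.prems by (simp add: determined_by_def)
    have det: "determined_by J M'"
      using insert.prems unfolding determined_by_def M'_def csubspace_def by auto
    obtain p where p: "p \<in> M'" "\<forall>z\<in>M'. l2_inner (x - p) z = 0"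
      using insert.IH[OF det insert.prems(2)] by blast
    have "\<exists>y\<in>M. \<forall>z\<in>M. l2_inner (x - y) z = 0"
    proof (cases "M \<subseteq> M'")
      case True
      then show ?thesis
        using p by (auto simp: M'_def)
    next
      case False
      then obtain u where u: "u \<in> M" "u j \<noteq> 0"
        by (auto simp: M'_def)
      then obtain q where q: "q \<in> M'" "\<forall>z\<in>M'. l2_inner (u - q) z = 0"
        using insert.IH[OF det] csubspaceD(4)[OF M] by blast
      define v where "v = u - q"
      have qM: "q \<in> M" "q j = 0"
        using q by (simp_all add: M'_def)
      have v: "v \<in> M" "v j \<noteq> 0"
        using u qM csubspaceD(5)[OF M] by (simp_all add: v_def)
      have lv: "l2 v"
        using v csubspaceD(4)[OF M] by blast
      have vv: "l2_inner v v \<noteq> 0"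
        using l2_inner_self_eq_0[of v] v lv by force
      define y where "y = p + scl (l2_inner x v / l2_inner v v) v"
      have pM: "p \<in> M"
        using p by (simp add: M'_def)
      then have yM: "y \<in> M"
        unfolding y_def using v csubspaceD(2,3)[OF M] by blast
      have l2s: "l2 p" "l2 x" "l2 y" "l2 v"
        using pM yM csubspaceD(4)[OF M] insert.prems lv by blast+
      have pv: "l2_inner p v = 0"
        using q p l2_inner_commute[of v p] by (simp add: v_def)
      note yM
      moreover have "l2_inner (x - y) z = 0" if z: "z \<in> M" for z
      proof -
        \<comment> \<open>This factor cancels coordinate \<open>j\<close>, so that \<open>z\<close>
          splits into a member of \<open>M'\<close> and a multiple of \<open>v\<close>.\<close>
        define c where "c = z j / v j"
        define w where "w = z - scl c v"
        have wM: "w \<in> M"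
          unfolding w_def using z v csubspaceD(3,5)[OF M] by blast
        then have w: "w \<in> M'"
          using v by (simp add: M'_def w_def c_def)
        have lw: "l2 w"
          using wM csubspaceD(4)[OF M] by blast
        have zw: "z = w + scl c v"
          by (simp add: w_def)
        have vw: "l2_inner v w = 0"
          using q w by (simp add: v_def)
        have xpw: "l2_inner x w = l2_inner p w"
        proof -
          have "l2_inner (x - p) w = 0"
            using p w by blast
          then show ?thesis
            using lw l2s by (simp add: l2_inner_diff_left)
        qed
        have 1: "l2_inner (x - y) w = 0"
          using lw l2s by (simp add: y_def l2_inner_lin vw xpw)
        have 2: "l2_inner (x - y) v = 0"
          using l2s vv by (simp add: y_def l2_inner_lin pv)
        show ?thesis
          using lw l2s by (simp add: zw l2_inner_add_right l2_inner_scl_right 1 2)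
      qed
      ultimately show ?thesis
        by blast
    qed
    then show ?case .
  qed
qed

lemma proj_unique:
  assumes M: "csubspace M" and x: "l2 x"
    and y: "y \<in> M" "\<forall>z\<in>M. l2_inner (x - y) z = 0"
  shows "proj M x = y"
  unfolding proj_def
proof (rule the_equality)
  show "y \<in> M \<and> (\<forall>z\<in>M. l2_inner (x - y) z = 0)"
    using y by simp
next
  fix y' assume y': "y' \<in> M \<and> (\<forall>z\<in>M. l2_inner (x - y') z = 0)"
  have m: "y' - y \<in> M"
    using y y' csubspaceD(5)[OF M] by blast
  have l: "l2 y" "l2 y'" "l2 (y' - y)"
    using y y' m csubspaceD(4)[OF M] by blast+
  have "l2_inner ((x - y) - (x - y')) (y' - y) = 0"
    using y y' m l x by (subst l2_inner_diff_left) simp_all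
  then have "l2_inner (y' - y) (y' - y) = 0"
    by simp
  then show "y' = y"
    using l2_inner_self_eq_0[of "y' - y"] l by simp
qed

lemma
  assumes "determined_by J M" "l2 x"
  shows proj_in: "proj M x \<in> M"
    and proj_orth: "z \<in> M \<Longrightarrow> l2_inner (x - proj M x) z = 0"
proof -
  have M: "csubspace M"
    using assms by (simp add: determined_by_def)
  obtain y where y: "y \<in> M" "\<forall>z\<in>M. l2_inner (x - y) z = 0"
    using determined_by_proj_exists[OF assms] by blast
  then have "proj M x = y"
    by (intro proj_unique M assms)
  then show "proj M x \<in> M" "z \<in> M \<Longrightarrow> l2_inner (x - proj M x) z = 0"
    using y by auto
qed

lemma proj_inner:
  assumes "determined_by J M" "l2 x" "z \<in> M"
  shows "l2_inner (proj M x) z = l2_inner x z"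
proof -
  have "l2 (proj M x)" "l2 z"
    using proj_in[OF assms(1,2)] assms csubspaceD(4) unfolding determined_by_def by blast+
  then show ?thesis
    using proj_orth[OF assms] assms by (simp add: l2_inner_lin)
qed

lemma proj_l2: "determined_by J M \<Longrightarrow> l2 x \<Longrightarrow> l2 (proj M x)"
  using proj_in[of J M x] csubspaceD(4) unfolding determined_by_def by blast

lemma proj_id:
  assumes "csubspace M" "x \<in> M"
  shows "proj M x = x"
  using assms csubspaceD(4) by (intro proj_unique) auto

lemma proj_add:
  assumes "determined_by J M" "l2 x" "l2 y"
  shows "proj M (x + y) = proj M x + proj M y"
proof (rule proj_unique)
  show M: "csubspace M"
    using assms by (simp add: determined_by_def)
  show "proj M x + proj M y \<in> M"
    using proj_in[OF assms(1)] assms(2-) csubspaceD(2,3)[OF M] by simp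
  show "\<forall>z\<in>M. l2_inner (x + y - (proj M x + proj M y)) z = 0"
    using assms csubspaceD(4)[OF M] by (simp add: l2_inner_lin proj_inner[OF assms(1)] proj_l2[OF assms(1)])
qed (use assms in auto)

lemma proj_scl:
  assumes "determined_by J M" "l2 x"
  shows "proj M (scl c x) = scl c (proj M x)"
proof (rule proj_unique)
  show M: "csubspace M"
    using assms by (simp add: determined_by_def)
  show "scl c (proj M x) \<in> M"
    using proj_in[OF assms(1)] assms(2-) csubspaceD(2,3)[OF M] by simp
  show "\<forall>z\<in>M. l2_inner (scl c x - scl c (proj M x)) z = 0"
    using assms csubspaceD(4)[OF M] by (simp add: l2_inner_lin proj_inner[OF assms(1)] proj_l2[OF assms(1)])
qed (use assms in auto)

lemma proj_pythagoras:
  assumes "determined_by J M" "l2 x" "y \<in> M"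
  shows "(l2_norm (x - y))\<^sup>2 = (l2_norm (x - proj M x))\<^sup>2 + (l2_norm (proj M x - y))\<^sup>2"
proof -
  have M: "csubspace M"
    using assms by (simp add: determined_by_def)
  have m: "proj M x - y \<in> M"
    using proj_in[OF assms(1,2)] csubspaceD(5)[OF M] assms by blast
  have l: "l2 (proj M x - y)"
    using m csubspaceD(4)[OF M] by blast
  have "(l2_norm ((x - proj M x) + (proj M x - y)))\<^sup>2 =
      (l2_norm (x - proj M x))\<^sup>2 + (l2_norm (proj M x - y))\<^sup>2"
    using proj_orth[OF assms(1,2) m] l assms proj_l2[OF assms(1,2)]
    by (subst l2_norm_sq_add) simp_all
  then show ?thesis
    by (simp only: diff_add_cancel add_diff_eq)
qed

lemma proj_norm_le:
  assumes "determined_by J M" "l2 x"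
  shows "l2_norm (proj M x) \<le> l2_norm x"
proof -
  have "0 \<in> M"
    using assms csubspaceD(1) unfolding determined_by_def by blast
  from proj_pythagoras[OF assms this] have "(l2_norm (proj M x))\<^sup>2 \<le> (l2_norm x)\<^sup>2"
    by simp
  then show ?thesis
    by (rule power2_le_imp_le) simp
qed

text \<open>By Pythagoras the projection is at least as close to \<open>x\<close> as any member of
  \<open>M\<close>, so a point of the closure has distance zero from its projection.\<close>

lemma determined_by_closed:
  assumes "determined_by J M"
  shows "l2_closure M \<subseteq> M"
proof
  fix x assume x: "x \<in> l2_closure M"
  then have lx: "l2 x"
    unfolding l2_closure_def by blast
  have "l2_norm (x - proj M x) \<le> 0"
  proof (rule field_le_epsilon)
    fix e :: real assume "e > 0"
    then obtain y where y: "y \<in> M" "l2_norm (x - y) < e"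
      using x unfolding l2_closure_def by blast
    have "(l2_norm (x - proj M x))\<^sup>2 \<le> (l2_norm (x - y))\<^sup>2"
      using proj_pythagoras[OF assms lx y(1)] by simp
    then have "l2_norm (x - proj M x) \<le> l2_norm (x - y)"
      by (rule power2_le_imp_le) simp
    then show "l2_norm (x - proj M x) \<le> 0 + e"
      using y by simp
  qed
  then have "x - proj M x = 0"
    using lx proj_l2[OF assms lx] by (intro l2_norm_eq_0) (simp_all add: antisym)
  then show "x \<in> M"
    using proj_in[OF assms lx] by simp
qed

lemma determined_by_UNIV: "csubspace M \<Longrightarrow> determined_by UNIV (M :: ('i::finite \<Rightarrow> complex) set)"
  by (auto simp: determined_by_def)

lemma closure_superset: "csubspace M \<Longrightarrow> M \<subseteq> l2_closure M"
  unfolding l2_closure_def using csubspaceD(4) by (auto intro!: bexI)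

section \<open>Adjoints and the minimal polynomial\<close>

lemma op_linearD:
  assumes "op_linear M F"
  shows "\<And>x y. x \<in> M \<Longrightarrow> y \<in> M \<Longrightarrow> F (x + y) = F x + F y" "\<And>c x. x \<in> M \<Longrightarrow> F (scl c x) = scl c (F x)"
  using assms by (auto simp: op_linear_def)

lemma op_linear_zero:
  assumes "op_linear M F" "0 \<in> M"
  shows "F 0 = 0"
  using op_linearD(2)[OF assms, of 0] by simp

lemma op_linear_diff:
  assumes "op_linear M F" "csubspace M" "x \<in> M" "y \<in> M"
  shows "F (x - y) = F x - F y"
  using op_linearD[OF assms(1)] csubspaceD(3)[OF assms(2)] assms(3,4) by (simp add: diff_eq_scl)

lemma op_linear_sum:
  assumes "op_linear M F" "csubspace M"
  shows "(\<And>k. k \<in> A \<Longrightarrow> f k \<in> M) \<Longrightarrow> F (sum f A) = (\<Sum>k\<in>A. F (f k))"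
proof (induction A rule: infinite_finite_induct)
  case (insert a A)
  have "sum f A \<in> M" "f a \<in> M"
    using insert.prems by (auto intro: csubspace_sum[OF assms(2)])
  then have "F (f a + sum f A) = F (f a) + F (sum f A)"
    by (rule op_linearD(1)[OF assms(1), rotated])
  moreover have "F (sum f A) = (\<Sum>k\<in>A. F (f k))"
    using insert.IH insert.prems by blast
  ultimately have "F (sum f (insert a A)) = (\<Sum>k\<in>insert a A. F (f k))"
    using insert.hyps by simp
  then show ?case .
qed (simp_all add: op_linear_zero[OF assms(1)] csubspaceD(1)[OF assms(2)])

lemma csubspace_UNIV: "csubspace (UNIV :: ('i::finite \<Rightarrow> complex) set)"
  by (auto simp: csubspace_def)

lemma op_linear_funpow:
  fixes T :: "('a \<Rightarrow> complex) \<Rightarrow> ('a \<Rightarrow> complex)"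
  shows "op_linear UNIV T \<Longrightarrow> op_linear UNIV (T ^^ n)"
  by (induction n) (simp_all add: op_linear_def)

definition unit_vec :: "'i \<Rightarrow> 'i \<Rightarrow> complex" where
  "unit_vec j = (\<lambda>i. if i = j then 1 else 0)"

lemma unit_vec_expansion: "(\<Sum>j\<in>UNIV. scl (x j) (unit_vec j)) = (x :: 'i::finite \<Rightarrow> complex)"
proof
  fix i
  have "(\<Sum>j\<in>UNIV. scl (x j) (unit_vec j)) i = (\<Sum>j\<in>UNIV. if i = j then x j else 0)"
    unfolding sum_fun_apply by (intro sum.cong) (auto simp: unit_vec_def)
  then show "(\<Sum>j\<in>UNIV. scl (x j) (unit_vec j)) i = x i"
    by simp
qed

lemma l2_inner_unit_vec: "l2_inner x (unit_vec j) = x j"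
proof -
  have "l2_inner x (unit_vec j) = (\<Sum>\<^sub>\<infinity>i\<in>{j}. x i * cnj (unit_vec j i))"
    unfolding l2_inner_def by (rule infsum_cong_neutral) (auto simp: unit_vec_def)
  then show ?thesis
    by (simp add: unit_vec_def)
qed

text \<open>Linearity of \<open>F\<close> is known on \<open>M\<close> only. Composing with the
  projection gives a globally linear \<open>G\<close>, whose representing vector is read off on the
  unit vectors and then projected back into \<open>M\<close>.\<close>

lemma riesz_exists:
  fixes F :: "('i::finite \<Rightarrow> complex) \<Rightarrow> ('j::finite \<Rightarrow> complex)"
  assumes M: "csubspace M" and F: "op_linear M F"
  shows "\<exists>z\<in>M. \<forall>x\<in>M. l2_inner (F x) y = l2_inner x z"
proof -
  have det: "determined_by UNIV M"
    by (rule determined_by_UNIV[OF M])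
  have pM: "proj M x \<in> M" for x
    by (rule proj_in[OF det]) simp
  define G where "G x = F (proj M x)" for x
  have G: "op_linear UNIV G"
    unfolding op_linear_def G_def
    using pM op_linearD[OF F] by (simp add: proj_add[OF det] proj_scl[OF det])
  define z where "z = (\<lambda>j. cnj (l2_inner (G (unit_vec j)) y))"
  have z: "l2_inner x z = l2_inner (G x) y" for x
  proof -
    have "G x = G (\<Sum>j\<in>UNIV. scl (x j) (unit_vec j))"
      by (simp add: unit_vec_expansion)
    also have "\<dots> = (\<Sum>j\<in>UNIV. G (scl (x j) (unit_vec j)))"
      by (rule op_linear_sum[OF G csubspace_UNIV]) simp
    finally have "l2_inner (G x) y = (\<Sum>j\<in>UNIV. l2_inner (scl (x j) (G (unit_vec j))) y)"
      by (simp add: op_linearD(2)[OF G] l2_inner_sum_left)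
    also have "\<dots> = l2_inner x z"
      by (simp add: l2_inner_finite[of x] z_def l2_inner_scl_left)
    finally show ?thesis
      by simp
  qed
  have "l2_inner (F x) y = l2_inner x (proj M z)" if x: "x \<in> M" for x
  proof -
    have "l2_inner x (proj M z) = cnj (l2_inner (proj M z) x)"
      by (rule l2_inner_commute)
    also have "\<dots> = cnj (l2_inner z x)"
      by (simp add: proj_inner[OF det _ x])
    also have "\<dots> = l2_inner (F x) y"
      by (simp add: z G_def proj_id[OF M x] flip: l2_inner_commute)
    finally show ?thesis
      by simp
  qed
  then show ?thesis
    using pM by blast
qed

lemma adj_on_unique:
  fixes F :: "('i::finite \<Rightarrow> complex) \<Rightarrow> ('j::finite \<Rightarrow> complex)"
  assumes M: "csubspace M" and z: "z \<in> M" "\<And>x. x \<in> M \<Longrightarrow> l2_inner (F x) y = l2_inner x z"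
  shows "adj_on M F y = z"
  unfolding adj_on_def
proof (rule the_equality)
  fix z' assume z': "z' \<in> M \<and> (\<forall>x\<in>M. l2_inner (F x) y = l2_inner x z')"
  have m: "z' - z \<in> M"
    using z z' csubspaceD(5)[OF M] by blast
  have "l2_inner (z' - z) (z' - z) = l2_inner (z' - z) z' - l2_inner (z' - z) z"
    by (simp add: l2_inner_diff_right)
  also have "\<dots> = 0"
    using z z' m by (metis diff_self)
  finally show "z' = z"
    using l2_inner_self_eq_0[of "z' - z"] by simp
qed (use z in auto)

lemma
  fixes F :: "('i::finite \<Rightarrow> complex) \<Rightarrow> ('j::finite \<Rightarrow> complex)"
  assumes M: "csubspace M" and F: "op_linear M F"
  shows adj_on_in: "adj_on M F y \<in> M"
    and adj_on_inner: "x \<in> M \<Longrightarrow> l2_inner (F x) y = l2_inner x (adj_on M F y)"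
proof -
  obtain z where z: "z \<in> M" "\<And>x. x \<in> M \<Longrightarrow> l2_inner (F x) y = l2_inner x z"
    using riesz_exists[OF M F, of y] by blast
  then have "adj_on M F y = z"
    by (rule adj_on_unique[OF M])
  then show "adj_on M F y \<in> M" "x \<in> M \<Longrightarrow> l2_inner (F x) y = l2_inner x (adj_on M F y)"
    using z by auto
qed

text \<open>The adjoint relation is solvable for every \<open>y\<close>, so linearity follows from
  uniqueness on the whole codomain and hence on any \<open>N\<close>.\<close>

lemma adj_on_linear:
  fixes F :: "('i::finite \<Rightarrow> complex) \<Rightarrow> ('j::finite \<Rightarrow> complex)"
  assumes M: "csubspace M" and F: "op_linear M F"
  shows "op_linear N (adj_on M F)"
proof -
  have "adj_on M F (x + y) = adj_on M F x + adj_on M F y" for x y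
    using csubspaceD(2)[OF M] adj_on_in[OF M F]
    by (intro adj_on_unique M) (simp_all add: l2_inner_add_right adj_on_inner[OF M F])
  moreover have "adj_on M F (scl c x) = scl c (adj_on M F x)" for c x
    using csubspaceD(3)[OF M] adj_on_in[OF M F]
    by (intro adj_on_unique M) (simp_all add: l2_inner_scl_right adj_on_inner[OF M F])
  ultimately show ?thesis
    by (simp add: op_linear_def)
qed

lemma hadj_inner: "op_linear UNIV T \<Longrightarrow> l2_inner (T x) y = l2_inner x (hadj T y)"
  unfolding hadj_def by (rule adj_on_inner[OF csubspace_UNIV]) auto

lemma hadj_inner': "op_linear UNIV T \<Longrightarrow> l2_inner (hadj T x) y = l2_inner x (T y)"
  using hadj_inner[of T y x] by (metis l2_inner_commute)

lemma hadj_linear: "op_linear UNIV T \<Longrightarrow> op_linear UNIV (hadj T)"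
  unfolding hadj_def by (rule adj_on_linear[OF csubspace_UNIV])

lemma hadj_funpow_inner:
  "op_linear UNIV T \<Longrightarrow> l2_inner ((T ^^ n) x) y = l2_inner x ((hadj T ^^ n) y)"
  by (induction n arbitrary: x) (simp_all add: hadj_inner funpow_swap1)

lemma hadj_norm_le:
  assumes "contraction T"
  shows "l2_norm (hadj T y) \<le> l2_norm y"
proof -
  have T: "op_linear UNIV T" and c: "\<And>x. l2_norm (T x) \<le> l2_norm x"
    using assms by (auto simp: contraction_def)
  have "(l2_norm (hadj T y))\<^sup>2 = cmod (l2_inner (T (hadj T y)) y)"
    by (simp add: hadj_inner[OF T] l2_inner_self norm_power)
  also have "\<dots> \<le> l2_norm (T (hadj T y)) * l2_norm y"
    by (rule l2_cauchy_schwarz) auto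
  also have "\<dots> \<le> l2_norm (hadj T y) * l2_norm y"
    by (intro mult_right_mono c) auto
  finally show ?thesis
    using l2_norm_nonneg[of y] l2_norm_nonneg[of "hadj T y"]
    by (cases "l2_norm (hadj T y) = 0") (auto simp: power2_eq_square)
qed

lemma hadj_commute:
  assumes "op_linear UNIV S" "op_linear UNIV T" "S \<circ> T = T \<circ> S"
  shows "hadj S (hadj T h) = hadj T (hadj S h)"
proof (rule l2_inner_ext)
  fix z
  have "T (S z) = S (T z)"
    using assms(3) by (metis comp_apply)
  then show "l2_inner (hadj S (hadj T h)) z = l2_inner (hadj T (hadj S h)) z"
    by (simp add: hadj_inner' assms(1,2))
qed

lemma hadj_commute_funpow:
  assumes "op_linear UNIV S" "op_linear UNIV T" "S \<circ> T = T \<circ> S"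
  shows "(hadj S ^^ n) (hadj T h) = hadj T ((hadj S ^^ n) h)"
  by (induction n) (simp_all add: hadj_commute[OF assms])

section \<open>Polynomials in an operator\<close>

lemma op_poly_upto:
  assumes "degree p \<le> n"
  shows "op_poly p T x = (\<Sum>i\<le>n. scl (coeff p i) ((T ^^ i) x))"
  unfolding op_poly_def
  by (rule sum.mono_neutral_left) (use assms in \<open>auto simp: coeff_eq_0\<close>)

lemma op_poly_0 [simp]: "op_poly 0 T x = 0"
  by (simp add: op_poly_def)

lemma op_poly_add: "op_poly (p + q) T x = op_poly p T x + op_poly q T x"
proof -
  define n where "n = max (degree p) (degree q)"
  have n: "degree p \<le> n" "degree q \<le> n" "degree (p + q) \<le> n"
    by (auto simp: n_def intro: degree_add_le)
  show ?thesis
    by (simp add: op_poly_upto[OF n(1)] op_poly_upto[OF n(2)] op_poly_upto[OF n(3)]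
        scl_add_left sum.distrib)
qed

lemma op_poly_smult: "op_poly (smult c p) T x = scl c (op_poly p T x)"
  by (simp add: op_poly_upto[OF degree_smult_le] op_poly_upto[of p, OF order_refl] scl_sum)

lemma op_poly_diff: "op_poly (p - q) T x = op_poly p T x - op_poly q T x"
  using op_poly_add[of p "- q" T x] op_poly_smult[of "-1" q T x] by (simp add: diff_eq_scl)

text \<open>Horner's rule, the form that makes induction over the coefficient list available for
  products and intertwining.\<close>

lemma op_poly_pCons:
  fixes T :: "('i::finite \<Rightarrow> complex) \<Rightarrow> ('i \<Rightarrow> complex)"
  assumes T: "op_linear UNIV T"
  shows "op_poly (pCons a p) T x = scl a x + T (op_poly p T x)"
proof -
  have "op_poly (pCons a p) T x = (\<Sum>i\<le>Suc (degree p). scl (coeff (pCons a p) i) ((T ^^ i) x))"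
    by (rule op_poly_upto) (rule degree_pCons_le)
  also have "\<dots> = scl a x + (\<Sum>i\<le>degree p. T (scl (coeff p i) ((T ^^ i) x)))"
    by (subst sum.atMost_Suc_shift) (simp add: op_linearD(2)[OF T])
  also have "(\<Sum>i\<le>degree p. T (scl (coeff p i) ((T ^^ i) x))) = T (op_poly p T x)"
    unfolding op_poly_def by (rule op_linear_sum[OF T csubspace_UNIV, symmetric]) simp
  finally show ?thesis .
qed

lemma op_poly_linear:
  fixes T :: "('i::finite \<Rightarrow> complex) \<Rightarrow> ('i \<Rightarrow> complex)"
  assumes T: "op_linear UNIV T"
  shows "op_linear UNIV (op_poly p T)"
proof (induction p)
  case 0
  show ?case
    unfolding op_linear_def by (simp only: op_poly_0 scl_zero_right) simp
next
  case (pCons a p)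
  then show ?case
    using op_linearD[OF T] by (auto simp: op_linear_def op_poly_pCons[OF T] scl_add algebra_simps)
qed

lemma op_poly_mult:
  fixes T :: "('i::finite \<Rightarrow> complex) \<Rightarrow> ('i \<Rightarrow> complex)"
  assumes T: "op_linear UNIV T"
  shows "op_poly (p * q) T x = op_poly p T (op_poly q T x)"
proof (induction p)
  case (pCons a p)
  have "op_poly (pCons a p * q) T x = op_poly (pCons a p) T (op_poly q T x)"
    by (simp add: op_poly_add op_poly_smult op_poly_pCons[OF T] pCons.IH)
  then show ?case .
qed simp

lemma op_poly_intertwine:
  fixes T :: "('i::finite \<Rightarrow> complex) \<Rightarrow> ('i \<Rightarrow> complex)"
  assumes T: "op_linear UNIV T" and H: "op_linear UNIV H" and "\<And>x. H (T x) = T (H x)"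
  shows "H (op_poly p T x) = op_poly p T (H x)"
proof (induction p)
  case (pCons a p)
  have "H (op_poly (pCons a p) T x) = op_poly (pCons a p) T (H x)"
    using op_linearD[OF H] by (simp add: op_poly_pCons[OF T] assms(3) pCons.IH)
  then show ?case .
next
  case 0
  have "H (op_poly 0 T x) = op_poly 0 T (H x)"
    by (simp add: op_linear_zero[OF H])
  then show ?case .
qed

lemma op_poly_linear_factor:
  fixes T :: "('i::finite \<Rightarrow> complex) \<Rightarrow> ('i \<Rightarrow> complex)"
  assumes T: "op_linear UNIV T"
  shows "op_poly [:-a, 1:] T x = T x - scl a x"
  by (simp add: op_poly_pCons[OF T] op_linear_zero[OF T] fun_eq_iff)

section \<open>Linear dependence and the minimal polynomial\<close>

lemma exists_nontrivial_relation:
  fixes v :: "'k \<Rightarrow> 'j \<Rightarrow> complex"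
  assumes "finite J" "finite K" "card J < card K"
  shows "\<exists>c. (\<exists>k\<in>K. c k \<noteq> 0) \<and> (\<forall>j\<in>J. (\<Sum>k\<in>K. c k * v k j) = 0)"
  using assms
proof (induction J arbitrary: K v rule: finite_induct)
  case empty
  then have "K \<noteq> {}"
    by auto
  then show ?case
    by (intro exI[of _ "\<lambda>_. 1"]) auto
next
  case (insert j J K v)
  have cK: "card J < card K"
    using insert.prems insert.hyps by simp
  show ?case
  proof (cases "\<forall>k\<in>K. v k j = 0")
    case True
    obtain c where "\<exists>k\<in>K. c k \<noteq> 0" "\<forall>j\<in>J. (\<Sum>k\<in>K. c k * v k j) = 0"
      using insert.IH[OF insert.prems(1) cK, of v] by blast
    with True show ?thesis
      by (intro exI[of _ c]) simp
  next
    case False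
    then obtain l where l: "l \<in> K" "v l j \<noteq> 0"
      by blast
    \<comment> \<open>Equation \<open>j\<close> is solved for the unknown with index
      \<open>l\<close> and substituted into the others. The \<open>w\<close> are the coefficients
      after this elimination, and \<open>- d\<close> below is the value forced on the eliminated
      unknown.\<close>
    define w where "w k i = v k i - v k j / v l j * v l i" for k i
    have "card J < card (K - {l})"
      using insert.prems insert.hyps l by simp
    then obtain c where c: "\<exists>k\<in>K - {l}. c k \<noteq> 0" "\<forall>i\<in>J. (\<Sum>k\<in>K - {l}. c k * w k i) = 0"
      using insert.IH[of "K - {l}" w] insert.prems by blast
    define d where "d = (\<Sum>k\<in>K - {l}. c k * v k j / v l j)"
    define c' where "c' = c(l := - d)"
    have eq: "(\<Sum>k\<in>K. c' k * v k i) = (\<Sum>k\<in>K - {l}. c k * w k i)" for i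
    proof -
      have "(\<Sum>k\<in>K. c' k * v k i) = - d * v l i + (\<Sum>k\<in>K - {l}. c k * v k i)"
        using insert.prems l by (simp add: sum.remove[of K l] c'_def)
      also have "- d * v l i = (\<Sum>k\<in>K - {l}. - (c k * (v k j / v l j * v l i)))"
        by (simp add: d_def sum_distrib_right sum_negf mult.assoc)
      also have "\<dots> + (\<Sum>k\<in>K - {l}. c k * v k i) = (\<Sum>k\<in>K - {l}. c k * w k i)"
        by (simp add: w_def algebra_simps flip: sum.distrib)
      finally show ?thesis .
    qed
    have "w k j = 0" for k
      using l by (simp add: w_def)
    then have "\<forall>i\<in>insert j J. (\<Sum>k\<in>K. c' k * v k i) = 0"
      using c unfolding eq by simp
    moreover have "\<exists>k\<in>K. c' k \<noteq> 0"
      using c by (auto simp: c'_def)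
    ultimately show ?thesis
      by blast
  qed
qed

text \<open>Counting suffices in place of Cayley-Hamilton: on \<open>n\<close> coordinates,
  \<open>n^2 + 1\<close> powers of \<open>T\<close> are matrices with \<open>n^2\<close> entries,
  hence linearly dependent.\<close>

lemma annihilating_poly_exists:
  fixes T :: "('i::finite \<Rightarrow> complex) \<Rightarrow> ('i \<Rightarrow> complex)"
  assumes T: "op_linear UNIV T"
  shows "\<exists>p. p \<noteq> 0 \<and> (\<forall>x. op_poly p T x = 0)"
proof -
  define J where "J = (UNIV :: ('i \<times> 'i) set)"
  define v where "v k = (\<lambda>(i, j). ((T ^^ k) (unit_vec j)) i)" for k :: nat
  have "\<exists>c. (\<exists>k\<in>{..card J}. c k \<noteq> 0) \<and> (\<forall>j\<in>J. (\<Sum>k\<in>{..card J}. c k * v k j) = 0)"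
    by (rule exists_nontrivial_relation) (auto simp: J_def)
  then obtain c where c: "\<exists>k\<le>card J. c k \<noteq> 0" "\<forall>j\<in>J. (\<Sum>k\<le>card J. c k * v k j) = 0"
    by auto
  define p where "p = (\<Sum>k\<le>card J. monom (c k) k)"
  have cp: "coeff p k = (if k \<le> card J then c k else 0)" for k
    by (auto simp: p_def coeff_sum)
  have "p \<noteq> 0"
    using c(1) cp by (metis coeff_0)
  have dp: "degree p \<le> card J"
    by (rule degree_le) (simp add: cp)
  have "op_poly p T (unit_vec j) i = 0" for i j
  proof -
    have "op_poly p T (unit_vec j) i = (\<Sum>k\<le>card J. c k * v k (i, j))"
      by (simp add: op_poly_upto[OF dp] sum_fun_apply cp v_def)
    then show ?thesis
      using c(2) by (simp add: J_def)
  qed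
  then have e: "op_poly p T (unit_vec j) = 0" for j
    by auto
  have "op_poly p T x = 0" for x
  proof -
    note L = op_poly_linear[OF T, of p]
    have "op_poly p T x = op_poly p T (\<Sum>j\<in>UNIV. scl (x j) (unit_vec j))"
      by (simp add: unit_vec_expansion)
    also have "\<dots> = (\<Sum>j\<in>UNIV. op_poly p T (scl (x j) (unit_vec j)))"
      by (rule op_linear_sum[OF L csubspace_UNIV]) simp
    also have "\<dots> = 0"
      by (simp add: op_linearD(2)[OF L] e)
    finally show ?thesis .
  qed
  with \<open>p \<noteq> 0\<close> show ?thesis
    by blast
qed

text \<open>Existence normalises an annihilator of least degree. For uniqueness, the difference of
  two monic candidates is again an annihilator, of lower degree, and therefore zero.\<close>

lemma
  fixes T :: "('i::finite \<Rightarrow> complex) \<Rightarrow> ('i \<Rightarrow> complex)"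
  assumes T: "op_linear UNIV T"
  shows min_poly_monic: "lead_coeff (min_poly T) = 1"
    and min_poly_annihilates: "op_poly (min_poly T) T x = 0"
    and min_poly_minimal: "q \<noteq> 0 \<Longrightarrow> (\<And>x. op_poly q T x = 0) \<Longrightarrow> degree (min_poly T) \<le> degree q"
proof -
  define A where "A p \<longleftrightarrow> p \<noteq> 0 \<and> (\<forall>x. op_poly p T x = 0)" for p
  define R where "R p \<longleftrightarrow> lead_coeff p = 1 \<and> (\<forall>x. op_poly p T x = 0)
     \<and> (\<forall>q. q \<noteq> 0 \<and> (\<forall>x. op_poly q T x = 0) \<longrightarrow> degree p \<le> degree q)" for p
  obtain p0 where "A p0"
    using annihilating_poly_exists[OF T] by (auto simp: A_def)
  then obtain p where p: "A p" "\<And>q. A q \<Longrightarrow> degree p \<le> degree q"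
    using ex_has_least_nat[of A p0 degree] by blast
  define m where "m = smult (inverse (lead_coeff p)) p"
  have "R m"
    using p by (auto simp: R_def m_def A_def op_poly_smult)
  moreover have "q = m" if "R q" for q
  proof (rule ccontr)
    assume "q \<noteq> m"
    then have ne: "q - m \<noteq> 0"
      by simp
    have "degree q = degree m"
      using \<open>R q\<close> \<open>R m\<close> unfolding R_def by (metis leading_coeff_0_iff order_antisym zero_neq_one)
    then have d: "degree (q - m) \<le> degree m" "coeff (q - m) (degree m) = 0"
      using \<open>R q\<close> \<open>R m\<close> by (auto simp: R_def intro: degree_diff_le)
    have "degree m \<le> degree (q - m)"
      using \<open>R q\<close> \<open>R m\<close> ne by (simp add: R_def op_poly_diff)
    then show False
      using d ne by (metis leading_coeff_0_iff order_antisym)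
  qed
  ultimately have "min_poly T = m"
    unfolding min_poly_def R_def[symmetric] by (rule the_equality)
  with \<open>R m\<close> show "lead_coeff (min_poly T) = 1" "op_poly (min_poly T) T x = 0"
    "q \<noteq> 0 \<Longrightarrow> (\<And>x. op_poly q T x = 0) \<Longrightarrow> degree (min_poly T) \<le> degree q"
    by (auto simp: R_def)
qed

text \<open>Dividing out the root leaves a cofactor \<open>q\<close> of smaller degree, which by
  minimality does not annihilate \<open>T\<close>; any nonzero value of \<open>q(T)\<close> is an
  eigenvector.\<close>

lemma min_poly_root_eigenvector:
  fixes T :: "('i::finite \<Rightarrow> complex) \<Rightarrow> ('i \<Rightarrow> complex)"
  assumes T: "op_linear UNIV T" and a: "poly (min_poly T) a = 0"
  shows "\<exists>v. v \<noteq> 0 \<and> T v = scl a v"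
proof -
  obtain q where q: "min_poly T = [:-a, 1:] * q"
    using a by (auto simp: poly_eq_0_iff_dvd)
  have ne: "q \<noteq> 0"
    using q min_poly_monic[OF T] by auto
  have "degree (min_poly T) = Suc (degree q)"
    unfolding q using ne by (subst degree_mult_eq) auto
  then obtain x where x: "op_poly q T x \<noteq> 0"
    using min_poly_minimal[OF T ne] by fastforce
  have "op_poly [:-a, 1:] T (op_poly q T x) = 0"
    using min_poly_annihilates[OF T, of x] unfolding q op_poly_mult[OF T] .
  then have "T (op_poly q T x) = scl a (op_poly q T x)"
    by (simp add: op_poly_linear_factor[OF T])
  with x show ?thesis
    by blast
qed

section \<open>Square roots, defect operators and completely non-unitary contractions\<close>

lemma real_interpolation:
  fixes f :: "real \<Rightarrow> real"
  assumes "finite R"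
  shows "\<exists>q :: real poly. \<forall>a\<in>R. poly q a = f a"
  using assms
proof (induction R rule: finite_induct)
  case (insert b R)
  then obtain q :: "real poly" where q: "\<forall>a\<in>R. poly q a = f a"
    by blast
  define w where "w = (\<Prod>a\<in>R. [:-a, 1:])"
  have wb: "poly w b \<noteq> 0"
    using insert.hyps by (auto simp: w_def poly_prod)
  have wR: "poly w a = 0" if "a \<in> R" for a
    using insert.hyps that by (auto simp: w_def poly_prod intro!: prod_zero bexI[of _ a])
  have "\<forall>a\<in>insert b R. poly (q + smult ((f b - poly q b) / poly w b) w) a = f a"
    using q wb wR by auto
  then show ?case
    by blast
qed simp

lemma prod_linear_factors_dvd:
  fixes g :: "complex poly"
  assumes "finite R" "\<And>a. a \<in> R \<Longrightarrow> poly g a = 0"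
  shows "(\<Prod>a\<in>R. [:-a, 1:]) dvd g"
  using assms
proof (induction R arbitrary: g rule: finite_induct)
  case (insert b R)
  then obtain h where h: "g = [:-b, 1:] * h"
    by (metis dvdE insertI1 poly_eq_0_iff_dvd)
  have "poly h a = 0" if "a \<in> R" for a
    using insert.prems[of a] insert.hyps that by (auto simp: h)
  then show ?case
    using insert.IH[of h] insert.hyps by (simp add: h mult_dvd_mono del: mult_pCons_left)
qed simp

lemma poly_map_poly_of_real: "poly (map_poly of_real q) (of_real a) = (of_real (poly q a) :: complex)"
  by (induction q) (simp_all add: map_poly_pCons)

lemma op_poly_selfadjoint:
  fixes A :: "('i::finite \<Rightarrow> complex) \<Rightarrow> ('i \<Rightarrow> complex)"
  assumes A: "op_linear UNIV A" and sa: "\<And>x y. l2_inner (A x) y = l2_inner x (A y)"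
  shows "l2_inner (op_poly (map_poly of_real (q :: real poly)) A x) y =
    l2_inner x (op_poly (map_poly of_real q) A y)"
proof (induction q arbitrary: y)
  case 0
  show ?case
    by (simp only: map_poly_0 op_poly_0 l2_inner_zero_left l2_inner_zero_right)
next
  case (pCons a q)
  have "l2_inner (op_poly (map_poly of_real (pCons a q)) A x) y =
      l2_inner x (op_poly (map_poly of_real (pCons a q)) A y)"
    by (simp add: map_poly_pCons op_poly_pCons[OF A] l2_inner_lin sa pCons.IH
        flip: op_poly_intertwine[OF A A])
  then show ?case .
qed

lemma positive_op_min_poly_root:
  assumes A: "positive_op A" and a: "poly (min_poly A) a = 0"
  shows "a = of_real (Re a)" "0 \<le> Re a"
proof -
  have L: "op_linear UNIV A" and sa: "\<And>x y. l2_inner (A x) y = l2_inner x (A y)"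
    and pos: "\<And>x. 0 \<le> Re (l2_inner (A x) x)"
    using A by (auto simp: positive_op_def)
  obtain v where v: "v \<noteq> 0" "A v = scl a v"
    using min_poly_root_eigenvector[OF L a] by blast
  define N where "N = (l2_norm v)\<^sup>2"
  have N: "N > 0"
    using v l2_norm_eq_0[of v] by (auto simp: N_def)
  have 1: "l2_inner (A v) v = a * of_real N"
    by (simp add: v(2) l2_inner_scl_left l2_inner_self N_def)
  have 2: "l2_inner v (A v) = cnj a * of_real N"
    by (simp add: v(2) l2_inner_scl_right l2_inner_self N_def)
  have "a = cnj a"
    using sa[of v v] N unfolding 1 2 by simp
  then show "a = of_real (Re a)"
    by (simp add: complex_eq_iff)
  show "0 \<le> Re a"
    using pos[of v] N unfolding 1 by (simp add: zero_le_mult_iff)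
qed

text \<open>A self-adjoint operator has no Jordan blocks. With \<open>z = (A - a) y\<close> and
  \<open>a\<close> real, \<open>(A - a) z = 0\<close> gives
  \<open><z, z> = <(A - a) z, y> = 0\<close>. So a double root could be replaced by a simple one,
  against minimality.\<close>

lemma positive_op_rsquarefree:
  assumes A: "positive_op A"
  shows "rsquarefree (min_poly A)"
proof -
  have L: "op_linear UNIV A" and sa: "\<And>x y. l2_inner (A x) y = l2_inner x (A y)"
    using A by (auto simp: positive_op_def)
  define m where "m = min_poly A"
  have m0: "m \<noteq> 0"
    using min_poly_monic[OF L] by (auto simp: m_def)
  have "order a m = 0 \<or> order a m = 1" for a
  proof (rule ccontr)
    assume "\<not> ?thesis"
    then have o2: "2 \<le> order a m"
      by auto
    then have "poly m a = 0"
      using m0 by (simp add: order_root)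
    then have ra: "cnj a = a"
      using positive_op_min_poly_root[OF A, of a] by (metis complex_cnj_complex_of_real m_def)
    have "[:-a, 1:] ^ 2 dvd m"
      using o2 order_1[of a m] by (meson dvd_trans le_imp_power_dvd)
    then obtain q where "m = [:-a, 1:] ^ 2 * q"
      by (rule dvdE)
    then have q: "m = [:-a, 1:] * ([:-a, 1:] * q)"
      by (simp only: power2_eq_square mult.assoc)
    define p where "p = [:-a, 1:] * q"
    have p0: "p \<noteq> 0"
      using m0 q by (auto simp: p_def)
    have "op_poly p A x = 0" for x
    proof -
      define y where "y = op_poly q A x"
      define z where "z = A y - scl a y"
      have z: "op_poly p A x = z"
        unfolding p_def op_poly_mult[OF L] by (simp add: op_poly_linear_factor[OF L] z_def y_def)
      have "op_poly m A x = 0"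
        unfolding m_def by (rule min_poly_annihilates[OF L])
      then have "A z - scl a z = 0"
        unfolding q p_def[symmetric] op_poly_mult[OF L] z by (simp add: op_poly_linear_factor[OF L])
      moreover have "l2_inner (A z - scl a z) y = l2_inner z z"
        by (subst (3) z_def) (simp add: l2_inner_lin sa ra)
      ultimately have "l2_inner z z = 0"
        by simp
      then show ?thesis
        unfolding z by (intro l2_inner_self_eq_0) auto
    qed
    then have "degree m \<le> degree p"
      unfolding m_def by (rule min_poly_minimal[OF L p0])
    moreover have "degree m = Suc (degree p)"
      unfolding q p_def[symmetric] using p0 by (subst degree_mult_eq) auto
    ultimately show False
      by simp
  qed
  with m0 show ?thesis
    by (simp add: rsquarefree_def m_def)
qed

text \<open>The minimal polynomial is a product of distinct linear factors, so it divides every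
  \<open>g\<close> that vanishes at its roots: \<open>g(A)\<close> depends only on the values of
  \<open>g\<close> on the spectrum.\<close>

lemma positive_op_annihilated:
  assumes A: "positive_op A" and g: "\<And>a. poly (min_poly A) a = 0 \<Longrightarrow> poly g a = 0"
  shows "op_poly g A x = 0"
proof -
  have L: "op_linear UNIV A"
    using A by (auto simp: positive_op_def)
  define m where "m = min_poly A"
  have m0: "m \<noteq> 0" and m1: "lead_coeff m = 1"
    using min_poly_monic[OF L] by (auto simp: m_def)
  have "m = (\<Prod>a | poly m a = 0. [:-a, 1:])"
    using complex_poly_decompose_rsquarefree[OF positive_op_rsquarefree[OF A]] m1
    by (simp add: m_def)
  also have "\<dots> dvd g"
    using g m0 by (intro prod_linear_factors_dvd poly_roots_finite) (auto simp: m_def)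
  finally obtain u where u: "g = u * m"
    by (auto simp: dvd_def mult.commute)
  show ?thesis
    unfolding u op_poly_mult[OF L] m_def min_poly_annihilates[OF L]
    by (rule op_linear_zero[OF op_poly_linear[OF L]]) simp
qed

text \<open>Moving from \<open>y\<close> against the direction \<open>G y\<close> changes the
  quadratic form by \<open>- 2 t N + t^2 K\<close>. The linear term wins for small \<open>t\<close>
  and would make the form negative.\<close>

lemma positive_op_inner_zero:
  assumes G: "positive_op G" and y: "Re (l2_inner (G y) y) = 0"
  shows "G y = 0"
proof (rule ccontr)
  assume "G y \<noteq> 0"
  have L: "op_linear UNIV G" and sa: "\<And>x y. l2_inner (G x) y = l2_inner x (G y)"
    and pos: "\<And>x. 0 \<le> Re (l2_inner (G x) x)"
    using G by (auto simp: positive_op_def)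
  define N where "N = (l2_norm (G y))\<^sup>2"
  define K where "K = Re (l2_inner (G (G y)) (G y))"
  have N: "N > 0"
    using \<open>G y \<noteq> 0\<close> l2_norm_eq_0[of "G y"] by (auto simp: N_def)
  have K: "K \<ge> 0"
    using pos by (simp add: K_def)
  have q: "0 \<le> - 2 * t * N + t\<^sup>2 * K" for t :: real
  proof -
    have "Re (l2_inner (G (y - scl (of_real t) (G y))) (y - scl (of_real t) (G y))) =
        - 2 * t * N + t\<^sup>2 * K"
      using y sa[of "G y" y]
      by (simp add: op_linear_diff[OF L csubspace_UNIV] op_linearD(2)[OF L] l2_inner_lin
          l2_inner_self N_def K_def algebra_simps power2_eq_square)
    then show ?thesis
      using pos[of "y - scl (of_real t) (G y)"] by simp
  qed
  \<comment> \<open>Any \<open>t > 0\<close> with \<open>t K < 2 N\<close> would do; the summand 1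
    covers \<open>K = 0\<close>.\<close>
  define t where "t = N / (K + 1)"
  have Nt: "N = t * (K + 1)" and t: "t > 0"
    using K N by (simp_all add: t_def)
  have "- 2 * t * N + t\<^sup>2 * K = - (t\<^sup>2 * (K + 2))"
    by (simp add: Nt algebra_simps power2_eq_square)
  moreover have "t\<^sup>2 * (K + 2) > 0"
    using t K by simp
  ultimately show False
    using q[of t] by linarith
qed

text \<open>For commuting roots, \<open>(H + G) (H - G) x = A x - A x = 0\<close>. With
  \<open>y = (H - G) x\<close>, positivity of both summands forces \<open>H y = G y = 0\<close>, and
  then \<open><y, y> = <x, (H - G) y> = 0\<close>.\<close>

lemma op_sqrt_unique:
  assumes A: "positive_op A" and G: "positive_op G" "\<And>x. G (G x) = A x"
    and H: "positive_op H" "\<And>x. H (H x) = A x" and comm: "\<And>x. H (G x) = G (H x)"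
  shows "H = G"
proof
  fix x
  have LG: "op_linear UNIV G" and LH: "op_linear UNIV H"
    and saG: "\<And>x y. l2_inner (G x) y = l2_inner x (G y)"
    and saH: "\<And>x y. l2_inner (H x) y = l2_inner x (H y)"
    using G H by (auto simp: positive_op_def)
  define y where "y = H x - G x"
  have "H y + G y = 0"
    unfolding y_def op_linear_diff[OF LG csubspace_UNIV UNIV_I UNIV_I]
      op_linear_diff[OF LH csubspace_UNIV UNIV_I UNIV_I]
    by (simp add: G H comm)
  then have "l2_inner (H y + G y) y = 0"
    by simp
  then have "Re (l2_inner (H y) y) + Re (l2_inner (G y) y) = 0"
    by (simp add: l2_inner_add_left flip: plus_complex.sel)
  moreover have "0 \<le> Re (l2_inner (H y) y)" "0 \<le> Re (l2_inner (G y) y)"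
    using G H by (auto simp: positive_op_def)
  ultimately have "Re (l2_inner (H y) y) = 0" "Re (l2_inner (G y) y) = 0"
    by linarith+
  then have z: "H y = 0" "G y = 0"
    using positive_op_inner_zero[OF H(1)] positive_op_inner_zero[OF G(1)] by blast+
  have "l2_inner y y = l2_inner (H x - G x) y"
    by (simp add: y_def)
  also have "\<dots> = l2_inner x (H y - G y)"
    by (simp add: l2_inner_lin saG saH)
  finally have "y = 0"
    using z by (intro l2_inner_self_eq_0) auto
  then show "H x = G x"
    by (simp add: y_def)
qed

text \<open>The square root is \<open>r(A)\<^sup>2\<close> for a real polynomial \<open>r\<close> interpolating the fourth root on the spectrum,
  so that its positivity is immediate.\<close>

lemma
  assumes A: "positive_op A"
  shows op_sqrt_positive: "positive_op (op_sqrt A)"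
    and op_sqrt_sqrt: "op_sqrt A (op_sqrt A x) = A x"
proof -
  have L: "op_linear UNIV A" and sa: "\<And>x y. l2_inner (A x) y = l2_inner x (A y)"
    using A by (auto simp: positive_op_def)
  define R where "R = {a. poly (min_poly A) a = 0}"
  have "min_poly A \<noteq> 0"
    using min_poly_monic[OF L] by auto
  then have "finite (Re ` R)"
    by (simp add: R_def poly_roots_finite)
  then obtain q :: "real poly" where q: "\<forall>a\<in>Re ` R. poly q a = sqrt (sqrt a)"
    using real_interpolation[of "Re ` R" "\<lambda>a. sqrt (sqrt a)"] by blast
  define r :: "complex poly" where "r = map_poly of_real q"
  define B where "B = op_poly r A"
  define G where "G x = B (B x)" for x
  have LB: "op_linear UNIV B"
    unfolding B_def by (rule op_poly_linear[OF L])
  have saB: "l2_inner (B x) y = l2_inner x (B y)" for x y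
    unfolding B_def r_def by (rule op_poly_selfadjoint[OF L sa])
  have pos: "0 \<le> Re (l2_inner (B (B x)) x)" for x
    unfolding saB[of "B x" x] by (simp add: l2_inner_self)
  have G: "positive_op G"
    unfolding positive_op_def G_def using op_linearD[OF LB] pos
    by (auto simp: op_linear_def) (metis saB)
  have "poly (r ^ 4 - [:0, 1:]) a = 0" if a: "poly (min_poly A) a = 0" for a
  proof -
    have b: "a = of_real (Re a)" "0 \<le> Re a"
      using positive_op_min_poly_root[OF A a] by auto
    have "poly r a = of_real (sqrt (sqrt (Re a)))"
      using q a by (subst b(1)) (auto simp: r_def poly_map_poly_of_real R_def)
    moreover have "sqrt (sqrt (Re a)) ^ 4 = Re a"
    proof -
      have "sqrt (sqrt (Re a)) ^ 4 = ((sqrt (sqrt (Re a)))\<^sup>2)\<^sup>2"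
        by (simp flip: power_mult)
      also have "\<dots> = Re a"
        using b(2) by simp
      finally show ?thesis .
    qed
    ultimately have "(poly r a) ^ 4 = a"
      using b(1) by (metis of_real_power)
    then show ?thesis
      by simp
  qed
  then have an: "op_poly (r ^ 4 - [:0, 1:]) A x = 0" for x
    by (rule positive_op_annihilated[OF A])
  have GG: "G (G x) = A x" for x
  proof -
    have "op_poly (r ^ 4) A x = op_poly [:0, 1:] A x"
      using an[of x] by (simp add: op_poly_diff)
    also have "\<dots> = A x"
      using op_poly_linear_factor[OF L, of 0 x] by simp
    finally show ?thesis
      unfolding G_def B_def op_poly_mult[OF L, symmetric] by (simp add: numeral_eq_Suc mult.assoc)
  qed
  \<comment> \<open>A competing root commutes with \<open>A = H^2\<close>, hence with every
    polynomial in \<open>A\<close> and in particular with \<open>G\<close>. This supplies the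
    commutation that the uniqueness argument requires.\<close>
  have "H = G" if H: "positive_op H \<and> (\<forall>x. H (H x) = A x)" for H
  proof (rule op_sqrt_unique[OF A G GG])
    have LH: "op_linear UNIV H"
      using H by (auto simp: positive_op_def)
    have "H (A x) = A (H x)" for x
      using H by metis
    then have "H (B x) = B (H x)" for x
      unfolding B_def by (rule op_poly_intertwine[OF L LH])
    then show "H (G x) = G (H x)" for x
      by (simp add: G_def)
  qed (use H in auto)
  then have "op_sqrt A = G"
    unfolding op_sqrt_def using G GG by (intro the_equality) auto
  then show "positive_op (op_sqrt A)" "op_sqrt A (op_sqrt A x) = A x"
    using G GG by auto
qed

section \<open>Defect operators and defect spaces\<close>

lemma positive_op_defect:
  assumes T: "contraction T"
  shows "positive_op (\<lambda>x. x - T (hadj T x))"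
proof -
  have L: "op_linear UNIV T"
    using T by (simp add: contraction_def)
  note LH = hadj_linear[OF L]
  have "op_linear UNIV (\<lambda>x. x - T (hadj T x))"
    using op_linearD[OF L] op_linearD[OF LH] by (auto simp: op_linear_def algebra_simps)
  moreover have "l2_inner (x - T (hadj T x)) y = l2_inner x (y - T (hadj T y))" for x y
    by (simp add: l2_inner_lin hadj_inner[OF L] flip: hadj_inner'[OF L])
  moreover have "0 \<le> Re (l2_inner (x - T (hadj T x)) x)" for x
  proof -
    have "l2_inner (x - T (hadj T x)) x = of_real ((l2_norm x)\<^sup>2 - (l2_norm (hadj T x))\<^sup>2)"
      by (simp add: l2_inner_diff_left hadj_inner[OF L] l2_inner_self)
    moreover have "(l2_norm (hadj T x))\<^sup>2 \<le> (l2_norm x)\<^sup>2"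
      by (intro power_mono hadj_norm_le T) auto
    ultimately show ?thesis
      by simp
  qed
  ultimately show ?thesis
    by (simp add: positive_op_def)
qed

text \<open>Besides linearity and the range, the norm identity is what later arguments use of the
  defect operator: it turns sums along the orbit of the adjoint into telescoping ones.\<close>

lemma
  assumes T: "contraction T"
  shows defect_linear: "op_linear UNIV (defect T)"
    and defect_norm_sq: "(l2_norm (defect T x))\<^sup>2 = (l2_norm x)\<^sup>2 - (l2_norm (hadj T x))\<^sup>2"
proof -
  have L: "op_linear UNIV T"
    using T by (simp add: contraction_def)
  have 1: "op_linear UNIV (defect T)" and 2: "\<And>x y. l2_inner (defect T x) y = l2_inner x (defect T y)"
    using op_sqrt_positive[OF positive_op_defect[OF T]] by (auto simp: defect_def positive_op_def)
  show "op_linear UNIV (defect T)"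
    by (rule 1)
  have "l2_inner (defect T x) (defect T x) = l2_inner (defect T (defect T x)) x"
    by (simp add: 2)
  also have "\<dots> = of_real ((l2_norm x)\<^sup>2 - (l2_norm (hadj T x))\<^sup>2)"
    unfolding defect_def op_sqrt_sqrt[OF positive_op_defect[OF T]]
    by (simp add: l2_inner_diff_left hadj_inner[OF L] l2_inner_self)
  finally show "(l2_norm (defect T x))\<^sup>2 = (l2_norm x)\<^sup>2 - (l2_norm (hadj T x))\<^sup>2"
    by (simp add: l2_norm_sq_eq_Re)
qed

lemma csubspace_range:
  fixes F :: "('i::finite \<Rightarrow> complex) \<Rightarrow> ('j::finite \<Rightarrow> complex)"
  assumes "op_linear UNIV F"
  shows "csubspace (range F)"
  using op_linear_zero[OF assms] op_linearD[OF assms]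
  unfolding csubspace_def by (auto simp: image_iff) metis+

lemma defect_space_eq:
  assumes "contraction T"
  shows "defect_space T = range (defect T)"
  unfolding defect_space_def
  using csubspace_range[OF defect_linear[OF assms]] determined_by_UNIV determined_by_closed closure_superset
  by blast

lemma csubspace_defect_space: "contraction T \<Longrightarrow> csubspace (defect_space T)"
  by (simp add: defect_space_eq csubspace_range defect_linear)

lemma defect_in_defect_space: "contraction T \<Longrightarrow> defect T x \<in> defect_space T"
  by (simp add: defect_space_eq)

text \<open>A root outside the open disc has an eigenvector \<open>v\<close>, and contractivity
  leaves only \<open>|a| = 1\<close>. Then \<open>v\<close> is also an eigenvector of the adjoint,
  for \<open>cnj a\<close>, so the line through \<open>v\<close> reduces \<open>T\<close> to a
  unitary, which complete non-unitarity excludes.\<close>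

lemma cnu_min_poly_root:
  assumes T: "contraction T" and cnu: "cnu T" and a: "poly (min_poly T) a = 0"
  shows "cmod a < 1"
proof (rule ccontr)
  assume "\<not> cmod a < 1"
  have L: "op_linear UNIV T"
    using T by (simp add: contraction_def)
  obtain v where v: "v \<noteq> 0" "T v = scl a v"
    using min_poly_root_eigenvector[OF L a] by blast
  have nv: "l2_norm v > 0"
    using v l2_norm_eq_0[of v] by (metis l2_finite l2_norm_nonneg less_eq_real_def)
  have "l2_norm (T v) \<le> l2_norm v"
    using T by (simp add: contraction_def)
  then have "cmod a * l2_norm v \<le> 1 * l2_norm v"
    unfolding v(2) l2_norm_scl by simp
  then have "cmod a \<le> 1"
    using nv by (simp only: mult_le_cancel_right_pos)
  then have a1: "cmod a = 1"
    using \<open>\<not> cmod a < 1\<close> by simp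
  then have aa: "a * cnj a = 1"
    by (simp flip: complex_norm_square)
  \<comment> \<open>This is the cross term in the expansion of \<open>||T^* v - cnj a v||^2\<close>.
    It equals \<open>||v||^2\<close>, so what remains is \<open>||T^* v||^2 - ||v||^2\<close>, and
    contractivity of the adjoint makes this at most zero.\<close>
  have "l2_inner (hadj T v) (scl (cnj a) v) = of_real ((l2_norm v)\<^sup>2)"
    by (simp add: l2_inner_scl_right hadj_inner'[OF L] v(2) l2_inner_self aa flip: mult.assoc)
  then have "(l2_norm (hadj T v - scl (cnj a) v))\<^sup>2 = (l2_norm (hadj T v))\<^sup>2 - (l2_norm v)\<^sup>2"
    by (subst l2_norm_sq_diff) (simp_all add: l2_norm_scl a1)
  also have "\<dots> \<le> 0"
    using power_mono[OF hadj_norm_le[OF T, of v], of 2] by simp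
  finally have "l2_norm (hadj T v - scl (cnj a) v) = 0"
    by simp
  then have hv: "hadj T v = scl (cnj a) v"
    using l2_norm_eq_0[of "hadj T v - scl (cnj a) v"] by simp
  define M where "M = range (\<lambda>c. scl c v)"
  have M: "csubspace M"
    unfolding csubspace_def M_def
    by (auto simp: image_iff intro: exI[of _ 0] simp flip: scl_add_left)
  have Tx: "T (scl c v) = scl (c * a) v" "hadj T (scl c v) = scl (c * cnj a) v" for c
    by (simp_all add: op_linearD(2)[OF L] op_linearD(2)[OF hadj_linear[OF L]] v hv)
  have "M \<subseteq> {0}"
  proof (rule cnu[unfolded cnu_def, rule_format], intro conjI ballI)
    show "csubspace M"
      by (rule M)
    show "l2_closure M \<subseteq> M"
      by (rule determined_by_closed[OF determined_by_UNIV[OF M]])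
    fix x assume "x \<in> M"
    then obtain c where c: "x = scl c v"
      by (auto simp: M_def)
    show "T x \<in> M" "hadj T x \<in> M"
      by (auto simp: c Tx M_def)
    show "hadj T (T x) = x" "T (hadj T x) = x"
      using aa by (simp_all add: c Tx mult.assoc mult.commute[of "cnj a"])
  qed
  moreover have "v \<in> M"
    unfolding M_def by (rule range_eqI[of _ _ 1]) simp
  ultimately show False
    using v by auto
qed

section \<open>Decay of the powers of a completely non-unitary contraction\<close>

lemma recurrence_tendsto_0:
  fixes u :: "nat \<Rightarrow> complex"
  assumes e: "(\<lambda>n. u (Suc n) - a * u n) \<longlonglongrightarrow> 0" and a: "cmod a < 1"
  shows "u \<longlonglongrightarrow> 0"
proof (rule LIMSEQ_I)
  fix r :: real assume r: "r > 0"
  \<comment> \<open>Errors below \<open>d\<close> accumulate to at most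
    \<open>d / (1 - |a|)\<close>, which this choice makes \<open>r / 2\<close>.\<close>
  define d where "d = r / 2 * (1 - cmod a)"
  have "d > 0"
    using r a by (simp add: d_def)
  then obtain N where N: "\<And>n. n \<ge> N \<Longrightarrow> cmod (u (Suc n) - a * u n) < d"
    using LIMSEQ_D[OF e] by auto
  have b: "cmod (u (N + k)) \<le> cmod a ^ k * cmod (u N) + r / 2" for k
  proof (induction k)
    case (Suc k)
    have "cmod (u (N + Suc k)) = cmod ((u (Suc (N + k)) - a * u (N + k)) + a * u (N + k))"
      by simp
    also have "\<dots> \<le> cmod (u (Suc (N + k)) - a * u (N + k)) + cmod (a * u (N + k))"
      by (rule norm_triangle_ineq)
    also have "\<dots> \<le> d + cmod a * (cmod a ^ k * cmod (u N) + r / 2)"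
      using N[of "N + k"] Suc by (intro add_mono) (auto simp: norm_mult intro: mult_left_mono)
    also have "\<dots> = cmod a ^ Suc k * cmod (u N) + r / 2"
      by (simp add: d_def field_simps)
    finally show ?case .
  qed (use r in simp)
  have "(\<lambda>k. cmod a ^ k * cmod (u N)) \<longlonglongrightarrow> 0 * cmod (u N)"
    using a by (intro tendsto_mult LIMSEQ_power_zero) auto
  then obtain K where K: "\<And>k. k \<ge> K \<Longrightarrow> cmod a ^ k * cmod (u N) < r / 2"
    using LIMSEQ_D[of "\<lambda>k. cmod a ^ k * cmod (u N)" 0 "r / 2"] r by auto
  show "\<exists>no. \<forall>n\<ge>no. norm (u n - 0) < r"
  proof (intro exI allI impI)
    fix n assume "n \<ge> N + K"
    then have "cmod (u (N + (n - N))) < r"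
      using b[of "n - N"] K[of "n - N"] by linarith
    then show "norm (u n - 0) < r"
      using \<open>n \<ge> N + K\<close> by simp
  qed
qed

text \<open>If \<open>p = (X - a) q\<close>, the scalars \<open>u n = <q(T) T^n x, y>\<close>
  satisfy \<open>u (n+1) - a * u n = <p(T) T^n x, y>\<close>, so decay for \<open>p\<close> passes
  to \<open>q\<close> by the scalar recurrence. The statement keeps \<open>p\<close> general so that
  it can descend from the minimal polynomial, where the sequence is identically zero, to a nonzero
  constant.\<close>

lemma op_poly_powers_tendsto_0:
  fixes T :: "('i::finite \<Rightarrow> complex) \<Rightarrow> ('i \<Rightarrow> complex)"
  assumes T: "op_linear UNIV T"
  shows "p \<noteq> 0 \<Longrightarrow> (\<And>a. poly p a = 0 \<Longrightarrow> cmod a < 1) \<Longrightarrow>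
    (\<lambda>n. l2_inner (op_poly p T ((T ^^ n) x)) y) \<longlonglongrightarrow> 0 \<Longrightarrow>
    (\<lambda>n. l2_inner ((T ^^ n) x) y) \<longlonglongrightarrow> 0"
proof (induction "degree p" arbitrary: p)
  case 0
  then obtain c where c: "p = [:c:]"
    by (metis degree_eq_zeroE)
  have "c \<noteq> 0"
    using 0 c by simp
  have "(\<lambda>n. l2_inner (op_poly p T ((T ^^ n) x)) y) \<longlonglongrightarrow> 0"
    by (rule "0.prems"(3))
  then have "(\<lambda>n. c * l2_inner ((T ^^ n) x) y) \<longlonglongrightarrow> 0"
    by (simp add: c op_poly_pCons[OF T] op_linear_zero[OF T] l2_inner_scl_left)
  then have "(\<lambda>n. inverse c * (c * l2_inner ((T ^^ n) x) y)) \<longlonglongrightarrow> inverse c * 0"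
    by (intro tendsto_mult tendsto_const)
  then show ?case
    using \<open>c \<noteq> 0\<close> by (simp flip: mult.assoc)
next
  case (Suc d)
  then have "\<not> constant (poly p)"
    by (simp add: constant_degree)
  then obtain a where a: "poly p a = 0"
    using fundamental_theorem_of_algebra by blast
  then obtain q where q: "p = [:-a, 1:] * q"
    by (auto simp: poly_eq_0_iff_dvd)
  have q0: "q \<noteq> 0"
    using Suc.prems(1) q by auto
  have dq: "d = degree q"
    using Suc.hyps(2) q0 unfolding q by (subst (asm) degree_mult_eq) auto
  have "(\<lambda>n. l2_inner (op_poly q T ((T ^^ Suc n) x)) y - a * l2_inner (op_poly q T ((T ^^ n) x)) y) \<longlonglongrightarrow> 0"
    using Suc.prems(3) unfolding q op_poly_mult[OF T]
    by (simp add: op_poly_linear_factor[OF T] l2_inner_lin op_poly_intertwine[OF T T])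
  then have "(\<lambda>n. l2_inner (op_poly q T ((T ^^ n) x)) y) \<longlonglongrightarrow> 0"
    by (rule recurrence_tendsto_0) (rule Suc.prems(2)[OF a])
  moreover have "cmod b < 1" if "poly q b = 0" for b
    using Suc.prems(2)[of b] that by (simp add: q)
  ultimately show ?case
    using Suc.hyps(1)[OF dq q0] by blast
qed

lemma l2_norm_tendsto_0:
  fixes f :: "nat \<Rightarrow> 'i::finite \<Rightarrow> complex"
  assumes "\<And>i. (\<lambda>n. f n i) \<longlonglongrightarrow> 0"
  shows "(\<lambda>n. l2_norm (f n)) \<longlonglongrightarrow> 0"
proof -
  have "(\<lambda>n. (cmod (f n i))\<^sup>2) \<longlonglongrightarrow> 0" for i
    using tendsto_power[OF tendsto_norm_zero[OF assms], of i 2] by simp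
  then have "(\<lambda>n. \<Sum>i\<in>UNIV. (cmod (f n i))\<^sup>2) \<longlonglongrightarrow> (\<Sum>i\<in>(UNIV :: 'i set). 0)"
    by (intro tendsto_sum)
  then have "(\<lambda>n. sqrt ((l2_norm (f n))\<^sup>2)) \<longlonglongrightarrow> sqrt 0"
    by (intro tendsto_real_sqrt) (simp add: l2_norm_sq_finite)
  then show ?thesis
    by simp
qed

lemma cnu_powers_tendsto_0:
  fixes T :: "('i::finite \<Rightarrow> complex) \<Rightarrow> ('i \<Rightarrow> complex)"
  assumes T: "contraction T" and cnu: "cnu T"
  shows "(\<lambda>n. l2_norm ((hadj T ^^ n) h)) \<longlonglongrightarrow> 0"
proof -
  have L: "op_linear UNIV T"
    using T by (simp add: contraction_def)
  have "min_poly T \<noteq> 0"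
    using min_poly_monic[OF L] by auto
  then have lim: "(\<lambda>n. l2_inner ((T ^^ n) x) y) \<longlonglongrightarrow> 0" for x y
    by (rule op_poly_powers_tendsto_0[OF L])
       (auto simp: min_poly_annihilates[OF L] intro: cnu_min_poly_root[OF T cnu])
  \<comment> \<open>The coordinates of the adjoint orbit are conjugate matrix coefficients of
    \<open>T^n\<close>, so the weak decay of the powers of \<open>T\<close> itself suffices.\<close>
  have "((hadj T ^^ n) h) i = cnj (l2_inner ((T ^^ n) (unit_vec i)) h)" for n i
    unfolding hadj_funpow_inner[OF L] by (simp add: l2_inner_unit_vec flip: l2_inner_commute)
  then have "(\<lambda>n. ((hadj T ^^ n) h) i) \<longlonglongrightarrow> 0" for i
    using tendsto_cnj[OF lim[of "unit_vec i" h]] by simp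
  then show ?thesis
    by (rule l2_norm_tendsto_0)
qed

section \<open>The Hardy space and the model space\<close>

definition backshift :: "(nat \<Rightarrow> complex) \<Rightarrow> nat \<Rightarrow> complex" where
  "backshift x = (\<lambda>n. x (Suc n))"

lemma backshift_funpow: "(backshift ^^ k) x n = x (n + k)"
  by (induction k arbitrary: n) (simp_all add: backshift_def)

lemma range_Suc: "range Suc = {0<..}"
  by (auto simp: image_iff gr0_conv_Suc)

lemma has_sum_shift:
  assumes "f 0 = (0 :: 'b :: topological_comm_monoid_add)"
  shows "(f has_sum s) UNIV \<longleftrightarrow> ((\<lambda>n. f (Suc n)) has_sum s) UNIV"
proof -
  have "(f has_sum s) UNIV \<longleftrightarrow> (f has_sum s) (range Suc)"
    by (rule has_sum_cong_neutral) (use assms in \<open>auto simp: range_Suc\<close>)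
  also have "\<dots> \<longleftrightarrow> ((\<lambda>n. f (Suc n)) has_sum s) UNIV"
    by (subst has_sum_reindex) (auto simp: o_def)
  finally show ?thesis .
qed

lemma infsum_shift:
  assumes "f 0 = (0 :: 'b :: {topological_comm_monoid_add, t2_space})"
  shows "infsum f UNIV = infsum (\<lambda>n. f (Suc n)) UNIV"
proof -
  have "infsum f UNIV = infsum f (range Suc)"
    by (rule infsum_cong_neutral) (use assms in \<open>auto simp: range_Suc\<close>)
  also have "\<dots> = infsum (\<lambda>n. f (Suc n)) UNIV"
    by (subst infsum_reindex) (auto simp: o_def)
  finally show ?thesis .
qed

lemma l2_shift [simp]: "l2 x \<Longrightarrow> l2 (shift x)"
  unfolding l2_def summable_on_def by (subst has_sum_shift) (auto simp: shift_def)

lemma l2_norm_shift: "l2_norm (shift x) = l2_norm x"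
  unfolding l2_norm_def by (subst infsum_shift) (auto simp: shift_def)

lemma l2_backshift [simp]:
  assumes "l2 x"
  shows "l2 (backshift x)"
proof -
  have "(\<lambda>n. (cmod (x n))\<^sup>2) summable_on range Suc"
    using assms unfolding l2_def by (rule summable_on_subset_banach) simp
  then show ?thesis
    unfolding l2_def by (subst (asm) summable_on_reindex) (auto simp: o_def backshift_def)
qed

lemma l2_inner_shift: "l2_inner x (shift y) = l2_inner (backshift x) y"
  unfolding l2_inner_def by (subst infsum_shift) (auto simp: shift_def backshift_def)

lemma l2_shift_funpow: "l2 x \<Longrightarrow> l2 ((shift ^^ k) x)"
  by (induction k) auto

lemma l2_backshift_funpow: "l2 x \<Longrightarrow> l2 ((backshift ^^ k) x)"
  by (induction k) auto

lemma l2_inner_shift_funpow: "l2_inner x ((shift ^^ k) y) = l2_inner ((backshift ^^ k) x) y"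
  by (induction k arbitrary: x) (simp_all add: l2_inner_shift funpow_swap1[of backshift])

lemma fps_nth_X_mult: "fps_nth (fps_X * F) = shift (fps_nth F)"
  by (auto simp: shift_def fun_eq_iff)

lemma fps_nth_X_power_mult: "fps_nth (fps_X ^ k * F) = (shift ^^ k) (fps_nth F)"
  by (induction k) (simp_all add: fps_nth_X_mult mult.assoc)

lemma fps_nth_sum_fun: "fps_nth (sum f A) = (\<Sum>k\<in>A. fps_nth (f k))"
  by (auto simp: fps_sum_nth sum_fun_apply)

lemma fps_nth_poly_mult: "fps_nth (fps_of_poly p * F) = op_poly p shift (fps_nth F)"
proof -
  have "fps_of_poly p = fps_of_poly (\<Sum>i\<le>degree p. monom (coeff p i) i)"
    by (simp add: poly_as_sum_of_monoms)
  also have "\<dots> = (\<Sum>i\<le>degree p. fps_const (coeff p i) * fps_X ^ i)"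
    by (simp add: fps_of_poly_sum fps_of_poly_monom)
  finally have "fps_of_poly p * F = (\<Sum>i\<le>degree p. fps_const (coeff p i) * (fps_X ^ i * F))"
    by (simp add: sum_distrib_right mult.assoc)
  moreover have "fps_nth (fps_const c * G) = scl c (fps_nth G)" for c and G :: "complex fps"
    by auto
  ultimately show ?thesis
    by (simp add: op_poly_def fps_nth_sum_fun fps_nth_X_power_mult)
qed

text \<open>The adjoint of multiplication by a polynomial on the Hardy space.\<close>

definition recur :: "complex poly \<Rightarrow> (nat \<Rightarrow> complex) \<Rightarrow> nat \<Rightarrow> complex" where
  "recur p x = (\<lambda>n. \<Sum>i\<le>degree p. cnj (coeff p i) * x (n + i))"

lemma recur_altdef: "recur p x = (\<Sum>i\<le>degree p. scl (cnj (coeff p i)) ((backshift ^^ i) x))"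
  by (auto simp: recur_def sum_fun_apply backshift_funpow)

lemma l2_inner_poly_shift:
  assumes "l2 x" "l2 y"
  shows "l2_inner x (op_poly p shift y) = l2_inner (recur p x) y"
  unfolding op_poly_def recur_altdef using assms
  by (simp add: l2_inner_sum_left l2_inner_sum_right l2_shift_funpow l2_backshift_funpow
      l2_inner_scl_left l2_inner_scl_right l2_inner_shift_funpow)

section \<open>Boundedness of the inverse Blaschke denominators as multipliers\<close>

lemma l2_nat_iff: "l2 x \<longleftrightarrow> summable (\<lambda>n. (cmod (x n))\<^sup>2)"
  unfolding l2_def by (rule summable_on_UNIV_nonneg_real_iff) simp

lemma l2_norm_sq_nat:
  assumes "l2 x"
  shows "(\<lambda>n. (cmod (x n))\<^sup>2) sums (l2_norm x)\<^sup>2"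
  using assms unfolding l2_norm_sq l2_def by (intro has_sum_imp_sums) simp

text \<open>Convexity of the square with weights \<open>1 - q\<close> and \<open>q\<close>, applied
  to \<open>a / (1 - q)\<close> and \<open>b\<close>.\<close>

lemma weighted_square_bound:
  fixes a b q :: real
  assumes "0 \<le> q" "q < 1"
  shows "(a + q * b)\<^sup>2 \<le> a\<^sup>2 / (1 - q) + q * b\<^sup>2"
proof -
  have "a\<^sup>2 / (1 - q) + q * b\<^sup>2 - (a + q * b)\<^sup>2 = q * (a - (1 - q) * b)\<^sup>2 / (1 - q)"
    using assms by (simp add: field_simps power2_eq_square)
  also have "\<dots> \<ge> 0"
    using assms by simp
  finally show ?thesis
    by simp
qed

text \<open>Dividing by \<open>1 - c z\<close> amounts to the recursion
  \<open>G (n+1) = F (n+1) + c G n\<close>. The weighted square inequality turns it into a bound on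
  partial energies, an elementary form of the multiplier norm estimate
  \<open>1 / (1 - |c|)\<close>.\<close>

lemma l2_inverse_linear_mult:
  assumes F: "l2 (fps_nth F)" and c: "cmod c < 1"
  shows "l2 (fps_nth (inverse (1 - fps_const c * fps_X) * F))"
proof -
  define G where "G = inverse (1 - fps_const c * fps_X) * F"
  define q where "q = cmod c"
  define E where "E = (l2_norm (fps_nth F))\<^sup>2"
  have q: "0 \<le> q" "q < 1"
    using c by (auto simp: q_def)
  have "(1 - fps_const c * fps_X) * G = F"
    unfolding G_def mult.assoc[symmetric] by (subst inverse_mult_eq_1') auto
  then have FG: "F = G - fps_const c * (fps_X * G)"
    by (simp add: algebra_simps)
  have G0: "G $ 0 = F $ 0" and GS: "G $ Suc n = F $ Suc n + c * G $ n" for n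
    unfolding FG by simp_all
  have EF: "(\<Sum>n<N. (cmod (F $ n))\<^sup>2) \<le> E" for N
    using l2_norm_sq_nat[OF F] unfolding E_def by (intro sum_le_suminf[THEN order_trans])
      (auto simp: sums_iff)
  have E0: "E \<ge> 0"
    by (simp add: E_def)
  \<comment> \<open>The constant \<open>K = E / (1 - q)^2\<close> is the fixed point of
    \<open>K = E / (1 - q) + q K\<close>, the inequality produced by one induction step.\<close>
  have bound: "(\<Sum>n<N. (cmod (G $ n))\<^sup>2) \<le> E / (1 - q)\<^sup>2" for N
  proof (induction N)
    case 0
    then show ?case
      using E0 by simp
  next
    case (Suc N)
    have "(cmod (G $ Suc n))\<^sup>2 \<le> (cmod (F $ Suc n))\<^sup>2 / (1 - q) + q * (cmod (G $ n))\<^sup>2" for n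
    proof -
      have "cmod (G $ Suc n) \<le> cmod (F $ Suc n) + q * cmod (G $ n)"
        unfolding GS q_def norm_mult[symmetric] by (rule norm_triangle_ineq)
      then have "(cmod (G $ Suc n))\<^sup>2 \<le> (cmod (F $ Suc n) + q * cmod (G $ n))\<^sup>2"
        by (intro power_mono) auto
      also have "\<dots> \<le> (cmod (F $ Suc n))\<^sup>2 / (1 - q) + q * (cmod (G $ n))\<^sup>2"
        by (rule weighted_square_bound[OF q])
      finally show ?thesis .
    qed
    then have "(\<Sum>n<N. (cmod (G $ Suc n))\<^sup>2) \<le>
        (\<Sum>n<N. (cmod (F $ Suc n))\<^sup>2 / (1 - q) + q * (cmod (G $ n))\<^sup>2)"
      by (rule sum_mono)
    also have "\<dots> = (\<Sum>n<N. (cmod (F $ Suc n))\<^sup>2) / (1 - q) + q * (\<Sum>n<N. (cmod (G $ n))\<^sup>2)"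
      by (simp add: sum.distrib sum_distrib_left sum_divide_distrib)
    finally have 1: "(\<Sum>n<N. (cmod (G $ Suc n))\<^sup>2) \<le>
        (\<Sum>n<N. (cmod (F $ Suc n))\<^sup>2) / (1 - q) + q * (\<Sum>n<N. (cmod (G $ n))\<^sup>2)" .
    have 2: "(cmod (F $ 0))\<^sup>2 \<le> (cmod (F $ 0))\<^sup>2 / (1 - q)"
      using q by (simp add: field_simps mult_left_le)
    have "(\<Sum>n<Suc N. (cmod (G $ n))\<^sup>2) \<le>
        ((cmod (F $ 0))\<^sup>2 + (\<Sum>n<N. (cmod (F $ Suc n))\<^sup>2)) / (1 - q) + q * (\<Sum>n<N. (cmod (G $ n))\<^sup>2)"
      unfolding sum.lessThan_Suc_shift G0 add_divide_distrib using 1 2 by linarith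
    also have "\<dots> \<le> E / (1 - q) + q * (E / (1 - q)\<^sup>2)"
      using q Suc EF[of "Suc N"] unfolding sum.lessThan_Suc_shift
      by (intro add_mono divide_right_mono mult_left_mono) auto
    also have "\<dots> = E / (1 - q)\<^sup>2"
      using q by (simp add: divide_simps power2_eq_square) (simp add: algebra_simps)
    finally show ?case .
  qed
  have "summable (\<lambda>n. (cmod (G $ n))\<^sup>2)"
  proof (rule bounded_imp_summable)
    show "(\<Sum>k\<le>n. (cmod (G $ k))\<^sup>2) \<le> E / (1 - q)\<^sup>2" for n
      using bound[of "Suc n"] by (simp only: lessThan_Suc_atMost)
  qed simp
  then show ?thesis
    by (simp add: l2_nat_iff G_def)
qed

lemma l2_inverse_linear_power_mult:
  assumes "l2 (fps_nth F)" "cmod c < 1"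
  shows "l2 (fps_nth (inverse (1 - fps_const c * fps_X) ^ k * F))"
proof (induction k)
  case (Suc k)
  have "l2 (fps_nth (inverse (1 - fps_const c * fps_X) * (inverse (1 - fps_const c * fps_X) ^ k * F)))"
    by (rule l2_inverse_linear_mult[OF Suc assms(2)])
  then show ?case
    by (simp add: mult.assoc)
qed (use assms in simp)

lemma l2_inverse_linear_prod_mult:
  assumes "finite R" "l2 (fps_nth F)" "\<And>a. a \<in> R \<Longrightarrow> cmod (c a) < 1"
  shows "l2 (fps_nth ((\<Prod>a\<in>R. inverse (1 - fps_const (c a) * fps_X) ^ k a) * F))"
  using assms(1,3)
proof (induction R rule: finite_induct)
  case (insert b R)
  have "l2 (fps_nth (inverse (1 - fps_const (c b) * fps_X) ^ k b *
      ((\<Prod>a\<in>R. inverse (1 - fps_const (c a) * fps_X) ^ k a) * F)))"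
    using insert.IH insert.prems by (intro l2_inverse_linear_power_mult) auto
  then show ?case
    using insert.hyps by (simp add: mult.assoc)
qed (use assms in simp)

section \<open>The model space as the solution space of a linear recurrence\<close>

lemma l2_finite_support:
  assumes "finite {n. x n \<noteq> 0}"
  shows "l2 x"
proof -
  have "(\<lambda>n. (cmod (x n))\<^sup>2) summable_on {n. x n \<noteq> 0}"
    using assms by simp
  then show ?thesis
    unfolding l2_def by (subst summable_on_cong_neutral[where T = "{n. x n \<noteq> 0}" and g = "\<lambda>n. (cmod (x n))\<^sup>2"]) auto
qed

lemma l2_unit_vec [simp]: "l2 (unit_vec j)"
  by (rule l2_finite_support) (auto simp: unit_vec_def intro: finite_subset[of _ "{j}"])

text \<open>The Blaschke product factors as \<open>m g\<close>, with \<open>g\<close> collecting the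
  inverse denominators. Moving \<open>m\<close> across the inner product leaves the condition that
  \<open>recur m x\<close> is orthogonal to \<open>g H2\<close>. That set contains every unit
  vector, because \<open>g\<close> has the polynomial \<open>d\<close> as its inverse.\<close>

lemma model_space_iff:
  assumes T: "contraction T" and cnu: "cnu T"
  shows "x \<in> model_space T \<longleftrightarrow> l2 x \<and> recur (min_poly T) x = 0"
proof -
  have L: "op_linear UNIV T"
    using T by (simp add: contraction_def)
  define m where "m = min_poly T"
  define R where "R = {a. poly m a = 0}"
  have m1: "lead_coeff m = 1"
    unfolding m_def by (rule min_poly_monic[OF L])
  then have "m \<noteq> 0"
    by auto
  then have R: "finite R"
    unfolding R_def by (rule poly_roots_finite)
  have disc: "cmod (cnj a) < 1" if "a \<in> R" for a
    using cnu_min_poly_root[OF T cnu, of a] that by (simp add: R_def m_def)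
  define g where "g = (\<Prod>a\<in>R. inverse (1 - fps_const (cnj a) * fps_X) ^ order a m)"
  define d where "d = (\<Prod>a\<in>R. [:1, - cnj a:] ^ order a m)"
  have "fps_of_poly m = fps_of_poly (\<Prod>a\<in>R. [:- a, 1:] ^ order a m)"
    using complex_poly_decompose[of m] m1 by (simp add: R_def)
  also have "\<dots> = (\<Prod>a\<in>R. (fps_X - fps_const a) ^ order a m)"
    by (simp add: fps_of_poly_prod fps_of_poly_power fps_of_poly_linear fps_const_neg[symmetric] del: fps_const_neg)
  finally have b: "blaschke_fps T = fps_of_poly m * g"
    unfolding blaschke_fps_def Let_def m_def[symmetric] R_def[symmetric] g_def
    by (simp add: power_mult_distrib prod.distrib)
  have "g * fps_of_poly d = 1"
  proof -
    have "inverse (1 - fps_const (cnj a) * fps_X) ^ order a m * fps_of_poly [:1, - cnj a:] ^ order a m = 1" for a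
    proof -
      have "fps_of_poly [:1, - cnj a:] = 1 - fps_const (cnj a) * fps_X"
        by (simp add: fps_of_poly_linear' fps_const_neg[symmetric] del: fps_const_neg)
      moreover have "inverse (1 - fps_const (cnj a) * fps_X) * (1 - fps_const (cnj a) * fps_X) = 1"
        by (rule inverse_mult_eq_1) simp
      ultimately show ?thesis
        by (simp only: power_mult_distrib[symmetric] power_one)
    qed
    then show ?thesis
      by (simp add: g_def d_def fps_of_poly_prod fps_of_poly_power prod.distrib[symmetric])
  qed
  have lg: "l2 (fps_nth (g * Abs_fps f))" if "l2 f" for f
    unfolding g_def using disc R that
    by (intro l2_inverse_linear_prod_mult) (auto simp: Abs_fps_inverse)
  have mb: "mult_fps (blaschke_fps T) f = op_poly m shift (fps_nth (g * Abs_fps f))" for f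
    unfolding mult_fps_def b mult.assoc fps_nth_poly_mult ..
  have key: "l2_inner x (mult_fps (blaschke_fps T) f) = l2_inner (recur m x) (fps_nth (g * Abs_fps f))"
    if "l2 x" "l2 f" for f
    unfolding mb by (rule l2_inner_poly_shift[OF that(1) lg[OF that(2)]])
  show ?thesis
  proof
    assume x: "x \<in> model_space T"
    then have lx: "l2 x"
      by (simp add: model_space_def H2_def)
    have "recur m x n = 0" for n
    proof -
      \<comment> \<open>The factor \<open>d\<close> cancels \<open>g\<close>, so this test function
        contributes the single power \<open>z^n\<close> and the pairing isolates coefficient
        \<open>n\<close>.\<close>
      define f where "f = fps_nth (fps_of_poly (d * monom 1 n))"
      have lf: "l2 f"
        unfolding f_def
        by (rule l2_finite_support, rule finite_subset[of _ "{..degree (d * monom 1 n)}"])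
           (auto intro: le_degree)
      have "g * Abs_fps f = (g * fps_of_poly d) * fps_X ^ n"
        by (simp add: f_def fps_nth_inverse fps_of_poly_mult fps_of_poly_monom' mult.assoc)
      then have "fps_nth (g * Abs_fps f) = unit_vec n"
        by (auto simp: \<open>g * fps_of_poly d = 1\<close> unit_vec_def)
      then have "recur m x n = l2_inner x (mult_fps (blaschke_fps T) f)"
        by (simp add: key[OF lx lf] l2_inner_unit_vec)
      also have "\<dots> = 0"
        using x lf by (simp add: model_space_def H2_def)
      finally show ?thesis .
    qed
    then show "l2 x \<and> recur (min_poly T) x = 0"
      using lx by (auto simp: m_def)
  next
    assume "l2 x \<and> recur (min_poly T) x = 0"
    then show "x \<in> model_space T"
      by (auto simp: model_space_def H2_def key m_def)
  qed
qed

text \<open>As the minimal polynomial is monic, \<open>recur m x = 0\<close> expresses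
  \<open>x (k + degree m)\<close> through the preceding \<open>degree m\<close> entries. The initial
  entries therefore determine the whole sequence.\<close>

lemma determined_by_model_space:
  assumes T: "contraction T" and cnu: "cnu T"
  shows "determined_by {..<degree (min_poly T)} (model_space T)"
proof -
  have L: "op_linear UNIV T"
    using T by (simp add: contraction_def)
  define m where "m = min_poly T"
  have m1: "coeff m (degree m) = 1"
    unfolding m_def by (rule min_poly_monic[OF L])
  note iff = model_space_iff[OF T cnu, folded m_def]
  have "recur m (x + y) = recur m x + recur m y" "recur m (scl c x) = scl c (recur m x)" for x y c
    by (auto simp: recur_def algebra_simps sum.distrib sum_distrib_left)
  moreover have "recur m 0 = 0"
    by (auto simp: recur_def)
  ultimately have "csubspace (model_space T)"
    unfolding csubspace_def by (auto simp: iff)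
  moreover have "x = 0" if x: "x \<in> model_space T" and z: "\<forall>j<degree m. x j = 0" for x
  proof
    fix n
    show "x n = 0 n"
    proof (induction n rule: less_induct)
      case (less n)
      show ?case
      proof (cases "n < degree m")
        case False
        define k where "k = n - degree m"
        have n: "n = k + degree m"
          using False by (simp add: k_def)
        have "recur m x k = 0"
          using x by (simp add: iff)
        moreover have "recur m x k = (\<Sum>i<degree m. cnj (coeff m i) * x (k + i)) + x n"
          by (simp add: recur_def m1 n flip: lessThan_Suc_atMost)
        moreover have "(\<Sum>i<degree m. cnj (coeff m i) * x (k + i)) = 0"
          using less by (intro sum.neutral) (auto simp: n)
        ultimately show ?thesis
          by simp
      qed (use z in simp)
    qed
  qed
  ultimately show ?thesis
    by (auto simp: determined_by_def m_def)
qed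

section \<open>Vector-valued Hardy space\<close>

text \<open>Two readings of one vector-valued Hardy function: \<open>slice\<close> gives its Taylor
  coefficients as vectors, \<open>coord\<close> its components as scalar Hardy functions.\<close>

definition slice :: "(nat \<times> 'i \<Rightarrow> complex) \<Rightarrow> nat \<Rightarrow> 'i \<Rightarrow> complex" where
  "slice x n = (\<lambda>i. x (n, i))"

definition coord :: "(nat \<times> 'i \<Rightarrow> complex) \<Rightarrow> 'i \<Rightarrow> nat \<Rightarrow> complex" where
  "coord x i = (\<lambda>n. x (n, i))"

lemma slice_apply [simp]: "slice x n i = x (n, i)"
  by (simp add: slice_def)

lemma coord_apply [simp]: "coord x i n = x (n, i)"
  by (simp add: coord_def)

lemma slice_add: "slice (x + y) n = slice x n + slice y n"
  and slice_diff: "slice (x - y) n = slice x n - slice y n"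
  and slice_scl: "slice (scl c x) n = scl c (slice x n)"
  and slice_zero: "slice 0 n = 0"
  by auto

lemma coord_add: "coord (x + y) i = coord x i + coord y i"
  and coord_diff: "coord (x - y) i = coord x i - coord y i"
  and coord_scl: "coord (scl c x) i = scl c (coord x i)"
  and coord_zero: "coord 0 i = 0"
  by auto

lemma has_sum_coords:
  fixes f :: "nat \<times> 'i::finite \<Rightarrow> 'b::topological_comm_monoid_add"
  assumes "\<And>i. ((\<lambda>n. f (n, i)) has_sum g i) UNIV"
  shows "(f has_sum (\<Sum>i\<in>UNIV. g i)) UNIV"
proof -
  have "(f has_sum (\<Sum>i\<in>UNIV. g i)) (\<Union>i\<in>UNIV. range (\<lambda>n. (n, i)))"
  proof (rule sum_has_sum)
    fix i :: 'i
    show "(f has_sum g i) (range (\<lambda>n. (n, i)))"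
      using assms[of i] by (subst has_sum_reindex) (auto simp: inj_on_def o_def)
  qed auto
  also have "(\<Union>i\<in>UNIV. range (\<lambda>n. (n, i))) = UNIV"
    by auto
  finally show ?thesis .
qed

lemma l2_coord_iff: "l2 x \<longleftrightarrow> (\<forall>i :: 'i::finite. l2 (coord x i))"
proof (intro iffI allI)
  fix i assume "l2 x"
  then have "(\<lambda>p. (cmod (x p))\<^sup>2) summable_on range (\<lambda>n. (n, i))"
    unfolding l2_def by (rule summable_on_subset_banach) simp
  then show "l2 (coord x i)"
    unfolding l2_def by (subst (asm) summable_on_reindex) (auto simp: inj_on_def o_def)
next
  assume "\<forall>i. l2 (coord x i)"
  then have "((\<lambda>n. (cmod (x (n, i)))\<^sup>2) has_sum (\<Sum>\<^sub>\<infinity>n. (cmod (x (n, i)))\<^sup>2)) UNIV" for i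
    by (intro has_sum_infsum) (auto simp: l2_def)
  from has_sum_coords[OF this] show "l2 x"
    unfolding l2_def summable_on_def by blast
qed

lemma l2_inner_coords:
  fixes x y :: "nat \<times> 'i::finite \<Rightarrow> complex"
  assumes "l2 x" "l2 y"
  shows "l2_inner x y = (\<Sum>i\<in>UNIV. l2_inner (coord x i) (coord y i))"
proof -
  have "((\<lambda>n. x (n, i) * cnj (y (n, i))) has_sum l2_inner (coord x i) (coord y i)) UNIV" for i
  proof -
    have "l2 (coord x i)" "l2 (coord y i)"
      using assms l2_coord_iff by blast+
    from has_sum_infsum[OF l2_inner_summable[OF this]] show ?thesis
      unfolding l2_inner_def by simp
  qed
  from has_sum_coords[OF this] show ?thesis
    unfolding l2_inner_def by (rule infsumI)
qed

lemma l2_inner_slices: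
  fixes x y :: "nat \<times> 'i::finite \<Rightarrow> complex"
  assumes "l2 x" "l2 y"
  shows "(\<lambda>n. l2_inner (slice x n) (slice y n)) sums l2_inner x y"
proof -
  have "(\<lambda>n. coord x i n * cnj (coord y i n)) sums l2_inner (coord x i) (coord y i)" for i
  proof -
    have "l2 (coord x i)" "l2 (coord y i)"
      using assms l2_coord_iff by blast+
    from has_sum_imp_sums[OF has_sum_infsum[OF l2_inner_summable[OF this]]] show ?thesis
      unfolding l2_inner_def .
  qed
  then have "(\<lambda>n. \<Sum>i\<in>UNIV. coord x i n * cnj (coord y i n)) sums (\<Sum>i\<in>UNIV. l2_inner (coord x i) (coord y i))"
    by (rule sums_sum)
  then show ?thesis
    by (simp add: l2_inner_coords[OF assms] l2_inner_finite)
qed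

lemma l2_norm_sq_coords:
  fixes x :: "nat \<times> 'i::finite \<Rightarrow> complex"
  assumes "l2 x"
  shows "(l2_norm x)\<^sup>2 = (\<Sum>i\<in>UNIV. (l2_norm (coord x i))\<^sup>2)"
  using assms assms[unfolded l2_coord_iff] by (simp add: l2_norm_sq_eq_Re l2_inner_coords)

lemma l2_norm_sq_slices:
  fixes x :: "nat \<times> 'i::finite \<Rightarrow> complex"
  assumes "l2 x"
  shows "(\<lambda>n. (l2_norm (slice x n))\<^sup>2) sums (l2_norm x)\<^sup>2"
  using sums_Re[OF l2_inner_slices[OF assms assms]] assms by (simp add: l2_norm_sq_eq_Re)

lemma l2_norm_coord_le:
  fixes x :: "nat \<times> 'i::finite \<Rightarrow> complex"
  assumes "l2 x"
  shows "l2_norm (coord x i) \<le> l2_norm x"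
proof (rule power2_le_imp_le)
  show "(l2_norm (coord x i))\<^sup>2 \<le> (l2_norm x)\<^sup>2"
    unfolding l2_norm_sq_coords[OF assms] by (rule member_le_sum) auto
qed simp

lemma l2_norm_slice_le:
  fixes x :: "nat \<times> 'i::finite \<Rightarrow> complex"
  assumes "l2 x"
  shows "l2_norm (slice x n) \<le> l2_norm x"
proof (rule power2_le_imp_le)
  have "(\<Sum>k\<in>{n}. (l2_norm (slice x k))\<^sup>2) \<le> (\<Sum>k. (l2_norm (slice x k))\<^sup>2)"
    using l2_norm_sq_slices[OF assms] by (intro sum_le_suminf) (auto simp: sums_iff)
  then show "(l2_norm (slice x n))\<^sup>2 \<le> (l2_norm x)\<^sup>2"
    using l2_norm_sq_slices[OF assms] by (simp add: sums_iff)
qed simp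

lemma l2_slicesI:
  fixes x :: "nat \<times> 'i::finite \<Rightarrow> complex"
  assumes "summable (\<lambda>n. (l2_norm (slice x n))\<^sup>2)"
  shows "l2 x"
  unfolding l2_coord_iff l2_nat_iff
proof
  fix i
  show "summable (\<lambda>n. (cmod (coord x i n))\<^sup>2)"
  proof (rule summable_comparison_test'[OF assms])
    fix n
    have "cmod (slice x n i) \<le> l2_norm (slice x n)"
      by (rule cmod_le_l2_norm) simp
    then show "norm ((cmod (coord x i n))\<^sup>2) \<le> (l2_norm (slice x n))\<^sup>2"
      by (simp add: power_mono)
  qed
qed

section \<open>Tensor products of subspaces\<close>

lemma op_linear_proj:
  assumes "csubspace D"
  shows "op_linear UNIV (proj (D :: ('i::finite \<Rightarrow> complex) set))"
  unfolding op_linear_def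
  by (simp add: proj_add[OF determined_by_UNIV[OF assms]] proj_scl[OF determined_by_UNIV[OF assms]])

lemma l2_closureI: "x \<in> S \<Longrightarrow> l2 x \<Longrightarrow> x \<in> l2_closure S"
  unfolding l2_closure_def by (auto intro!: bexI[of _ x])

text \<open>The right-hand side is a closed subspace containing the elementary tensors. Conversely,
  each slice is fixed by the projection onto \<open>D\<close>, so \<open>x\<close> is the finite sum
  over \<open>i\<close> of \<open>coord x i\<close> tensored with the projected unit vector; no
  limit is involved.\<close>

lemma tensor_sub_eq:
  fixes D :: "('i::finite \<Rightarrow> complex) set"
  assumes M: "csubspace M" "l2_closure M \<subseteq> M" and D: "csubspace D"
  shows "tensor_sub M D = {x. l2 x \<and> (\<forall>i. coord x i \<in> M) \<and> (\<forall>n. slice x n \<in> D)}"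
    and "csubspace (tensor_sub M D)"
proof -
  define W where "W = {x. l2 x \<and> (\<forall>i. coord x i \<in> M) \<and> (\<forall>n. slice x n \<in> D)}"
  define S where "S = {(\<lambda>(n :: nat, i :: 'i). f n * v i) | f v. f \<in> M \<and> v \<in> D}"
  have W: "csubspace W"
    unfolding csubspace_def W_def
    using csubspaceD(1-3)[OF M(1)] csubspaceD(1-3)[OF D]
    by (simp add: slice_add coord_add slice_scl coord_scl slice_zero coord_zero) auto
  have "S \<subseteq> W"
  proof
    fix x assume "x \<in> S"
    then obtain f v where x: "x = (\<lambda>(n, i). f n * v i)" and fv: "f \<in> M" "v \<in> D"
      by (auto simp: S_def)
    have c: "coord x i = scl (v i) f" for i
      by (auto simp: x)
    have r: "slice x n = scl (f n) v" for n
      by (auto simp: x)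
    have "coord x i \<in> M" "l2 (coord x i)" for i
      unfolding c using csubspaceD(3,4)[OF M(1)] fv by blast+
    moreover have "slice x n \<in> D" for n
      unfolding r using csubspaceD(3)[OF D] fv by blast
    ultimately show "x \<in> W"
      by (simp add: W_def l2_coord_iff)
  qed
  then have span: "cspan S \<subseteq> W"
    unfolding cspan_def using W by blast
  have "tensor_sub M D \<subseteq> W"
  proof
    fix x assume "x \<in> tensor_sub M D"
    then have lx: "l2 x" and cl: "\<And>e. e > 0 \<Longrightarrow> \<exists>y\<in>W. l2_norm (x - y) < e"
      using span unfolding tensor_sub_def S_def[symmetric] l2_closure_def by blast+
    have "coord x i \<in> l2_closure M" for i
      unfolding l2_closure_def
    proof (intro CollectI conjI allI impI)
      show "l2 (coord x i)"
        using lx l2_coord_iff by blast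
      fix e :: real assume "e > 0"
      then obtain y where y: "y \<in> W" "l2_norm (x - y) < e"
        using cl by blast
      then have "l2_norm (coord x i - coord y i) < e"
        using l2_norm_coord_le[of "x - y" i] lx by (simp add: W_def coord_diff)
      then show "\<exists>y\<in>M. l2_norm (coord x i - y) < e"
        using y unfolding W_def by blast
    qed
    moreover have "slice x n \<in> l2_closure D" for n
      unfolding l2_closure_def
    proof (intro CollectI conjI allI impI)
      fix e :: real assume "e > 0"
      then obtain y where y: "y \<in> W" "l2_norm (x - y) < e"
        using cl by blast
      then have "l2_norm (slice x n - slice y n) < e"
        using l2_norm_slice_le[of "x - y" n] lx by (simp add: W_def slice_diff)
      then show "\<exists>y\<in>D. l2_norm (slice x n - y) < e"
        using y unfolding W_def by blast
    qed simp
    moreover have "l2_closure D \<subseteq> D"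
      by (rule determined_by_closed[OF determined_by_UNIV[OF D]])
    ultimately show "x \<in> W"
      using lx M(2) unfolding W_def by blast
  qed
  moreover have "W \<subseteq> tensor_sub M D"
  proof
    fix x assume x: "x \<in> W"
    then have lx: "l2 x"
      by (simp add: W_def)
    define E where "E i = (\<lambda>(n, j). coord x i n * proj D (unit_vec i) j)" for i
    have expand: "slice x n = (\<Sum>i\<in>UNIV. scl (x (n, i)) (proj D (unit_vec i)))" for n
    proof -
      have "slice x n = proj D (slice x n)"
        using x proj_id[OF D] by (simp add: W_def)
      also have "\<dots> = proj D (\<Sum>i\<in>UNIV. scl (slice x n i) (unit_vec i))"
        by (simp only: unit_vec_expansion)
      also have "\<dots> = (\<Sum>i\<in>UNIV. proj D (scl (slice x n i) (unit_vec i)))"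
        by (rule op_linear_sum[OF op_linear_proj[OF D] csubspace_UNIV]) simp
      finally show ?thesis
        by (simp add: op_linearD(2)[OF op_linear_proj[OF D]])
    qed
    have xE: "x = (\<Sum>i\<in>UNIV. E i)"
    proof
      fix p :: "nat \<times> 'i"
      obtain n j where p: "p = (n, j)"
        by fastforce
      have "x p = (\<Sum>i\<in>UNIV. scl (x (n, i)) (proj D (unit_vec i))) j"
        unfolding p expand[symmetric] by simp
      also have "\<dots> = (\<Sum>i\<in>UNIV. E i) p"
        by (simp add: p E_def sum_fun_apply)
      finally show "x p = (\<Sum>i\<in>UNIV. E i) p" .
    qed
    have "E i \<in> S" for i
      unfolding E_def S_def using x proj_in[OF determined_by_UNIV[OF D], of "unit_vec i"]
      by (intro CollectI exI[of _ "coord x i"] exI[of _ "proj D (unit_vec i)"]) (simp add: W_def)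
    then have "x \<in> N" if "csubspace N" "S \<subseteq> N" for N
      unfolding xE by (intro csubspace_sum[OF that(1)]) (use that in auto)
    then have "x \<in> cspan S"
      by (auto simp: cspan_def)
    then show "x \<in> tensor_sub M D"
      unfolding tensor_sub_def S_def[symmetric] by (rule l2_closureI[OF _ lx])
  qed
  ultimately show "tensor_sub M D = {x. l2 x \<and> (\<forall>i. coord x i \<in> M) \<and> (\<forall>n. slice x n \<in> D)}"
    by (simp add: W_def)
  then show "csubspace (tensor_sub M D)"
    using W by (simp add: W_def)
qed

lemma H2D_iff:
  assumes T: "contraction T"
  shows "x \<in> H2D T \<longleftrightarrow> l2 x \<and> (\<forall>n. slice x n \<in> defect_space T)"
proof -
  have H: "csubspace H2" "l2_closure H2 \<subseteq> H2"
    by (auto simp: csubspace_def H2_def l2_closure_def)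
  show ?thesis
    unfolding H2D_def tensor_sub_eq(1)[OF H csubspace_defect_space[OF T]]
    by (auto simp: H2_def l2_coord_iff)
qed

lemma
  assumes T: "contraction T" and cnu: "cnu T"
  shows NTD_iff: "x \<in> NTD T \<longleftrightarrow> l2 x \<and> (\<forall>i. coord x i \<in> model_space T) \<and> (\<forall>n. slice x n \<in> defect_space T)"
    and determined_by_NTD: "determined_by ({..<degree (min_poly T)} \<times> UNIV) (NTD T)"
proof -
  note det = determined_by_model_space[OF T cnu]
  have M: "csubspace (model_space T)" "l2_closure (model_space T) \<subseteq> model_space T"
    using det determined_by_closed[OF det] by (auto simp: determined_by_def)
  show iff: "x \<in> NTD T \<longleftrightarrow> l2 x \<and> (\<forall>i. coord x i \<in> model_space T) \<and> (\<forall>n. slice x n \<in> defect_space T)" for x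
    unfolding NTD_def tensor_sub_eq(1)[OF M csubspace_defect_space[OF T]] by simp
  have c: "csubspace (NTD T)"
    unfolding NTD_def by (rule tensor_sub_eq(2)[OF M csubspace_defect_space[OF T]])
  have "x = 0" if x: "x \<in> NTD T" and z: "\<forall>j\<in>{..<degree (min_poly T)} \<times> UNIV. x j = 0" for x
  proof -
    have "coord x i = 0" for i
    proof -
      have "coord x i \<in> model_space T" "\<forall>j\<in>{..<degree (min_poly T)}. coord x i j = 0"
        using x z by (auto simp: iff)
      then show ?thesis
        using det by (auto simp: determined_by_def)
    qed
    then have "x (n, i) = 0" for n i
      by (metis coord_apply zero_fun_apply)
    then show ?thesis
      by auto
  qed
  with c show "determined_by ({..<degree (min_poly T)} \<times> UNIV) (NTD T)"
    by (auto simp: determined_by_def)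
qed

section \<open>The transfer function as an input-output map\<close>

lemma dsum_add: "dsum x y + dsum x' y' = dsum (x + x') (y + y')"
  and dsum_scl: "scl c (dsum x y) = dsum (scl c x) (scl c y)"
  by (auto simp: dsum_def fun_eq_iff split: sum.splits)

lemma dsum_Inl [simp]: "dsum x y \<circ> Inl = x"
  and dsum_Inr [simp]: "dsum x y \<circ> Inr = y"
  by (auto simp: dsum_def fun_eq_iff)

lemma dsum_components: "dsum (z \<circ> Inl) (z \<circ> Inr) = z"
  by (auto simp: dsum_def fun_eq_iff split: sum.splits)

lemma comp_add:
  fixes x y :: "'a \<Rightarrow> complex"
  shows "(x + y) \<circ> f = (x \<circ> f) + (y \<circ> f)"
  by (auto simp: fun_eq_iff)

lemma comp_zero: "(0 :: 'a \<Rightarrow> complex) \<circ> f = 0"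
  by (auto simp: fun_eq_iff)

lemma comp_scl: "scl c x \<circ> f = scl c (x \<circ> f)"
  by (auto simp: fun_eq_iff)

lemma l2_inner_dsum:
  "l2_inner (dsum x y) (dsum x' y') = l2_inner x x' + l2_inner y (y' :: 'i::finite \<Rightarrow> complex)"
  unfolding l2_inner_finite UNIV_Plus_UNIV[symmetric]
  by (subst sum.Plus) (auto simp: dsum_def o_def)

lemma l2_norm_sq_dsum:
  "(l2_norm (dsum x (y :: 'i::finite \<Rightarrow> complex)))\<^sup>2 = (l2_norm x)\<^sup>2 + (l2_norm y)\<^sup>2"
  by (simp add: l2_norm_sq_eq_Re l2_inner_dsum)

lemma isometry_inner:
  assumes M: "csubspace M" and U: "op_linear M U" "\<And>x. x \<in> M \<Longrightarrow> l2_norm (U x) = l2_norm x"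
    "\<And>x. x \<in> M \<Longrightarrow> l2 (U x)" and xy: "x \<in> M" "y \<in> M"
  shows "l2_inner (U x) (U y) = l2_inner x y"
proof -
  have re: "Re (l2_inner (U x) (U y)) = Re (l2_inner x y)" if xy: "x \<in> M" "y \<in> M" for x y
  proof -
    have "(l2_norm (U x + U y))\<^sup>2 = (l2_norm (x + y))\<^sup>2"
      using op_linearD(1)[OF U(1)] U(2) csubspaceD(2)[OF M] xy by metis
    then show ?thesis
      using U(2)[OF xy(1)] U(2)[OF xy(2)] U(3)[OF xy(1)] U(3)[OF xy(2)]
        csubspaceD(4)[OF M xy(1)] csubspaceD(4)[OF M xy(2)]
      by (simp add: l2_norm_sq_add)
  qed
  have "Re (l2_inner (U (scl \<i> x)) (U y)) = Re (l2_inner (scl \<i> x) y)"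
    by (rule re) (use csubspaceD(3)[OF M] xy in auto)
  then have "Im (l2_inner (U x) (U y)) = Im (l2_inner x y)"
    by (simp add: op_linearD(2)[OF U(1) xy(1)] l2_inner_scl_left)
  with re[OF xy] show ?thesis
    by (rule complex_eqI)
qed

text \<open>Unitarity of \<open>U\<close> governs the Toeplitz isometry. Commutation and the
  extension property join in \<open>commuting_dilation\<close>, where the embedding is compared with
  \<open>T1\<close> and \<open>T2\<close>.\<close>

locale unitary_colligation =
  fixes T1 T2 :: "('i::finite \<Rightarrow> complex) \<Rightarrow> ('i \<Rightarrow> complex)"
    and U :: "('i + 'i \<Rightarrow> complex) \<Rightarrow> ('i + 'i \<Rightarrow> complex)"
  assumes T1: "contraction T1" and T2: "contraction T2"
    and U_unitary: "unitary_on (dspace T1 T2) U"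
begin

abbreviation "D1 \<equiv> defect_space T1"
abbreviation "D2 \<equiv> defect_space T2"
abbreviation "Ast \<equiv> adj_on D1 (blkA U)"
abbreviation "Bst \<equiv> adj_on D2 (blkB U)"
abbreviation "Cst \<equiv> adj_on D1 (blkC U)"
abbreviation "Dst \<equiv> adj_on D2 (blkD U)"

lemmas D1 = csubspace_defect_space[OF T1]
lemmas D2 = csubspace_defect_space[OF T2]

lemma dsum_in_dspace: "x \<in> D1 \<Longrightarrow> y \<in> D2 \<Longrightarrow> dsum x y \<in> dspace T1 T2"
  by (simp add: dspace_def)

lemma csubspace_dspace: "csubspace (dspace T1 T2)"
  unfolding csubspace_def dspace_def
  using csubspaceD(1-3)[OF D1] csubspaceD(1-3)[OF D2]
  by (simp add: comp_add comp_scl comp_zero) auto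

lemma U_linear: "op_linear (dspace T1 T2) U"
  and U_norm: "z \<in> dspace T1 T2 \<Longrightarrow> l2_norm (U z) = l2_norm z"
  and U_in: "z \<in> dspace T1 T2 \<Longrightarrow> U z \<in> dspace T1 T2"
  using U_unitary unfolding unitary_on_def by blast+

lemma U_surj: "w \<in> dspace T1 T2 \<Longrightarrow> \<exists>z\<in>dspace T1 T2. U z = w"
  using U_unitary unfolding unitary_on_def by (metis imageE)

lemma U_inner:
  "z \<in> dspace T1 T2 \<Longrightarrow> w \<in> dspace T1 T2 \<Longrightarrow> l2_inner (U z) (U w) = l2_inner z w"
  by (rule isometry_inner[OF csubspace_dspace U_linear U_norm]) auto

lemma blocks_linear:
  "op_linear D1 (blkA U)" "op_linear D2 (blkB U)" "op_linear D1 (blkC U)" "op_linear D2 (blkD U)"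
proof -
  have l: "U (dsum (x + x') 0) = U (dsum x 0) + U (dsum x' 0)" "U (dsum (scl c x) 0) = scl c (U (dsum x 0))"
    if "x \<in> D1" "x' \<in> D1" for x x' c
    using op_linearD[OF U_linear] dsum_in_dspace[OF _ csubspaceD(1)[OF D2]] that
    by (metis dsum_add add_0 , metis dsum_scl scl_zero_right)
  have r: "U (dsum 0 (y + y')) = U (dsum 0 y) + U (dsum 0 y')" "U (dsum 0 (scl c y)) = scl c (U (dsum 0 y))"
    if "y \<in> D2" "y' \<in> D2" for y y' c
    using op_linearD[OF U_linear] dsum_in_dspace[OF csubspaceD(1)[OF D1]] that
    by (metis dsum_add add_0 , metis dsum_scl scl_zero_right)
  show "op_linear D1 (blkA U)" "op_linear D2 (blkB U)" "op_linear D1 (blkC U)" "op_linear D2 (blkD U)"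
    unfolding op_linear_def blkA_def blkB_def blkC_def blkD_def
    using l r by (simp_all add: comp_add comp_scl)
qed

lemma adj_in:
  "Ast x \<in> D1" "Bst x \<in> D2" "Cst x \<in> D1" "Dst x \<in> D2"
  using adj_on_in[OF D1 blocks_linear(1)] adj_on_in[OF D2 blocks_linear(2)]
    adj_on_in[OF D1 blocks_linear(3)] adj_on_in[OF D2 blocks_linear(4)] by blast+

lemma adj_linear:
  "op_linear UNIV Ast" "op_linear UNIV Bst" "op_linear UNIV Cst" "op_linear UNIV Dst"
  using adj_on_linear[OF D1 blocks_linear(1)] adj_on_linear[OF D2 blocks_linear(2)]
    adj_on_linear[OF D1 blocks_linear(3)] adj_on_linear[OF D2 blocks_linear(4)] by blast+

text \<open>The separate block adjoints assemble to the inverse of \<open>U\<close>. For the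
  preimage \<open>w\<close> of \<open>dsum x s\<close> and any \<open>v\<close>,
  \<open><v, z> = <U v, U w> = <v, w>\<close>, which forces \<open>z = w\<close>.\<close>

lemma U_adjoint:
  assumes x: "x \<in> D1" and s: "s \<in> D2"
  shows "U (dsum (Ast x + Cst s) (Bst x + Dst s)) = dsum x s"
proof -
  define z where "z = dsum (Ast x + Cst s) (Bst x + Dst s)"
  have z: "z \<in> dspace T1 T2"
    unfolding z_def using csubspaceD(2)[OF D1] csubspaceD(2)[OF D2] adj_in
    by (intro dsum_in_dspace) blast+
  obtain w where w: "w \<in> dspace T1 T2" "U w = dsum x s"
    using U_surj[OF dsum_in_dspace[OF x s]] by blast
  have "l2_inner v z = l2_inner v w" if v: "v \<in> dspace T1 T2" for v
  proof -
    define v1 v2 where "v1 = v \<circ> Inl" and "v2 = v \<circ> Inr"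
    have v12: "v1 \<in> D1" "v2 \<in> D2"
      using v by (auto simp: dspace_def v1_def v2_def)
    have vv: "v = dsum v1 0 + dsum 0 v2"
      unfolding dsum_add by (simp add: v1_def v2_def dsum_components)
    have "U v = U (dsum v1 0) + U (dsum 0 v2)"
      unfolding vv using v12 csubspaceD(1)[OF D1] csubspaceD(1)[OF D2]
      by (intro op_linearD(1)[OF U_linear] dsum_in_dspace)
    also have "\<dots> = dsum (blkA U v1 + blkB U v2) (blkC U v1 + blkD U v2)"
      unfolding blkA_def blkB_def blkC_def blkD_def dsum_add[symmetric] by (simp add: dsum_components)
    finally have "l2_inner (U v) (dsum x s) =
        l2_inner (blkA U v1 + blkB U v2) x + l2_inner (blkC U v1 + blkD U v2) s"
      by (simp add: l2_inner_dsum)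
    also have "\<dots> = l2_inner v1 (Ast x + Cst s) + l2_inner v2 (Bst x + Dst s)"
      using adj_on_inner[OF D1 blocks_linear(1) v12(1)] adj_on_inner[OF D2 blocks_linear(2) v12(2)]
        adj_on_inner[OF D1 blocks_linear(3) v12(1)] adj_on_inner[OF D2 blocks_linear(4) v12(2)]
      by (simp add: l2_inner_add_left l2_inner_add_right)
    also have "\<dots> = l2_inner v z"
      unfolding z_def v1_def v2_def by (subst (3) dsum_components[symmetric]) (simp only: l2_inner_dsum)
    finally show ?thesis
      using U_inner[OF v w(1)] w(2) by simp
  qed
  then have "l2_inner (z - w) (z - w) = 0"
    using csubspaceD(5)[OF csubspace_dspace z w(1)] by (subst l2_inner_diff_right) simp_all
  then have "z = w"
    using l2_inner_self_eq_0[of "z - w"] by simp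
  then show ?thesis
    using w by (simp add: z_def)
qed

text \<open>The transfer function is realised as the input-output map of the linear system with
  colligation matrix \<open>U\<^sup>*\<close>, started in the zero state.\<close>

primrec state :: "(nat \<Rightarrow> 'i \<Rightarrow> complex) \<Rightarrow> nat \<Rightarrow> 'i \<Rightarrow> complex" where
  "state f 0 = 0"
| "state f (Suc n) = Bst (f n) + Dst (state f n)"

definition out :: "(nat \<Rightarrow> 'i \<Rightarrow> complex) \<Rightarrow> nat \<Rightarrow> 'i \<Rightarrow> complex" where
  "out f n = Ast (f n) + Cst (state f n)"

lemma state_in: "state f n \<in> D2"
  by (cases n) (simp_all add: csubspaceD(1)[OF D2] csubspaceD(2)[OF D2] adj_in)

lemma out_in: "out f n \<in> D1"
  unfolding out_def using csubspaceD(2)[OF D1] adj_in by blast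

text \<open>Unrolled, the recursion is a convolution with the impulse responses
  \<open>D^*^k B^*\<close>; one application of \<open>C^*\<close> turns these into the Taylor
  coefficients of the transfer function.\<close>

lemma state_closed_form: "state f n = (\<Sum>k<n. (Dst ^^ k) (Bst (f (n - Suc k))))"
proof (induction n)
  case (Suc n)
  have "(\<Sum>k<Suc n. (Dst ^^ k) (Bst (f (Suc n - Suc k)))) =
      Bst (f n) + (\<Sum>k<n. Dst ((Dst ^^ k) (Bst (f (n - Suc k)))))"
    by (subst sum.lessThan_Suc_shift) simp
  also have "\<dots> = Bst (f n) + Dst (state f n)"
    unfolding Suc by (subst op_linear_sum[OF adj_linear(4) csubspace_UNIV]) simp_all
  finally have "state f (Suc n) = (\<Sum>k<Suc n. (Dst ^^ k) (Bst (f (Suc n - Suc k))))"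
    by simp
  then show ?case .
next
  case 0
  have "state f 0 = (\<Sum>k<0. (Dst ^^ k) (Bst (f (0 - Suc k))))"
    by simp
  then show ?case .
qed

lemma slice_transfer_mult: "slice (transfer_mult T1 T2 U x) n = out (slice x) n"
proof -
  have "slice (transfer_mult T1 T2 U x) n = (\<Sum>k\<le>n. transfer_coeff T1 T2 U k (slice x (n - k)))"
    by (auto simp: transfer_mult_def slice_def)
  \<comment> \<open>Coefficient \<open>Suc k\<close> carries the power \<open>k\<close> of
    \<open>D^*\<close> and acts on the input at time \<open>n - Suc k\<close>, in step with the
    closed form of the state.\<close>
  also have "\<dots> = transfer_coeff T1 T2 U 0 (slice x n) +
      (\<Sum>k<n. transfer_coeff T1 T2 U (Suc k) (slice x (n - Suc k)))"
    by (simp add: lessThan_Suc_atMost[symmetric] sum.lessThan_Suc_shift del: sum.lessThan_Suc)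
  also have "\<dots> = Ast (slice x n) + (\<Sum>k<n. Cst ((Dst ^^ k) (Bst (slice x (n - Suc k)))))"
    by (simp add: transfer_coeff_def)
  also have "(\<Sum>k<n. Cst ((Dst ^^ k) (Bst (slice x (n - Suc k))))) = Cst (state (slice x) n)"
    unfolding state_closed_form by (rule op_linear_sum[OF adj_linear(3) csubspace_UNIV, symmetric]) simp
  finally show ?thesis
    unfolding out_def .
qed

section \<open>Energy balance and decay of the states\<close>

lemma energy_step:
  assumes "f n \<in> D1"
  shows "(l2_norm (out f n))\<^sup>2 + (l2_norm (state f (Suc n)))\<^sup>2 = (l2_norm (f n))\<^sup>2 + (l2_norm (state f n))\<^sup>2"
proof -
  have "dsum (out f n) (state f (Suc n)) \<in> dspace T1 T2"
    by (rule dsum_in_dspace[OF out_in state_in])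
  moreover have "U (dsum (out f n) (state f (Suc n))) = dsum (f n) (state f n)"
    unfolding out_def state.simps by (rule U_adjoint[OF assms state_in])
  ultimately show ?thesis
    using U_norm by (metis l2_norm_sq_dsum)
qed

lemma energy:
  assumes "\<And>n. f n \<in> D1"
  shows "(\<Sum>n<N. (l2_norm (out f n))\<^sup>2) + (l2_norm (state f N))\<^sup>2 = (\<Sum>n<N. (l2_norm (f n))\<^sup>2)"
proof (induction N)
  case (Suc N)
  then show ?case
    using energy_step[of f N] assms by (simp del: state.simps)
next
  case 0
  have "(\<Sum>n<0. (l2_norm (out f n))\<^sup>2) + (l2_norm (state f 0))\<^sup>2 = (\<Sum>n<0. (l2_norm (f n))\<^sup>2)"
    by simp
  then show ?case .
qed

lemma state_norm_le:
  assumes "\<And>n. f n \<in> D1"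
  shows "(l2_norm (state f N))\<^sup>2 \<le> (\<Sum>n<N. (l2_norm (f n))\<^sup>2)"
  using energy[of f N, OF assms] sum_nonneg[of "{..<N}" "\<lambda>n. (l2_norm (out f n))\<^sup>2"] by simp

text \<open>The powers of \<open>D^*\<close> alone need not decay: if \<open>U\<close> is the
  identity, so is \<open>D\<close>. On the range of \<open>B^*\<close> they do, because coordinate
  \<open>i\<close> is the pairing of \<open>x\<close> with \<open>B D^n v\<close> for the projected
  unit vector \<open>v\<close>, and these vectors have summable squared norms.\<close>

lemma Dst_powers_tendsto_0:
  "(\<lambda>n. l2_norm ((Dst ^^ n) (Bst x))) \<longlonglongrightarrow> 0"
proof (rule l2_norm_tendsto_0)
  fix i
  define v where "v = proj D2 (unit_vec i)"
  have v: "v \<in> D2"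
    unfolding v_def by (rule proj_in[OF determined_by_UNIV[OF D2]]) simp
  have Din: "blkD U w \<in> D2" if "w \<in> D2" for w
    using U_in[OF dsum_in_dspace[OF csubspaceD(1)[OF D1] that]] by (simp add: blkD_def dspace_def)
  have DnV: "(blkD U ^^ n) v \<in> D2" for n
    by (induction n) (use v Din in auto)
  have BD: "(l2_norm (blkB U w))\<^sup>2 + (l2_norm (blkD U w))\<^sup>2 = (l2_norm w)\<^sup>2" if "w \<in> D2" for w
    using U_norm[OF dsum_in_dspace[OF csubspaceD(1)[OF D1] that]]
    unfolding blkB_def blkD_def l2_norm_sq_dsum[symmetric] dsum_components
    by (simp add: l2_norm_sq_dsum)
  \<comment> \<open>The second column of \<open>U\<close> is isometric; applied along the orbit
    \<open>D^n v\<close>, this makes the sum telescope.\<close>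
  have "(\<Sum>n<N. (l2_norm (blkB U ((blkD U ^^ n) v)))\<^sup>2) + (l2_norm ((blkD U ^^ N) v))\<^sup>2 = (l2_norm v)\<^sup>2" for N
  proof (induction N)
    case (Suc N)
    then show ?case
      using BD[OF DnV[of N]] by simp
  qed simp
  then have "(\<Sum>n<N. (l2_norm (blkB U ((blkD U ^^ n) v)))\<^sup>2) \<le> (l2_norm v)\<^sup>2" for N
    by (metis add.commute add_increasing order_refl zero_le_power2)
  then have "summable (\<lambda>n. (l2_norm (blkB U ((blkD U ^^ n) v)))\<^sup>2)"
    by (intro bounded_imp_summable[where B = "(l2_norm v)\<^sup>2"]) (simp, metis lessThan_Suc_atMost)
  then have "(\<lambda>n. sqrt ((l2_norm (blkB U ((blkD U ^^ n) v)))\<^sup>2)) \<longlonglongrightarrow> sqrt 0"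
    by (intro tendsto_real_sqrt summable_LIMSEQ_zero)
  then have lim: "(\<lambda>n. l2_norm x * l2_norm (blkB U ((blkD U ^^ n) v))) \<longlonglongrightarrow> 0"
    by (intro tendsto_mult_right_zero) simp
  have Dadj: "l2_inner (Dst z) w = l2_inner z (blkD U w)" if "w \<in> D2" for z w
    using adj_on_inner[OF D2 blocks_linear(4) that, of z] by (metis l2_inner_commute)
  have Badj: "l2_inner (Bst z) w = l2_inner z (blkB U w)" if "w \<in> D2" for z w
    using adj_on_inner[OF D2 blocks_linear(2) that, of z] by (metis l2_inner_commute)
  have Dn: "l2_inner ((Dst ^^ n) z) w = l2_inner z ((blkD U ^^ n) w)" if "w \<in> D2" for n z w
    using that
  proof (induction n arbitrary: w)
    case (Suc n)
    then show ?case
      by (simp add: Dadj Din funpow_swap1[of "blkD U"])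
  qed simp
  have mem: "(Dst ^^ n) (Bst x) \<in> D2" for n
    by (induction n) (auto simp: adj_in)
  have "((Dst ^^ n) (Bst x)) i = l2_inner x (blkB U ((blkD U ^^ n) v))" for n
  proof -
    have "((Dst ^^ n) (Bst x)) i = cnj (l2_inner (unit_vec i) ((Dst ^^ n) (Bst x)))"
      by (simp add: l2_inner_unit_vec flip: l2_inner_commute)
    also have "l2_inner (unit_vec i) ((Dst ^^ n) (Bst x)) = l2_inner v ((Dst ^^ n) (Bst x))"
      unfolding v_def by (rule proj_inner[OF determined_by_UNIV[OF D2] _ mem, symmetric]) simp
    also have "cnj \<dots> = l2_inner ((Dst ^^ n) (Bst x)) v"
      by (simp flip: l2_inner_commute)
    also have "\<dots> = l2_inner x (blkB U ((blkD U ^^ n) v))"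
      by (simp add: Dn[OF v] Badj[OF DnV])
    finally show ?thesis .
  qed
  then have "cmod (((Dst ^^ n) (Bst x)) i) \<le> l2_norm x * l2_norm (blkB U ((blkD U ^^ n) v))" for n
    by (simp add: l2_cauchy_schwarz)
  then show "(\<lambda>n. ((Dst ^^ n) (Bst x)) i) \<longlonglongrightarrow> 0"
    by (intro Lim_null_comparison[OF _ lim]) auto
qed

lemma Dst_powers_state_tendsto_0: "(\<lambda>n. l2_norm ((Dst ^^ n) (state f m))) \<longlonglongrightarrow> 0"
proof (induction m)
  case 0
  have "(Dst ^^ n) 0 = 0" for n
    by (rule op_linear_zero[OF op_linear_funpow[OF adj_linear(4)]]) simp
  then have "(\<lambda>n. l2_norm ((Dst ^^ n) (state f 0))) \<longlonglongrightarrow> 0"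
    by simp
  then show ?case .
next
  case (Suc m)
  have le: "l2_norm ((Dst ^^ n) (state f (Suc m))) \<le>
      l2_norm ((Dst ^^ n) (Bst (f m))) + l2_norm ((Dst ^^ Suc n) (state f m))" for n
  proof -
    have "(Dst ^^ n) (state f (Suc m)) = (Dst ^^ n) (Bst (f m)) + (Dst ^^ Suc n) (state f m)"
      by (simp add: op_linearD(1)[OF op_linear_funpow[OF adj_linear(4)]] funpow_swap1)
    then show ?thesis
      by (simp add: l2_norm_triangle del: funpow.simps state.simps)
  qed
  have lim: "(\<lambda>n. l2_norm ((Dst ^^ n) (Bst (f m))) + l2_norm ((Dst ^^ Suc n) (state f m))) \<longlonglongrightarrow> 0 + 0"
    by (intro tendsto_add Dst_powers_tendsto_0 LIMSEQ_Suc[OF Suc])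
  have "(\<lambda>n. l2_norm ((Dst ^^ n) (state f (Suc m)))) \<longlonglongrightarrow> 0"
  proof (rule Lim_null_comparison[OF _ lim[unfolded add_0]])
    show "\<forall>\<^sub>F n in sequentially. norm (l2_norm ((Dst ^^ n) (state f (Suc m)))) \<le>
        l2_norm ((Dst ^^ n) (Bst (f m))) + l2_norm ((Dst ^^ Suc n) (state f m))"
      unfolding real_norm_def abs_of_nonneg[OF l2_norm_nonneg] by (intro always_eventually allI le)
  qed
  then show ?case .
qed

text \<open>Superposition: the free evolution of the state reached at time \<open>m\<close>, plus
  the response from rest to the later input.\<close>

lemma state_split: "state f (m + n) = (Dst ^^ n) (state f m) + state (\<lambda>k. f (m + k)) n"
proof (induction n)
  case (Suc n)
  have IH: "state f (m + n) = (Dst ^^ n) (state f m) + state (\<lambda>k. f (m + k)) n"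
    by (rule Suc)
  have "state f (m + Suc n) = (Dst ^^ Suc n) (state f m) + state (\<lambda>k. f (m + k)) (Suc n)"
    by (simp add: IH op_linearD(1)[OF adj_linear(4)])
  then show ?case .
next
  case 0
  have "state f (m + 0) = (Dst ^^ 0) (state f m) + state (\<lambda>k. f (m + k)) 0"
    by simp
  then show ?case .
qed

text \<open>Cut the input at a time \<open>m\<close> after which its energy is below
  \<open>(r / 2)^2\<close>. The later input then moves the state by less than \<open>r / 2\<close>
  at all times, while the free evolution from time \<open>m\<close> decays.\<close>

lemma state_tendsto_0:
  assumes f: "\<And>n. f n \<in> D1" and s: "summable (\<lambda>n. (l2_norm (f n))\<^sup>2)"
  shows "(\<lambda>n. l2_norm (state f n)) \<longlonglongrightarrow> 0"
proof (rule LIMSEQ_I)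
  fix r :: real assume r: "r > 0"
  then have "(r / 2)\<^sup>2 > 0"
    by simp
  from suminf_exist_split[OF this s] obtain m where
    m: "norm (\<Sum>k. (l2_norm (f (k + m)))\<^sup>2) < (r / 2)\<^sup>2"
    by blast
  have tail: "l2_norm (state (\<lambda>k. f (m + k)) n) < r / 2" for n
  proof -
    have "(l2_norm (state (\<lambda>k. f (m + k)) n))\<^sup>2 \<le> (\<Sum>k<n. (l2_norm (f (m + k)))\<^sup>2)"
      by (rule state_norm_le) (rule f)
    also have "\<dots> \<le> (\<Sum>k. (l2_norm (f (k + m)))\<^sup>2)"
      using s by (subst add.commute) (intro sum_le_suminf, auto simp: summable_iff_shift[of "\<lambda>n. (l2_norm (f n))\<^sup>2"])
    also have "\<dots> < (r / 2)\<^sup>2"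
      using m by simp
    finally show ?thesis
      using r by (intro power2_less_imp_less[of _ "r / 2"]) auto
  qed
  obtain K where K: "\<And>n. n \<ge> K \<Longrightarrow> l2_norm ((Dst ^^ n) (state f m)) < r / 2"
    using LIMSEQ_D[OF Dst_powers_state_tendsto_0[of f m], of "r / 2"] r by auto
  show "\<exists>no. \<forall>n\<ge>no. norm (l2_norm (state f n) - 0) < r"
  proof (intro exI allI impI)
    fix n assume n: "n \<ge> m + K"
    have "l2_norm (state f (m + (n - m))) \<le>
        l2_norm ((Dst ^^ (n - m)) (state f m)) + l2_norm (state (\<lambda>k. f (m + k)) (n - m))"
      unfolding state_split by (rule l2_norm_triangle) auto
    also have "\<dots> < r"
    proof -
      have "l2_norm ((Dst ^^ (n - m)) (state f m)) < r / 2"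
        using n by (intro K) simp
      then show ?thesis
        using tail[of "n - m"] by linarith
    qed
    finally show "norm (l2_norm (state f n) - 0) < r"
      using n by simp
  qed
qed

section \<open>The transfer operator as a Toeplitz isometry\<close>

lemma transfer_mult_isometry:
  assumes x: "x \<in> H2D T1"
  shows "transfer_mult T1 T2 U x \<in> H2D T1" "l2_norm (transfer_mult T1 T2 U x) = l2_norm x"
proof -
  have lx: "l2 x" and rx: "\<And>n. slice x n \<in> D1"
    using x by (auto simp: H2D_iff[OF T1])
  note sx = l2_norm_sq_slices[OF lx]
  define y where "y = transfer_mult T1 T2 U x"
  have ry: "slice y n = out (slice x) n" for n
    unfolding y_def by (rule slice_transfer_mult)
  \<comment> \<open>By the energy balance these are the partial sums of the output energy, so a
    single limit gives both the square-summability of the output and its norm.\<close>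
  have "(\<lambda>N. (\<Sum>n<N. (l2_norm (slice x n))\<^sup>2) - (l2_norm (state (slice x) N))\<^sup>2) \<longlonglongrightarrow> (l2_norm x)\<^sup>2 - 0\<^sup>2"
    using sx state_tendsto_0[of "slice x"] rx
    by (intro tendsto_diff tendsto_power) (auto simp: sums_def summable_def)
  moreover have "(\<Sum>n<N. (l2_norm (slice x n))\<^sup>2) - (l2_norm (state (slice x) N))\<^sup>2 =
      (\<Sum>n<N. (l2_norm (slice y n))\<^sup>2)" for N
    using energy[of "slice x" N] rx by (simp add: ry)
  ultimately have sy: "(\<lambda>n. (l2_norm (slice y n))\<^sup>2) sums (l2_norm x)\<^sup>2"
    by (simp add: sums_def)
  then have ly: "l2 y"
    by (intro l2_slicesI) (auto simp: sums_iff)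
  then show "transfer_mult T1 T2 U x \<in> H2D T1"
    unfolding y_def[symmetric] by (simp add: H2D_iff[OF T1] ry out_in)
  have "(l2_norm y)\<^sup>2 = (l2_norm x)\<^sup>2"
    using sums_unique2[OF sy l2_norm_sq_slices[OF ly]] by simp
  then show "l2_norm (transfer_mult T1 T2 U x) = l2_norm x"
    by (simp add: y_def)
qed

lemma slice_ext:
  assumes "\<And>n. slice x n = slice y n"
  shows "x = y"
proof
  fix p
  show "x p = y p"
    using fun_cong[OF assms[of "fst p"], of "snd p"] by simp
qed

lemma state_add: "state (\<lambda>n. f n + g n) n = state f n + state g n"
proof (induction n)
  case (Suc n)
  have IH: "state (\<lambda>n. f n + g n) n = state f n + state g n"
    by (rule Suc)
  have "state (\<lambda>n. f n + g n) (Suc n) = state f (Suc n) + state g (Suc n)"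
    by (simp add: IH op_linearD(1)[OF adj_linear(2)] op_linearD(1)[OF adj_linear(4)])
  then show ?case .
next
  case 0
  have "state (\<lambda>n. f n + g n) 0 = state f 0 + state g 0"
    by simp
  then show ?case .
qed

lemma state_scl: "state (\<lambda>n. scl c (f n)) n = scl c (state f n)"
proof (induction n)
  case (Suc n)
  have IH: "state (\<lambda>n. scl c (f n)) n = scl c (state f n)"
    by (rule Suc)
  have "state (\<lambda>n. scl c (f n)) (Suc n) = scl c (state f (Suc n))"
    by (simp add: IH op_linearD(2)[OF adj_linear(2)] op_linearD(2)[OF adj_linear(4)] scl_add)
  then show ?case .
next
  case 0
  have "state (\<lambda>n. scl c (f n)) 0 = scl c (state f 0)"
    by simp
  then show ?case .
qed

lemma transfer_mult_linear: "op_linear (H2D T1) (transfer_mult T1 T2 U)"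
proof -
  have "transfer_mult T1 T2 U (x + y) = transfer_mult T1 T2 U x + transfer_mult T1 T2 U y" for x y
  proof (rule slice_ext)
    fix n
    have "slice (x + y) = (\<lambda>n. slice x n + slice y n)"
      by (auto simp: slice_add)
    then show "slice (transfer_mult T1 T2 U (x + y)) n = slice (transfer_mult T1 T2 U x + transfer_mult T1 T2 U y) n"
      unfolding slice_add slice_transfer_mult out_def
      by (simp add: state_add op_linearD(1)[OF adj_linear(1)] op_linearD(1)[OF adj_linear(3)] add_ac)
  qed
  moreover have "transfer_mult T1 T2 U (scl c x) = scl c (transfer_mult T1 T2 U x)" for c x
  proof (rule slice_ext)
    fix n
    have "slice (scl c x) = (\<lambda>n. scl c (slice x n))"
      by (auto simp: slice_scl)
    then show "slice (transfer_mult T1 T2 U (scl c x)) n = slice (scl c (transfer_mult T1 T2 U x)) n"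
      unfolding slice_scl slice_transfer_mult out_def
      by (simp add: state_scl op_linearD(2)[OF adj_linear(1)] op_linearD(2)[OF adj_linear(3)] scl_add)
  qed
  ultimately show ?thesis
    by (simp add: op_linear_def)
qed

lemma slice_ampl_shift: "slice (ampl shift x) n = (case n of 0 \<Rightarrow> 0 | Suc k \<Rightarrow> slice x k)"
  by (auto simp: ampl_def shift_def split: nat.splits)

lemma transfer_mult_shift: "transfer_mult T1 T2 U (ampl shift x) = ampl shift (transfer_mult T1 T2 U x)"
proof (rule slice_ext)
  fix n
  \<comment> \<open>A delayed input leaves the zero state at rest for one step, hence the states are
    delayed by one as well.\<close>
  have st: "state (slice (ampl shift x)) (Suc n) = state (slice x) n" for n
  proof (induction n)
    case 0
    have "state (slice (ampl shift x)) (Suc 0) = state (slice x) 0"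
      by (simp add: slice_ampl_shift op_linear_zero[OF adj_linear(2)] op_linear_zero[OF adj_linear(4)])
    then show ?case .
  next
    case (Suc n)
    have IH: "state (slice (ampl shift x)) (Suc n) = state (slice x) n"
      by (rule Suc)
    have "state (slice (ampl shift x)) (Suc (Suc n)) = state (slice x) (Suc n)"
      unfolding state.simps(2)[of "slice (ampl shift x)" "Suc n"] IH by (simp add: slice_ampl_shift)
    then show ?case .
  qed
  show "slice (transfer_mult T1 T2 U (ampl shift x)) n = slice (ampl shift (transfer_mult T1 T2 U x)) n"
  proof (cases n)
    case 0
    then show ?thesis
      unfolding slice_ampl_shift slice_transfer_mult out_def
      by (simp add: slice_ampl_shift op_linear_zero[OF adj_linear(1)] op_linear_zero[OF adj_linear(3)])
  next
    case (Suc k)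
    show ?thesis
      unfolding Suc slice_ampl_shift[of "transfer_mult T1 T2 U x"] slice_transfer_mult out_def st
      by (simp add: slice_ampl_shift slice_transfer_mult out_def)
  qed
qed

lemma transfer_mult_isometric_toeplitz:
  "isometric_analytic_toeplitz (H2D T1) (transfer_mult T1 T2 U)"
  by (simp add: isometric_analytic_toeplitz_def transfer_mult_linear transfer_mult_isometry
      transfer_mult_shift)

end

section \<open>The dilation\<close>

lemma eval2_intertwine:
  fixes X Y :: "('a \<Rightarrow> complex) \<Rightarrow> ('a \<Rightarrow> complex)"
    and P :: "('a \<Rightarrow> complex) \<Rightarrow> ('b \<Rightarrow> complex)"
  assumes M: "csubspace M" and P: "op_linear M P" and x: "x \<in> M"
    and X: "\<And>y. y \<in> M \<Longrightarrow> X y \<in> M" "\<And>y. y \<in> M \<Longrightarrow> P (X y) = X' (P y)"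
    and Y: "\<And>y. y \<in> M \<Longrightarrow> Y y \<in> M" "\<And>y. y \<in> M \<Longrightarrow> P (Y y) = Y' (P y)"
  shows "eval2 p X Y x \<in> M" "P (eval2 p X Y x) = eval2 p X' Y' (P x)"
proof -
  have Ym: "(Y ^^ j) x \<in> M" for j
    by (induction j) (use x Y in auto)
  have XYm: "(X ^^ i) ((Y ^^ j) x) \<in> M" for i j
    by (induction i) (use Ym X in auto)
  have m: "scl c ((X ^^ i) ((Y ^^ j) x)) \<in> M" for c i j
    using csubspaceD(3)[OF M XYm] .
  show "eval2 p X Y x \<in> M"
    unfolding eval2_def by (intro csubspace_sum[OF M] m)
  have "P ((Y ^^ j) x) = (Y' ^^ j) (P x)" for j
    by (induction j) (simp_all add: Y Ym)
  then have "P ((X ^^ i) ((Y ^^ j) x)) = (X' ^^ i) ((Y' ^^ j) (P x))" for i j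
    by (induction i) (simp_all add: X XYm)
  then show "P (eval2 p X Y x) = eval2 p X' Y' (P x)"
    unfolding eval2_def
    by (simp add: op_linear_sum[OF P M] csubspace_sum[OF M] m op_linearD(2)[OF P XYm])
qed

text \<open>A crude coefficient bound whose purpose is to make the supremum in
  \<open>block_norm\<close> one of a bounded set.\<close>

lemma eval2_norm_le:
  fixes X Y :: "('a \<Rightarrow> complex) \<Rightarrow> ('a \<Rightarrow> complex)"
  assumes M: "csubspace M" and x: "x \<in> M"
    and X: "\<And>y. y \<in> M \<Longrightarrow> X y \<in> M" "\<And>y. y \<in> M \<Longrightarrow> l2_norm (X y) \<le> l2_norm y"
    and Y: "\<And>y. y \<in> M \<Longrightarrow> Y y \<in> M" "\<And>y. y \<in> M \<Longrightarrow> l2_norm (Y y) \<le> l2_norm y"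
  shows "l2_norm (eval2 p X Y x) \<le> (\<Sum>j\<le>degree p. \<Sum>i\<le>degree (coeff p j). cmod (coeff (coeff p j) i)) * l2_norm x"
proof -
  have Ym: "(Y ^^ j) x \<in> M" for j
    by (induction j) (use x Y in auto)
  have Yn: "l2_norm ((Y ^^ j) x) \<le> l2_norm x" for j
    by (induction j) (auto intro: order_trans[OF Y(2)[OF Ym]])
  have XYm: "(X ^^ i) ((Y ^^ j) x) \<in> M" for i j
    by (induction i) (use Ym X in auto)
  have XYn: "l2_norm ((X ^^ i) ((Y ^^ j) x)) \<le> l2_norm x" for i j
    by (induction i) (auto intro: Yn order_trans[OF X(2)[OF XYm]])
  have l: "l2 (scl c ((X ^^ i) ((Y ^^ j) x)))" for c i j
    using csubspaceD(4)[OF M XYm] by simp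
  have "l2_norm (eval2 p X Y x) \<le>
      (\<Sum>j\<le>degree p. l2_norm (\<Sum>i\<le>degree (coeff p j). scl (coeff (coeff p j) i) ((X ^^ i) ((Y ^^ j) x))))"
    unfolding eval2_def by (intro l2_norm_sum l2_sum l)
  also have "\<dots> \<le> (\<Sum>j\<le>degree p. \<Sum>i\<le>degree (coeff p j). l2_norm (scl (coeff (coeff p j) i) ((X ^^ i) ((Y ^^ j) x))))"
    by (intro sum_mono l2_norm_sum l)
  also have "\<dots> \<le> (\<Sum>j\<le>degree p. \<Sum>i\<le>degree (coeff p j). cmod (coeff (coeff p j) i) * l2_norm x)"
    unfolding l2_norm_scl by (intro sum_mono mult_left_mono XYn) auto
  finally show ?thesis
    by (simp add: sum_distrib_right)
qed

text \<open>If entrywise \<open>P = R Q J\<close> with \<open>J\<close> isometric and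
  \<open>R\<close> contractive, every admissible family \<open>x\<close> for \<open>P\<close> yields
  the admissible family \<open>J x\<close> for \<open>Q\<close>, with at least as large a value. The
  constants \<open>C\<close> guarantee that the larger set is bounded above, as the conditional
  supremum demands.\<close>

lemma block_norm_le:
  fixes P :: "nat \<Rightarrow> nat \<Rightarrow> ('a \<Rightarrow> complex) \<Rightarrow> ('a \<Rightarrow> complex)"
    and Q :: "nat \<Rightarrow> nat \<Rightarrow> ('b \<Rightarrow> complex) \<Rightarrow> ('b \<Rightarrow> complex)"
  assumes M: "csubspace M" and N: "csubspace N"
    and Q: "\<And>r s x. x \<in> N \<Longrightarrow> Q r s x \<in> N" "\<And>r s x. x \<in> N \<Longrightarrow> l2_norm (Q r s x) \<le> C r s * l2_norm x"
    and J: "\<And>x. x \<in> M \<Longrightarrow> J x \<in> N" "\<And>x. x \<in> M \<Longrightarrow> l2_norm (J x) = l2_norm x"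
    and R: "op_linear N R" "\<And>y. y \<in> N \<Longrightarrow> l2_norm (R y) \<le> l2_norm y"
    and PQ: "\<And>r s x. x \<in> M \<Longrightarrow> P r s x = R (Q r s (J x))"
  shows "block_norm k M P \<le> block_norm k N Q"
  unfolding block_norm_def
proof (rule cSup_mono)
  have "\<exists>x. (\<forall>s<k. x s \<in> M) \<and> (\<Sum>s<k. (l2_norm (x s))\<^sup>2) \<le> 1"
    using csubspaceD(1)[OF M] by (intro exI[of _ "\<lambda>_. 0"]) simp
  then show "{sqrt (\<Sum>r<k. (l2_norm (\<Sum>s<k. P r s (x s)))\<^sup>2) |x.
      (\<forall>s<k. x s \<in> M) \<and> (\<Sum>s<k. (l2_norm (x s))\<^sup>2) \<le> 1} \<noteq> {}"
    by blast
  show "bdd_above {sqrt (\<Sum>r<k. (l2_norm (\<Sum>s<k. Q r s (x s)))\<^sup>2) |x.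
      (\<forall>s<k. x s \<in> N) \<and> (\<Sum>s<k. (l2_norm (x s))\<^sup>2) \<le> 1}"
  proof (rule bdd_aboveI)
    fix b assume "b \<in> {sqrt (\<Sum>r<k. (l2_norm (\<Sum>s<k. Q r s (x s)))\<^sup>2) |x.
      (\<forall>s<k. x s \<in> N) \<and> (\<Sum>s<k. (l2_norm (x s))\<^sup>2) \<le> 1}"
    then obtain x where b: "b = sqrt (\<Sum>r<k. (l2_norm (\<Sum>s<k. Q r s (x s)))\<^sup>2)"
      and x: "\<And>s. s < k \<Longrightarrow> x s \<in> N" and x1: "(\<Sum>s<k. (l2_norm (x s))\<^sup>2) \<le> 1"
      by blast
    have x2: "l2_norm (x s) \<le> 1" if "s < k" for s
    proof -
      have "(l2_norm (x s))\<^sup>2 \<le> (\<Sum>s<k. (l2_norm (x s))\<^sup>2)"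
        using that by (intro member_le_sum) auto
      then have "(l2_norm (x s))\<^sup>2 \<le> 1\<^sup>2"
        using x1 by simp
      then show ?thesis
        by (rule power2_le_imp_le) simp
    qed
    have "l2_norm (\<Sum>s<k. Q r s (x s)) \<le> (\<Sum>s<k. \<bar>C r s\<bar>)" for r
    proof -
      have "l2_norm (\<Sum>s<k. Q r s (x s)) \<le> (\<Sum>s<k. l2_norm (Q r s (x s)))"
        using x Q(1) csubspaceD(4)[OF N] by (intro l2_norm_sum) simp
      also have "\<dots> \<le> (\<Sum>s<k. \<bar>C r s\<bar>)"
      proof (rule sum_mono)
        fix s assume s: "s \<in> {..<k}"
        have "l2_norm (Q r s (x s)) \<le> C r s * l2_norm (x s)"
          using s x by (intro Q(2)) simp
        also have "\<dots> \<le> \<bar>C r s\<bar> * l2_norm (x s)"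
          by (intro mult_right_mono) auto
        also have "\<dots> \<le> \<bar>C r s\<bar>"
          using x2 s by (intro mult_left_le) auto
        finally show "l2_norm (Q r s (x s)) \<le> \<bar>C r s\<bar>" .
      qed
      finally show ?thesis .
    qed
    then show "b \<le> sqrt (\<Sum>r<k. (\<Sum>s<k. \<bar>C r s\<bar>)\<^sup>2)"
      unfolding b by (intro real_sqrt_le_mono sum_mono power_mono) auto
  qed
  fix b assume "b \<in> {sqrt (\<Sum>r<k. (l2_norm (\<Sum>s<k. P r s (x s)))\<^sup>2) |x.
      (\<forall>s<k. x s \<in> M) \<and> (\<Sum>s<k. (l2_norm (x s))\<^sup>2) \<le> 1}"
  then obtain x where b: "b = sqrt (\<Sum>r<k. (l2_norm (\<Sum>s<k. P r s (x s)))\<^sup>2)"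
    and x: "\<And>s. s < k \<Longrightarrow> x s \<in> M" and x1: "(\<Sum>s<k. (l2_norm (x s))\<^sup>2) \<le> 1"
    by blast
  have "l2_norm (\<Sum>s<k. P r s (x s)) \<le> l2_norm (\<Sum>s<k. Q r s (J (x s)))" for r
  proof -
    have m: "Q r s (J (x s)) \<in> N" if "s \<in> {..<k}" for s
      using that x J(1) Q(1) by simp
    have "(\<Sum>s<k. P r s (x s)) = (\<Sum>s<k. R (Q r s (J (x s))))"
      using x PQ by (intro sum.cong) simp_all
    also have "\<dots> = R (\<Sum>s<k. Q r s (J (x s)))"
      by (rule op_linear_sum[OF R(1) N, symmetric]) (rule m)
    finally have "(\<Sum>s<k. P r s (x s)) = R (\<Sum>s<k. Q r s (J (x s)))" .
    moreover have "(\<Sum>s<k. Q r s (J (x s))) \<in> N"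
      by (rule csubspace_sum[OF N]) (rule m)
    ultimately show ?thesis
      using R(2) by presburger
  qed
  then have "b \<le> sqrt (\<Sum>r<k. (l2_norm (\<Sum>s<k. Q r s (J (x s))))\<^sup>2)"
    unfolding b by (intro real_sqrt_le_mono sum_mono power_mono) auto
  moreover have "\<forall>s<k. J (x s) \<in> N"
    using x J(1) by blast
  moreover have "(\<Sum>s<k. (l2_norm (J (x s)))\<^sup>2) \<le> 1"
    using x1 J(2) x by simp
  ultimately show "\<exists>a\<in>{sqrt (\<Sum>r<k. (l2_norm (\<Sum>s<k. Q r s (x s)))\<^sup>2) |x.
      (\<forall>s<k. x s \<in> N) \<and> (\<Sum>s<k. (l2_norm (x s))\<^sup>2) \<le> 1}. b \<le> a"
    by (intro bexI[of _ "sqrt (\<Sum>r<k. (l2_norm (\<Sum>s<k. Q r s (J (x s))))\<^sup>2)"])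
      (auto intro!: exI[of _ "\<lambda>s. J (x s)"])
qed

section \<open>The isometric embedding and its adjoint\<close>

locale commuting_dilation = unitary_colligation T1 T2 U
  for T1 T2 :: "('i::finite \<Rightarrow> complex) \<Rightarrow> ('i \<Rightarrow> complex)"
    and U :: "('i + 'i \<Rightarrow> complex) \<Rightarrow> ('i + 'i \<Rightarrow> complex)" +
  assumes commute: "T1 \<circ> T2 = T2 \<circ> T1"
    and cnu: "cnu T1"
    and U_extends: "U (dsum (defect T1 h) (defect T2 (hadj T1 h))) = dsum (defect T1 (hadj T2 h)) (defect T2 h)"
begin

lemma T1_linear: "op_linear UNIV T1"
  and T2_linear: "op_linear UNIV T2"
  using T1 T2 by (auto simp: contraction_def)

text \<open>The map \<open>\<Pi>\<close> of the overview: the standard embedding of a contraction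
  whose adjoint powers decay into a vector-valued Hardy space, known in system theory as an
  observability operator.\<close>

definition emb :: "('i \<Rightarrow> complex) \<Rightarrow> nat \<times> 'i \<Rightarrow> complex" where
  "emb h = (\<lambda>(n, i). defect T1 ((hadj T1 ^^ n) h) i)"

lemma slice_emb: "slice (emb h) n = defect T1 ((hadj T1 ^^ n) h)"
  by (auto simp: emb_def)

lemma emb_sums: "(\<lambda>n. (l2_norm (slice (emb h) n))\<^sup>2) sums (l2_norm h)\<^sup>2"
proof -
  have "(\<Sum>n<N. (l2_norm (slice (emb h) n))\<^sup>2) = (l2_norm h)\<^sup>2 - (l2_norm ((hadj T1 ^^ N) h))\<^sup>2" for N
    by (induction N) (simp_all add: slice_emb defect_norm_sq[OF T1])
  moreover have "(\<lambda>N. (l2_norm h)\<^sup>2 - (l2_norm ((hadj T1 ^^ N) h))\<^sup>2) \<longlonglongrightarrow> (l2_norm h)\<^sup>2 - 0\<^sup>2"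
    by (intro tendsto_diff tendsto_const tendsto_power cnu_powers_tendsto_0[OF T1 cnu])
  ultimately show ?thesis
    by (simp add: sums_def)
qed

lemma emb_l2 [simp]: "l2 (emb h)"
  using emb_sums[of h] by (intro l2_slicesI) (auto simp: sums_iff)

lemma emb_norm: "l2_norm (emb h) = l2_norm h"
proof -
  have "(l2_norm (emb h))\<^sup>2 = (l2_norm h)\<^sup>2"
    using sums_unique2[OF emb_sums l2_norm_sq_slices[OF emb_l2]] by simp
  then show ?thesis
    by simp
qed

lemma emb_linear: "op_linear UNIV emb"
proof -
  note L = op_linearD[OF defect_linear[OF T1]]
  note H = op_linearD[OF op_linear_funpow[OF hadj_linear[OF T1_linear]]]
  have "emb (x + y) = emb x + emb y" for x y
    by (rule slice_ext) (simp add: slice_emb slice_add L H)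
  moreover have "emb (scl c x) = scl c (emb x)" for c x
    by (rule slice_ext) (simp add: slice_emb slice_scl L H)
  ultimately show ?thesis
    by (simp add: op_linear_def)
qed

text \<open>The sum is \<open>m(T1)^*\<close> applied to \<open>g\<close>, and
  \<open>m(T1) = 0\<close>.\<close>

lemma min_poly_hadj: "(\<Sum>k\<le>degree (min_poly T1). scl (cnj (coeff (min_poly T1) k)) ((hadj T1 ^^ k) g)) = 0"
proof (rule l2_inner_ext)
  fix z
  have adj: "l2_inner ((hadj T1 ^^ k) g) z = l2_inner g ((T1 ^^ k) z)" for k
    using hadj_funpow_inner[OF T1_linear, of k z g] by (metis l2_inner_commute)
  have "l2_inner (\<Sum>k\<le>degree (min_poly T1). scl (cnj (coeff (min_poly T1) k)) ((hadj T1 ^^ k) g)) z =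
      (\<Sum>k\<le>degree (min_poly T1). l2_inner g (scl (coeff (min_poly T1) k) ((T1 ^^ k) z)))"
    by (simp add: l2_inner_sum_left l2_inner_scl_left l2_inner_scl_right adj)
  also have "\<dots> = l2_inner g (op_poly (min_poly T1) T1 z)"
    unfolding op_poly_def by (rule l2_inner_sum_right[symmetric]) auto
  finally show "l2_inner (\<Sum>k\<le>degree (min_poly T1). scl (cnj (coeff (min_poly T1) k)) ((hadj T1 ^^ k) g)) z =
      l2_inner 0 z"
    by (simp add: min_poly_annihilates[OF T1_linear])
qed

text \<open>Advancing the Taylor index applies the adjoint of \<open>T1\<close> under the defect
  operator. Hence \<open>recur\<close> evaluates the conjugated minimal polynomial at that adjoint,
  which gives zero.\<close>

lemma emb_in_NTD: "emb h \<in> NTD T1"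
proof -
  have "recur (min_poly T1) (coord (emb h) i) n = 0" for i n
  proof -
    note L = defect_linear[OF T1]
    let ?s = "\<lambda>k. scl (cnj (coeff (min_poly T1) k)) ((hadj T1 ^^ k) ((hadj T1 ^^ n) h))"
    have "recur (min_poly T1) (coord (emb h) i) n = (\<Sum>k\<le>degree (min_poly T1). defect T1 (?s k) i)"
      unfolding recur_def
      by (intro sum.cong) (simp_all add: emb_def op_linearD(2)[OF L] funpow_add add.commute[of n])
    also have "\<dots> = defect T1 (\<Sum>k\<le>degree (min_poly T1). ?s k) i"
      by (subst op_linear_sum[OF L csubspace_UNIV]) (simp_all add: sum_fun_apply)
    also have "\<dots> = 0"
      unfolding min_poly_hadj by (simp add: op_linear_zero[OF L])
    finally show ?thesis .
  qed
  then have "recur (min_poly T1) (coord (emb h) i) = 0" for i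
    by auto
  moreover have "l2 (coord (emb h) i)" for i
    using emb_l2 l2_coord_iff by blast
  ultimately show ?thesis
    by (simp add: NTD_iff[OF T1 cnu] model_space_iff[OF T1 cnu] slice_emb defect_in_defect_space[OF T1])
qed

text \<open>The adjoint \<open>\<Pi>^*\<close>, written out in coordinates because the earlier Riesz
  argument concerns finite index sets on both sides.\<close>

definition coemb :: "(nat \<times> 'i \<Rightarrow> complex) \<Rightarrow> 'i \<Rightarrow> complex" where
  "coemb x = (\<lambda>i. l2_inner x (emb (unit_vec i)))"

lemma coemb_inner:
  assumes "l2 x"
  shows "l2_inner (coemb x) h = l2_inner x (emb h)"
proof -
  have "emb h = emb (\<Sum>i\<in>UNIV. scl (h i) (unit_vec i))"
    by (simp only: unit_vec_expansion)
  also have "\<dots> = (\<Sum>i\<in>UNIV. scl (h i) (emb (unit_vec i)))"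
    by (subst op_linear_sum[OF emb_linear csubspace_UNIV]) (simp_all add: op_linearD(2)[OF emb_linear])
  finally have "l2_inner x (emb h) = (\<Sum>i\<in>UNIV. l2_inner x (scl (h i) (emb (unit_vec i))))"
    using assms by (simp add: l2_inner_sum_right)
  then show ?thesis
    unfolding l2_inner_finite[of "coemb x"]
    by (simp add: coemb_def l2_inner_scl_right mult.commute)
qed

lemma coemb_norm_le:
  assumes "l2 x"
  shows "l2_norm (coemb x) \<le> l2_norm x"
proof -
  have "(l2_norm (coemb x))\<^sup>2 = cmod (l2_inner (coemb x) (coemb x))"
    by (simp add: l2_inner_self norm_power)
  also have "\<dots> \<le> l2_norm x * l2_norm (coemb x)"
    using l2_cauchy_schwarz[OF assms emb_l2, of "coemb x"] by (simp add: coemb_inner[OF assms] emb_norm)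
  finally show ?thesis
    using l2_norm_nonneg[of x] l2_norm_nonneg[of "coemb x"]
    by (cases "l2_norm (coemb x) = 0") (auto simp: power2_eq_square)
qed

text \<open>The cross term is \<open>||\<Pi> h||^2 = ||h||^2\<close>, so
  \<open>||\<Pi>^* \<Pi> h - h||^2 = ||\<Pi>^* \<Pi> h||^2 - ||h||^2\<close>, and this is not
  positive as \<open>\<Pi>^*\<close> is contractive.\<close>

lemma coemb_emb: "coemb (emb h) = h"
proof -
  have "(l2_norm (coemb (emb h) - h))\<^sup>2 = (l2_norm (coemb (emb h)))\<^sup>2 - (l2_norm h)\<^sup>2"
    by (subst l2_norm_sq_diff) (simp_all add: coemb_inner l2_inner_self emb_norm)
  also have "\<dots> \<le> 0"
    using power_mono[OF coemb_norm_le[of "emb h"], of 2] by (simp add: emb_norm)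
  finally have "l2_norm (coemb (emb h) - h) = 0"
    by simp
  then show ?thesis
    using l2_norm_eq_0[of "coemb (emb h) - h"] by simp
qed

lemma coemb_linear: "op_linear (Collect l2) coemb"
  by (auto simp: op_linear_def coemb_def l2_inner_add_left l2_inner_scl_left)

lemma coemb_eqI:
  assumes "l2 x" "\<And>h. l2_inner x (emb h) = l2_inner v h"
  shows "coemb x = v"
  by (rule l2_inner_ext) (simp add: coemb_inner assms)

section \<open>Compressions to the model space and the norm inequality\<close>

lemma NTD_subspace: "csubspace (NTD T1)"
  using determined_by_NTD[OF T1 cnu] by (simp add: determined_by_def)

lemma NTD_l2: "x \<in> NTD T1 \<Longrightarrow> l2 x"
  using csubspaceD(4)[OF NTD_subspace] .

lemma NTD_H2D: "x \<in> NTD T1 \<Longrightarrow> x \<in> H2D T1"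
  by (simp add: NTD_iff[OF T1 cnu] H2D_iff[OF T1])

lemma coord_ampl: "coord (ampl F x) i = F (coord x i)"
  by (simp add: ampl_def coord_def)

text \<open>The delicate claim is membership in \<open>NTD T1\<close>: the projection is applied to
  each scalar coordinate separately, whereas lying in the defect space is a condition across
  coordinates.\<close>

lemma ampl_univ_model:
  assumes x: "x \<in> NTD T1"
  shows "ampl (univ_model T1) x \<in> NTD T1"
    and "l2_norm (ampl (univ_model T1) x) \<le> l2_norm x"
    and "coemb (ampl (univ_model T1) x) = T1 (coemb x)"
proof -
  note det = determined_by_model_space[OF T1 cnu]
  have lx: "l2 x" and lc: "\<And>i. l2 (coord x i)" and rx: "\<And>n. slice x n \<in> D1"
    using x NTD_l2[OF x] l2_coord_iff by (auto simp: NTD_iff[OF T1 cnu])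
  define y where "y = ampl (univ_model T1) x"
  have cy: "coord y i = proj (model_space T1) (shift (coord x i))" for i
    by (simp add: y_def coord_ampl univ_model_def)
  have cm: "coord y i \<in> model_space T1" "l2 (coord y i)" for i
    unfolding cy using proj_in[OF det l2_shift[OF lc]] proj_l2[OF det l2_shift[OF lc]] by auto
  then have ly: "l2 y"
    by (simp add: l2_coord_iff)
  have "slice y n \<in> D1" for n
  proof -
    define P where "P = proj D1"
    note dD = determined_by_UNIV[OF D1]
    \<comment> \<open>A vector \<open>w\<close> orthogonal to \<open>D1\<close> is a linear relation
      among the coordinates of \<open>x\<close>. Shift and projection are linear in the Hardy
      variable, so the relation persists for \<open>y\<close>. Taking for \<open>w\<close> the
      residual of \<open>slice y n\<close> then shows that this residual vanishes.\<close>
    have "l2_inner (slice y n) w = 0" if w: "\<And>v. v \<in> D1 \<Longrightarrow> l2_inner v w = 0" for w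
    proof -
      have z: "(\<Sum>i\<in>UNIV. scl (cnj (w i)) (shift (coord x i))) = 0"
      proof
        fix k
        show "(\<Sum>i\<in>UNIV. scl (cnj (w i)) (shift (coord x i))) k = 0 k"
        proof (cases k)
          case (Suc l)
          have "(\<Sum>i\<in>UNIV. scl (cnj (w i)) (shift (coord x i))) k = l2_inner (slice x l) w"
            by (simp add: Suc sum_fun_apply shift_def l2_inner_finite mult.commute)
          then show ?thesis
            using w[OF rx] by simp
        qed (simp add: sum_fun_apply shift_def)
      qed
      have "(\<Sum>i\<in>UNIV. scl (cnj (w i)) (coord y i)) =
          (\<Sum>i\<in>UNIV. proj (model_space T1) (scl (cnj (w i)) (shift (coord x i))))"
        by (simp add: cy proj_scl[OF det] lc)
      also have "\<dots> = proj (model_space T1) (\<Sum>i\<in>UNIV. scl (cnj (w i)) (shift (coord x i)))"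
      proof -
        have pl: "op_linear (Collect l2) (proj (model_space T1))"
          by (simp add: op_linear_def proj_add[OF det] proj_scl[OF det])
        have cs: "csubspace (Collect l2)"
          by (simp add: csubspace_def)
        show ?thesis
          by (rule op_linear_sum[OF pl cs, symmetric]) (simp add: lc)
      qed
      also have "\<dots> = 0"
        unfolding z using det by (intro proj_id) (auto simp: determined_by_def csubspaceD(1))
      finally have "(\<Sum>i\<in>UNIV. scl (cnj (w i)) (coord y i)) n = 0"
        by simp
      then show ?thesis
        by (simp add: sum_fun_apply l2_inner_finite mult.commute)
    qed
    moreover have "l2_inner v (slice y n - P (slice y n)) = 0" if "v \<in> D1" for v
      using proj_orth[OF dD _ that, of "slice y n"] unfolding P_def by (metis complex_cnj_zero l2_finite l2_inner_commute)
    ultimately have 1: "l2_inner (slice y n) (slice y n - P (slice y n)) = 0"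
      by blast
    have 2: "l2_inner (P (slice y n)) (slice y n - P (slice y n)) = 0"
      unfolding P_def using proj_orth[OF dD _ proj_in[OF dD], of "slice y n" "slice y n"]
      by (metis complex_cnj_zero l2_finite l2_inner_commute)
    have "l2_inner (slice y n - P (slice y n)) (slice y n - P (slice y n)) = 0"
      by (subst l2_inner_diff_left) (simp_all add: 1 2)
    then have "slice y n = P (slice y n)"
      using l2_inner_self_eq_0[of "slice y n - P (slice y n)"] by simp
    then show ?thesis
      using proj_in[OF dD, of "slice y n"] by (simp add: P_def)
  qed
  then show "ampl (univ_model T1) x \<in> NTD T1"
    unfolding y_def[symmetric] using ly cm by (simp add: NTD_iff[OF T1 cnu])
  have "(l2_norm y)\<^sup>2 \<le> (l2_norm x)\<^sup>2"
    unfolding l2_norm_sq_coords[OF ly] l2_norm_sq_coords[OF lx]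
  proof (intro sum_mono power_mono)
    show "l2_norm (coord y i) \<le> l2_norm (coord x i)" for i
      using proj_norm_le[OF det l2_shift[OF lc], of i] by (simp add: cy l2_norm_shift)
  qed simp
  then show "l2_norm (ampl (univ_model T1) x) \<le> l2_norm x"
    unfolding y_def[symmetric] by (rule power2_le_imp_le) simp
  show "coemb (ampl (univ_model T1) x) = T1 (coemb x)"
    unfolding y_def[symmetric]
  proof (rule coemb_eqI[OF ly])
    fix h
    have "l2_inner y (emb h) = (\<Sum>i\<in>UNIV. l2_inner (coord y i) (coord (emb h) i))"
      by (rule l2_inner_coords[OF ly emb_l2])
    also have "\<dots> = (\<Sum>i\<in>UNIV. l2_inner (coord x i) (coord (emb (hadj T1 h)) i))"
    proof (rule sum.cong[OF refl])
      fix i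
      \<comment> \<open>Against a member of the model space the projection drops out. The shift then
        moves over as \<open>backshift\<close>, which sends \<open>emb h\<close> to
        \<open>emb (hadj T1 h)\<close>.\<close>
      have "coord (emb h) i \<in> model_space T1"
        using emb_in_NTD[of h] by (simp add: NTD_iff[OF T1 cnu])
      then have "l2_inner (coord y i) (coord (emb h) i) = l2_inner (shift (coord x i)) (coord (emb h) i)"
        unfolding cy by (rule proj_inner[OF det l2_shift[OF lc]])
      also have "\<dots> = l2_inner (coord x i) (backshift (coord (emb h) i))"
        using l2_inner_shift[of "coord (emb h) i" "coord x i"] by (metis l2_inner_commute)
      also have "backshift (coord (emb h) i) = coord (emb (hadj T1 h)) i"
        by (simp add: backshift_def emb_def coord_def funpow_swap1)
      finally show "l2_inner (coord y i) (coord (emb h) i) = l2_inner (coord x i) (coord (emb (hadj T1 h)) i)" .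
    qed
    also have "\<dots> = l2_inner (T1 (coemb x)) h"
      by (simp add: l2_inner_coords[OF lx emb_l2, symmetric] hadj_inner[OF T1_linear] coemb_inner[OF lx])
    finally show "l2_inner y (emb h) = l2_inner (T1 (coemb x)) h" .
  qed
qed

text \<open>Unitarity of \<open>U\<close> turns the difference of the two inner products into a telescoping sum.\<close>

lemma coemb_transfer_mult:
  assumes x: "x \<in> H2D T1"
  shows "coemb (transfer_mult T1 T2 U x) = T2 (coemb x)"
proof -
  define y where "y = transfer_mult T1 T2 U x"
  have lx: "l2 x" and rx: "\<And>n. slice x n \<in> D1"
    using x by (auto simp: H2D_iff[OF T1])
  have ly: "l2 y"
    using transfer_mult_isometry(1)[OF x] by (simp add: y_def H2D_iff[OF T1])
  define st where "st = state (slice x)"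
  show ?thesis
    unfolding y_def[symmetric]
  proof (rule coemb_eqI[OF ly])
    fix h
    \<comment> \<open>The pairing of the second components, left over when the equality of inner
      products under \<open>U\<close> is separated from the first components.\<close>
    define c where "c n = l2_inner (st n) (defect T2 ((hadj T1 ^^ n) h))" for n
    have step: "l2_inner (slice y n) (slice (emb h) n) - l2_inner (slice x n) (slice (emb (hadj T2 h)) n)
        = c n - c (Suc n)" for n
    proof -
      define g where "g = (hadj T1 ^^ n) h"
      have z: "dsum (slice y n) (st (Suc n)) \<in> dspace T1 T2"
        unfolding y_def slice_transfer_mult st_def by (rule dsum_in_dspace[OF out_in state_in])
      have w: "dsum (defect T1 g) (defect T2 (hadj T1 g)) \<in> dspace T1 T2"
        by (intro dsum_in_dspace defect_in_defect_space T1 T2)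
      have "U (dsum (slice y n) (st (Suc n))) = dsum (slice x n) (st n)"
        unfolding y_def slice_transfer_mult st_def out_def state.simps by (rule U_adjoint[OF rx state_in])
      then have "l2_inner (dsum (slice x n) (st n)) (dsum (defect T1 (hadj T2 g)) (defect T2 g)) =
          l2_inner (dsum (slice y n) (st (Suc n))) (dsum (defect T1 g) (defect T2 (hadj T1 g)))"
        using U_inner[OF z w] U_extends[of g] by simp
      \<comment> \<open>Commutation of \<open>T1\<close> and \<open>T2\<close> enters here: it
        identifies slice \<open>n\<close> of \<open>emb (hadj T2 h)\<close> with the first component
        of the extension relation at \<open>g\<close>.\<close>
      moreover have "(hadj T1 ^^ n) (hadj T2 h) = hadj T2 g"
        unfolding g_def by (rule hadj_commute_funpow[OF T1_linear T2_linear commute])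
      ultimately show ?thesis
        by (simp add: l2_inner_dsum slice_emb c_def g_def algebra_simps)
    qed
    have c0: "c 0 = 0"
      by (simp add: c_def st_def)
    \<comment> \<open>The states stay bounded by the input energy, while the adjoint powers of
      \<open>T1\<close> applied to \<open>h\<close> tend to zero. Together with
      \<open>c 0 = 0\<close>, both ends of the telescoping sum vanish.\<close>
    have "(\<lambda>n. c n) \<longlonglongrightarrow> 0"
    proof (rule Lim_null_comparison)
      show "\<forall>\<^sub>F n in sequentially. norm (c n) \<le> l2_norm x * l2_norm ((hadj T1 ^^ n) h)"
      proof (intro always_eventually allI)
        fix n
        have "(l2_norm (st n))\<^sup>2 \<le> (\<Sum>k<n. (l2_norm (slice x k))\<^sup>2)"
          unfolding st_def by (rule state_norm_le) (rule rx)
        also have "\<dots> \<le> (l2_norm x)\<^sup>2"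
          using l2_norm_sq_slices[OF lx] sum_le_suminf[of "\<lambda>k. (l2_norm (slice x k))\<^sup>2" "{..<n}"]
          by (simp add: sums_iff)
        finally have "l2_norm (st n) \<le> l2_norm x"
          by (rule power2_le_imp_le) simp
        moreover have "(l2_norm (defect T2 ((hadj T1 ^^ n) h)))\<^sup>2 \<le> (l2_norm ((hadj T1 ^^ n) h))\<^sup>2"
          by (simp add: defect_norm_sq[OF T2])
        then have "l2_norm (defect T2 ((hadj T1 ^^ n) h)) \<le> l2_norm ((hadj T1 ^^ n) h)"
          by (rule power2_le_imp_le) simp
        ultimately have "l2_norm (st n) * l2_norm (defect T2 ((hadj T1 ^^ n) h)) \<le>
            l2_norm x * l2_norm ((hadj T1 ^^ n) h)"
          by (intro mult_mono) auto
        then show "norm (c n) \<le> l2_norm x * l2_norm ((hadj T1 ^^ n) h)"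
          unfolding c_def using l2_cauchy_schwarz[of "st n" "defect T2 ((hadj T1 ^^ n) h)"] by simp
      qed
      show "(\<lambda>n. l2_norm x * l2_norm ((hadj T1 ^^ n) h)) \<longlonglongrightarrow> 0"
        by (intro tendsto_mult_right_zero cnu_powers_tendsto_0[OF T1 cnu])
    qed
    then have "(\<lambda>n. c n - c (Suc n)) sums (c 0 - 0)"
      by (rule telescope_sums')
    moreover have "(\<lambda>n. c n - c (Suc n)) sums (l2_inner y (emb h) - l2_inner x (emb (hadj T2 h)))"
      unfolding step[symmetric] by (intro sums_diff l2_inner_slices lx ly emb_l2)
    ultimately have "l2_inner y (emb h) = l2_inner x (emb (hadj T2 h))"
      using sums_unique2 c0 by fastforce
    then show "l2_inner y (emb h) = l2_inner (T2 (coemb x)) h"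
      by (simp add: hadj_inner[OF T2_linear] coemb_inner[OF lx])
  qed
qed

lemma transfer_model_props:
  assumes x: "x \<in> NTD T1"
  shows "transfer_model T1 T2 U x \<in> NTD T1"
    and "l2_norm (transfer_model T1 T2 U x) \<le> l2_norm x"
    and "coemb (transfer_model T1 T2 U x) = T2 (coemb x)"
proof -
  note det = determined_by_NTD[OF T1 cnu]
  define y where "y = transfer_mult T1 T2 U x"
  have y: "y \<in> H2D T1" "l2_norm y = l2_norm x"
    unfolding y_def using transfer_mult_isometry[OF NTD_H2D[OF x]] by auto
  then have ly: "l2 y"
    by (simp add: H2D_iff[OF T1])
  have m: "transfer_model T1 T2 U x = proj (NTD T1) y"
    by (simp add: transfer_model_def y_def)
  show "transfer_model T1 T2 U x \<in> NTD T1"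
    unfolding m by (rule proj_in[OF det ly])
  show "l2_norm (transfer_model T1 T2 U x) \<le> l2_norm x"
    unfolding m y(2)[symmetric] by (rule proj_norm_le[OF det ly])
  \<comment> \<open>The range of \<open>emb\<close> lies in \<open>NTD T1\<close>, so the
    compression cannot be seen by \<open>coemb\<close>.\<close>
  have "coemb (proj (NTD T1) y) = coemb y"
    by (rule coemb_eqI) (simp_all add: proj_l2[OF det ly] proj_inner[OF det ly emb_in_NTD] coemb_inner ly)
  then show "coemb (transfer_model T1 T2 U x) = T2 (coemb x)"
    unfolding m by (simp add: y_def coemb_transfer_mult[OF NTD_H2D[OF x]])
qed

lemma block_norm_model_le:
  "block_norm k UNIV (\<lambda>r s. eval2 (p r s) T1 T2)
   \<le> block_norm k (NTD T1) (\<lambda>r s. eval2 (p r s) (ampl (univ_model T1)) (transfer_model T1 T2 U))"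
proof (rule block_norm_le[where J = emb and R = coemb])
  have R: "op_linear (NTD T1) coemb"
    using op_linearD[OF coemb_linear] NTD_l2 unfolding op_linear_def by blast
  have mono: "eval2 q (ampl (univ_model T1)) (transfer_model T1 T2 U) x \<in> NTD T1"
    "coemb (eval2 q (ampl (univ_model T1)) (transfer_model T1 T2 U) x) = eval2 q T1 T2 (coemb x)"
    if x: "x \<in> NTD T1" for q x
    using eval2_intertwine[where X = "ampl (univ_model T1)" and Y = "transfer_model T1 T2 U" and
        X' = T1 and Y' = T2 and p = q, OF NTD_subspace R x] ampl_univ_model transfer_model_props
    by blast+
  show "op_linear (NTD T1) coemb"
    by (rule R)
  show "csubspace (UNIV :: ('i \<Rightarrow> complex) set)" "csubspace (NTD T1)"
    by (rule csubspace_UNIV, rule NTD_subspace)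
  show "emb h \<in> NTD T1" "l2_norm (emb h) = l2_norm h" for h
    by (rule emb_in_NTD, rule emb_norm)
  show "l2_norm (coemb y) \<le> l2_norm y" if "y \<in> NTD T1" for y
    by (rule coemb_norm_le[OF NTD_l2[OF that]])
  fix r s
  show "eval2 (p r s) (ampl (univ_model T1)) (transfer_model T1 T2 U) x \<in> NTD T1" if "x \<in> NTD T1" for x
    by (rule mono(1)[OF that])
  \<comment> \<open>Both operators are contractions on \<open>NTD T1\<close>, so the sum of the
    moduli of the coefficients serves as the bound.\<close>
  show "l2_norm (eval2 (p r s) (ampl (univ_model T1)) (transfer_model T1 T2 U) x) \<le>
      (\<Sum>j\<le>degree (p r s). \<Sum>i\<le>degree (coeff (p r s) j). cmod (coeff (coeff (p r s) j) i)) * l2_norm x"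
    if "x \<in> NTD T1" for x
    by (rule eval2_norm_le[OF NTD_subspace that]) (intro ampl_univ_model transfer_model_props; assumption)+
  show "eval2 (p r s) T1 T2 h =
      coemb (eval2 (p r s) (ampl (univ_model T1)) (transfer_model T1 T2 U) (emb h))" for h
    by (simp add: mono(2)[OF emb_in_NTD] coemb_emb)
qed

end

theorem mainTheorem13:
  fixes T1 T2 :: "('i::finite \<Rightarrow> complex) \<Rightarrow> ('i \<Rightarrow> complex)"
    and U :: "('i + 'i \<Rightarrow> complex) \<Rightarrow> ('i + 'i \<Rightarrow> complex)"
  assumes "contraction T1" and "contraction T2" and "T1 \<circ> T2 = T2 \<circ> T1"
    and "cnu T1"
    and "U \<in> U_set T1 T2"
  shows "isometric_analytic_toeplitz (H2D T1) (transfer_mult T1 T2 U) \<and>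
    (\<forall>(k::nat) (p :: nat \<Rightarrow> nat \<Rightarrow> complex poly poly).
       block_norm k UNIV (\<lambda>r s. eval2 (p r s) T1 T2)
       \<le> block_norm k (NTD T1)
            (\<lambda>r s. eval2 (p r s) (ampl (univ_model T1)) (transfer_model T1 T2 U)))"
proof -
  interpret commuting_dilation T1 T2 U
    using assms by unfold_locales (auto simp: U_set_def)
  show ?thesis
    using transfer_mult_isometric_toeplitz block_norm_model_le by blast
qed

end
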